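(* Let $k\ge 2$ be an integer. If the Green conjecture is true for a canonical binary curve $\tilde C$ of genus $2k-1$ (that is, $K_{p,2}(\tilde C,\omega_{\tilde C})=0$ for all $0\le p\le k-2$), then it is true for the canonical binary curve $C$ of genus $2k$ for a generic choice of its parameters $a_{i,j}$ (that is, $K_{p,2}(C,\omega_C)=0$ for all $0\le p\le k-2$).
   Context: We work over $\mathbb{C}$. A binary curve of genus $g$ is a stable curve consisting of two smooth rational components $C_1,C_2$ meeting transversally at $g+1$ points. Koszul cohomology: for a projective curve $C$ and a line bundle $L$ on $C$, $K_{p,q}(C,L)$ is the cohomology at the middle term of $$\Lambda^{p+1}H^0(L)\otimes H^0(L^{q-1})\to \Lambda^{p}H^0(L)\otimes H^0(L^{q})\to \Lambda^{p-1}H^0(L)\otimes H^0(L^{q+1}),$$ where the maps are $s_1\wedge\dots\wedge s_m\otimes u\mapsto\sum_{l}(-1)^l s_1\wedge\dots\wedge\hat{s_l}\wedge\dots\wedge s_m\otimes(s_lu)$. The (generic) Green conjecture is true for a canonically embedded curve $C$ of genus $g$ if $K_{p,1}(C,\omega_C)=0$ for all $p\ge\lfloor g/2\rfloor$, equivalently (by duality) $K_{p,2}(C,\omega_C)=0$ for all $0\le p\le\lfloor (g-3)/2\rfloor$. Canonical binary curves of genus $g\ge 3$ (the same construction is used for every genus): let $a_{i,j}\in\mathbb{C}$ ($1\le i\le g$, $j=1,2$) be parameters, $M_j(t,u)=\prod_{r=1}^{g}(t-a_{r,j}u)$, and for $j=1,2$ let $C_j$ be the image of $$\phi_j:\mathbb{P}^1\to\mathbb{P}^{g-1},\qquad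 \phi_j(t,u)=\Big[\tfrac{M_j(t,u)}{t-a_{1,j}u},\dots,\tfrac{M_j(t,u)}{t-a_{g,j}u}\Big].$$ Then $\phi_1,\phi_2$ both send $[a_{l,j},1]$ to the $l$-th coordinate point $P_l$ ($1\le l\le g$) and $[1,0]$ to $P_{g+1}=[1,\dots,1]$. For generic $a_{i,j}$ the curve $C=C_1\cup C_2$ is a binary curve of genus $g$ with nodes $P_1,\dots,P_{g+1}$, embedded by $|\omega_C|$; such a curve is called here a canonical binary curve of genus $g$. "Generic choice of the parameters" means for all parameters in a nonempty Zariski open subset of the parameter space $\mathbb{C}^{2g}$. *)

theory Defs
  imports
    "HOL-Analysis.Analysis"
    "HOL-Computational_Algebra.Polynomial"
    "HOL-Library.Poly_Mapping"
begin

section \<open>The curves \<open>C\<^sub>j\<close> in projective space\<close>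

text \<open>
  Vectors of \<open>\<complex>\<^sup>g\<close> are functions on the index set \<open>{1..g}\<close>, extended by \<open>undefined\<close> outside of it;
  a point of \<open>\<P>\<^sup>g\<^sup>-\<^sup>1\<close> is the set of all nonzero multiples of a nonzero vector.
  The parameter \<open>a\<^sub>i\<^sub>,\<^sub>j\<close> is written \<open>a (i, j)\<close>.
\<close>

definition proj_point :: "nat \<Rightarrow> (nat \<Rightarrow> complex) \<Rightarrow> (nat \<Rightarrow> complex) set" where
  "proj_point g v = {\<lambda>i\<in>{1..g}. c * v i | c. c \<noteq> 0}"

text \<open>The form \<open>M\<^sub>j(t,u) / (t - a\<^sub>i\<^sub>,\<^sub>j u)\<close>.\<close>

definition phi :: "nat \<Rightarrow> (nat \<times> nat \<Rightarrow> complex) \<Rightarrow> nat \<Rightarrow> complex \<times> complex \<Rightarrow> nat \<Rightarrow> complex" where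
  "phi g a j = (\<lambda>(t, u). \<lambda>i\<in>{1..g}. \<Prod>r\<in>{1..g} - {i}. t - a (r, j) * u)"

definition phi_dt :: "nat \<Rightarrow> (nat \<times> nat \<Rightarrow> complex) \<Rightarrow> nat \<Rightarrow> complex \<times> complex \<Rightarrow> nat \<Rightarrow> complex" where
  "phi_dt g a j = (\<lambda>(t, u). \<lambda>i\<in>{1..g}. deriv (\<lambda>z. phi g a j (z, u) i) t)"

definition phi_du :: "nat \<Rightarrow> (nat \<times> nat \<Rightarrow> complex) \<Rightarrow> nat \<Rightarrow> complex \<times> complex \<Rightarrow> nat \<Rightarrow> complex" where
  "phi_du g a j = (\<lambda>(t, u). \<lambda>i\<in>{1..g}. deriv (\<lambda>z. phi g a j (t, z) i) u)"

definition component :: "nat \<Rightarrow> (nat \<times> nat \<Rightarrow> complex) \<Rightarrow> nat \<Rightarrow> (nat \<Rightarrow> complex) set set" where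
  "component g a j = {proj_point g (phi g a j x) | x. x \<noteq> (0, 0)}"

definition node :: "nat \<Rightarrow> nat \<Rightarrow> (nat \<Rightarrow> complex) set" where
  "node g l = proj_point g (\<lambda>i. if l = Suc g \<or> i = l then 1 else 0)"

text \<open>
  \<open>\<phi>\<^sub>j\<close> is an embedding of \<open>\<P>\<^sup>1\<close>: it is defined everywhere, injective and immersive. In homogeneous
  coordinates, being immersive means that the two partial derivatives are linearly independent.
\<close>

definition smooth_rational :: "nat \<Rightarrow> (nat \<times> nat \<Rightarrow> complex) \<Rightarrow> nat \<Rightarrow> bool" where
  "smooth_rational g a j \<longleftrightarrow>
     (\<forall>x. x \<noteq> (0, 0) \<longrightarrow> (\<exists>i\<in>{1..g}. phi g a j x i \<noteq> 0)) \<and>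
     (\<forall>t u t' u'. (t, u) \<noteq> (0, 0) \<and> (t', u') \<noteq> (0, 0) \<and>
        proj_point g (phi g a j (t, u)) = proj_point g (phi g a j (t', u')) \<longrightarrow> t * u' = t' * u) \<and>
     (\<forall>x \<alpha> \<beta>. x \<noteq> (0, 0) \<and>
        (\<forall>i\<in>{1..g}. \<alpha> * phi_dt g a j x i + \<beta> * phi_du g a j x i = 0) \<longrightarrow> \<alpha> = 0 \<and> \<beta> = 0)"

text \<open>The plane in \<open>\<complex>\<^sup>g\<close> over the projective tangent line of \<open>C\<^sub>j\<close> at \<open>\<phi>\<^sub>j(x)\<close>.\<close>

definition tangent :: "nat \<Rightarrow> (nat \<times> nat \<Rightarrow> complex) \<Rightarrow> nat \<Rightarrow> complex \<times> complex \<Rightarrow> (nat \<Rightarrow> complex) set" where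
  "tangent g a j x = {\<lambda>i\<in>{1..g}. \<alpha> * phi_dt g a j x i + \<beta> * phi_du g a j x i | \<alpha> \<beta>. True}"

text \<open>
  Two smooth branches through a point of projective space meet transversally there if and only if
  their tangent lines are different.
\<close>

definition canonical_binary_curve :: "nat \<Rightarrow> (nat \<times> nat \<Rightarrow> complex) \<Rightarrow> bool" where
  "canonical_binary_curve g a \<longleftrightarrow>
     smooth_rational g a 1 \<and> smooth_rational g a 2 \<and>
     component g a 1 \<inter> component g a 2 = node g ` {1..Suc g} \<and> inj_on (node g) {1..Suc g} \<and>
     (\<forall>x y. x \<noteq> (0, 0) \<and> y \<noteq> (0, 0) \<and> proj_point g (phi g a 1 x) = proj_point g (phi g a 2 y)
        \<longrightarrow> tangent g a 1 x \<noteq> tangent g a 2 y)"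

section \<open>Sections of the powers of the dualizing sheaf\<close>

text \<open>
  The curve \<open>C\<close> is obtained from two copies of \<open>\<P>\<^sup>1\<close> by gluing \<open>a\<^sub>l\<^sub>,\<^sub>1\<close> to \<open>a\<^sub>l\<^sub>,\<^sub>2\<close> for \<open>l = 1, \<dots>, g\<close> and
  \<open>\<infinity>\<close> to \<open>\<infinity>\<close>. A section of \<open>\<omega>\<^sub>C\<close> is a pair of meromorphic differentials on the two components, with
  at most simple poles at the points over the nodes and no other poles, such that the two residues
  over each node add up to 0. Accordingly, a section of the \<open>q\<close>-th power of \<open>\<omega>\<^sub>C\<close> is a pair
  \<open>(\<eta>\<^sub>1, \<eta>\<^sub>2)\<close> of \<open>q\<close>-differentials with poles of order at most \<open>q\<close> at the points over the nodes, such that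
  over each node the leading coefficient of \<open>\<eta>\<^sub>1\<close> is \<open>(-1)\<^sup>q\<close> times that of \<open>\<eta>\<^sub>2\<close> (the leading coefficient
  of \<open>(c s\<^sup>-\<^sup>q + \<dots>) ds\<^sup>q\<close>, which does not depend on the local coordinate \<open>s\<close>, is \<open>c\<close>).

  The \<open>q\<close>-differentials on the \<open>j\<close>-th component with such poles are \<open>f(t) dt\<^sup>q / M\<^sub>j(t,1)\<^sup>q\<close> for the
  polynomials \<open>f\<close> of degree at most \<open>q (g - 1)\<close>, and sections are stored as pairs \<open>(f\<^sub>1, f\<^sub>2)\<close> of such
  numerators. The \<open>i\<close>-th coordinate of \<open>\<P>\<^sup>g\<^sup>-\<^sup>1\<close> is the section
  \<open>(dt / (t - a\<^sub>i\<^sub>,\<^sub>1), - dt / (t - a\<^sub>i\<^sub>,\<^sub>2))\<close> of \<open>\<omega>\<^sub>C\<close>.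
\<close>

type_synonym sec = "complex poly \<times> complex poly"

definition sec_scale :: "complex \<Rightarrow> sec \<Rightarrow> sec" where
  "sec_scale c s = (smult c (fst s), smult c (snd s))"

definition sec_mult :: "sec \<Rightarrow> sec \<Rightarrow> sec" where
  "sec_mult s s' = (fst s * fst s', snd s * snd s')"

definition M_poly :: "nat \<Rightarrow> (nat \<times> nat \<Rightarrow> complex) \<Rightarrow> nat \<Rightarrow> complex poly" where
  "M_poly g a j = (\<Prod>r\<in>{1..g}. [:- a (r, j), 1:])"

text \<open>
  The leading coefficient of \<open>f(t) dt\<^sup>q / M\<^sub>j(t,1)\<^sup>q\<close> at the \<open>l\<close>-th node; at infinity (\<open>l = g + 1\<close>)
  substitute \<open>t = 1/s\<close>, \<open>dt = - ds / s\<^sup>2\<close>.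
\<close>

definition leading_coefficient ::
    "nat \<Rightarrow> (nat \<times> nat \<Rightarrow> complex) \<Rightarrow> nat \<Rightarrow> nat \<Rightarrow> complex poly \<Rightarrow> nat \<Rightarrow> complex" where
  "leading_coefficient g a q j f l =
     (if l \<le> g then poly f (a (l, j)) / poly (pderiv (M_poly g a j)) (a (l, j)) ^ q
      else (- 1) ^ q * coeff f (q * (g - 1)))"

definition H0_omega_power :: "nat \<Rightarrow> (nat \<times> nat \<Rightarrow> complex) \<Rightarrow> nat \<Rightarrow> sec set" where
  "H0_omega_power g a q =
     {(f1, f2). degree f1 \<le> q * (g - 1) \<and> degree f2 \<le> q * (g - 1) \<and>
        (\<forall>l\<in>{1..Suc g}.
           leading_coefficient g a q 1 f1 l = (- 1) ^ q * leading_coefficient g a q 2 f2 l)}"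

section \<open>Koszul cohomology\<close>

text \<open>
  \<open>H q\<close> stands for \<open>H\<^sup>0(L\<^sup>q)\<close>. The space \<open>\<Lambda>\<^sup>m H\<^sup>0(L) \<otimes> H\<^sup>0(L\<^sup>q)\<close> is the quotient of the
  free complex vector space on the symbols \<open>s\<^sub>1 \<and> \<dots> \<and> s\<^sub>m \<otimes> u\<close> (rendered as \<open>([s\<^sub>1, \<dots>, s\<^sub>m], u)\<close>) by the
  subspace generated by the relations saying that the symbol is linear in each of
  \<open>s\<^sub>1, \<dots>, s\<^sub>m, u\<close> and alternating in \<open>s\<^sub>1, \<dots>, s\<^sub>m\<close>.
\<close>

definition symbols :: "(nat \<Rightarrow> sec set) \<Rightarrow> nat \<Rightarrow> nat \<Rightarrow> (sec list \<times> sec) set" where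
  "symbols H m q = {(ss, u). length ss = m \<and> set ss \<subseteq> H 1 \<and> u \<in> H q}"

definition chains :: "(nat \<Rightarrow> sec set) \<Rightarrow> nat \<Rightarrow> nat \<Rightarrow> (sec list \<times> sec \<Rightarrow>\<^sub>0 complex) set" where
  "chains H m q = {x. Poly_Mapping.keys x \<subseteq> symbols H m q}"

inductive_set relations :: "(nat \<Rightarrow> sec set) \<Rightarrow> nat \<Rightarrow> nat \<Rightarrow> (sec list \<times> sec \<Rightarrow>\<^sub>0 complex) set"
  for H :: "nat \<Rightarrow> sec set" and m q :: nat
where
  zero: "0 \<in> relations H m q"
| add: "x \<in> relations H m q \<Longrightarrow> y \<in> relations H m q \<Longrightarrow> x + y \<in> relations H m q"
| slot_add: "(ss, u) \<in> symbols H m q \<Longrightarrow> i < m \<Longrightarrow> s \<in> H 1 \<Longrightarrow> s' \<in> H 1 \<Longrightarrow>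
    Poly_Mapping.single (ss[i := s + s'], u) c - Poly_Mapping.single (ss[i := s], u) c
      - Poly_Mapping.single (ss[i := s'], u) c \<in> relations H m q"
| slot_scale: "(ss, u) \<in> symbols H m q \<Longrightarrow> i < m \<Longrightarrow> s \<in> H 1 \<Longrightarrow>
    Poly_Mapping.single (ss[i := sec_scale z s], u) c - Poly_Mapping.single (ss[i := s], u) (c * z)
      \<in> relations H m q"
| coeff_add: "(ss, u) \<in> symbols H m q \<Longrightarrow> (ss, u') \<in> symbols H m q \<Longrightarrow>
    Poly_Mapping.single (ss, u + u') c - Poly_Mapping.single (ss, u) c
      - Poly_Mapping.single (ss, u') c \<in> relations H m q"
| coeff_scale: "(ss, u) \<in> symbols H m q \<Longrightarrow>
    Poly_Mapping.single (ss, sec_scale z u) c - Poly_Mapping.single (ss, u) (c * z)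
      \<in> relations H m q"
| alternating: "(ss, u) \<in> symbols H m q \<Longrightarrow> i < j \<Longrightarrow> j < m \<Longrightarrow> ss ! i = ss ! j \<Longrightarrow>
    Poly_Mapping.single (ss, u) c \<in> relations H m q"

text \<open>
  List positions start at 0, hence the exponent \<open>Suc l\<close>. On symbols with \<open>m = 0\<close> the
  differential is 0.
\<close>

definition koszul_d :: "(sec list \<times> sec \<Rightarrow>\<^sub>0 complex) \<Rightarrow> (sec list \<times> sec \<Rightarrow>\<^sub>0 complex)" where
  "koszul_d x = (\<Sum>(ss, u)\<in>Poly_Mapping.keys x. \<Sum>l<length ss.
     Poly_Mapping.single (take l ss @ drop (Suc l) ss, sec_mult (ss ! l) u)
       ((- 1) ^ Suc l * Poly_Mapping.lookup x (ss, u)))"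

text \<open>
  \<open>K\<^sub>p\<^sub>,\<^sub>q = 0\<close> for \<open>q \<ge> 1\<close>. For \<open>p = 0\<close> the target of the second map is 0; the condition on
  \<open>koszul_d x\<close> then holds for all \<open>x\<close>, so that the truncated subtraction \<open>p - 1\<close> does no harm.
\<close>

definition koszul_vanishes :: "(nat \<Rightarrow> sec set) \<Rightarrow> nat \<Rightarrow> nat \<Rightarrow> bool" where
  "koszul_vanishes H p q \<longleftrightarrow>
     (\<forall>x\<in>chains H p q. koszul_d x \<in> relations H (p - 1) (q + 1) \<longrightarrow>
        (\<exists>y\<in>chains H (p + 1) (q - 1). x - koszul_d y \<in> relations H p q))"

section \<open>Generic parameters\<close>

inductive_set polynomial_maps :: "'i set \<Rightarrow> (('i \<Rightarrow> complex) \<Rightarrow> complex) set" for I :: "'i set"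
where
  const: "(\<lambda>_. c) \<in> polynomial_maps I"
| coord: "i \<in> I \<Longrightarrow> (\<lambda>a. a i) \<in> polynomial_maps I"
| add: "f \<in> polynomial_maps I \<Longrightarrow> h \<in> polynomial_maps I \<Longrightarrow> (\<lambda>a. f a + h a) \<in> polynomial_maps I"
| mult: "f \<in> polynomial_maps I \<Longrightarrow> h \<in> polynomial_maps I \<Longrightarrow> (\<lambda>a. f a * h a) \<in> polynomial_maps I"

definition zariski_open :: "'i set \<Rightarrow> ('i \<Rightarrow> complex) set \<Rightarrow> bool" where
  "zariski_open I U \<longleftrightarrow>
     (\<exists>F \<subseteq> polynomial_maps I. U = (I \<rightarrow>\<^sub>E UNIV) - {a. \<forall>f\<in>F. f a = 0})"

definition for_generic_parameters :: "nat \<Rightarrow> ((nat \<times> nat \<Rightarrow> complex) \<Rightarrow> bool) \<Rightarrow> bool" where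
  "for_generic_parameters g P \<longleftrightarrow>
     (\<exists>U. zariski_open ({1..g} \<times> {1, 2}) U \<and> U \<noteq> {} \<and> (\<forall>a\<in>U. P a))"

end

theory Submission
  imports Defs
begin

text \<open>
  Let \<open>d = g - 1\<close>, let \<open>\<alpha>\<^sub>l = a (l, 1)\<close> and \<open>\<beta>\<^sub>l = a (l, 2)\<close> be the nodes on the two components, and let
  \<open>V = H\<^sup>0(\<omega>\<^sub>C)\<close> with its coordinate basis \<open>e\<^sub>1, \<dots>, e\<^sub>g\<close>, where \<open>e\<^sub>i\<close> has the numerators
  \<open>\<Prod>\<^sub>r\<^sub>\<noteq>\<^sub>i (y - \<alpha>\<^sub>r)\<close> and \<open>- \<Prod>\<^sub>r\<^sub>\<noteq>\<^sub>i (y - \<beta>\<^sub>r)\<close>. An element of \<open>\<Lambda>\<^sup>p V \<otimes> H\<^sup>0(\<omega>\<^sub>C\<^sup>q)\<close> is a family \<open>F\<^sub>I\<close> of sections,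
  indexed by the \<open>p\<close>-element subsets \<open>I\<close> of \<open>{1..g}\<close>, and on each component the Koszul differential is
  contraction with the vector \<open>(e\<^sub>i(y))\<^sub>i\<close> of polynomials.

  The proof rests on one observation (\<open>closed_family_factor\<close>). Suppose that this contraction kills a
  family of polynomials \<open>F\<^sub>I(y)\<close>. At a node \<open>y = \<alpha>\<^sub>i\<close> all coordinates of the vector except the \<open>i\<close>-th
  vanish, so that \<open>F\<^sub>I(\<alpha>\<^sub>i) = 0\<close> for \<open>i \<in> I\<close>. Hence \<open>F\<^sub>I = \<Prod>\<^sub>i\<^sub>\<in>\<^sub>I (y - \<alpha>\<^sub>i) \<cdot> G\<^sub>I\<close>, and the condition on \<open>F\<close>
  becomes the condition that contraction with the constant vector \<open>(1, \<dots>, 1)\<close> kills \<open>G\<close>. Call such a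
  family \<open>G\<close> closed.

  Take a cycle \<open>F\<close> for \<open>K\<^sub>p\<^sub>,\<^sub>2\<close>. Its restriction to the first component is a cycle on a rational normal
  curve, and these are boundaries (\<open>rational_normal_curve_exact\<close>). After subtracting a boundary, \<open>F\<close> lives
  on the second component and vanishes at all nodes, so \<open>F\<^sub>I = \<Prod>\<^sub>r (y - \<beta>\<^sub>r) \<cdot> \<Prod>\<^sub>i\<^sub>\<in>\<^sub>I (y - \<beta>\<^sub>i) \<cdot> G\<^sub>I\<close> with a closed
  family \<open>G\<close> of degree at most \<open>g - 3 - p\<close>. In the same way, the elements of \<open>\<Lambda>\<^sup>p\<^sup>+\<^sup>1 V \<otimes> V\<close> whose boundary
  vanishes on the first component are given by the closed families \<open>L\<close> of degree at most \<open>g - 2 - p\<close>.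
  The boundary becomes an explicit linear map \<open>L \<mapsto> G\<close> (\<open>green_map\<close>): carry each \<open>L\<^sub>J\<close> from the nodes \<open>\<alpha>\<^sub>l\<close>
  to the nodes \<open>\<beta>\<^sub>l\<close>, \<open>l \<notin> J\<close>, by interpolation, and contract with \<open>(1, \<dots>, 1)\<close>. So \<open>K\<^sub>p\<^sub>,\<^sub>2(C, \<omega>\<^sub>C) = 0\<close> if
  and only if this map is onto (\<open>koszul_vanishes_iff_green_surj\<close>).

  The space of closed families does not depend on the parameters and the map depends rationally on
  them, so surjectivity is an open condition (\<open>green_surj_open\<close>). Normalizing \<open>C\<close> at the node \<open>P\<^sub>c\<close>
  deletes \<open>\<alpha>\<^sub>c\<close> and \<open>\<beta>\<^sub>c\<close>. Multiplication by \<open>y - \<alpha>\<^sub>c\<close> and \<open>y - \<beta>\<^sub>c\<close> embeds the map for the normalized curve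
  into the map for \<open>C\<close>, with image in the families that vanish on the sets containing \<open>c\<close>. A closed family
  is a sum of contractions of single terms \<open>K\<^sub>J e\<^sub>J\<close>. If \<open>c \<noteq> c'\<close> lie outside \<open>J\<close>, then
  \<open>K\<^sub>J = (y - \<beta>\<^sub>c) A + (y - \<beta>\<^sub>c\<^sub>') B\<close>, so that the contraction comes from the normalizations at \<open>P\<^sub>c\<close> and
  at \<open>P\<^sub>c\<^sub>'\<close>. Therefore surjectivity for all the normalizations at one node implies surjectivity for \<open>C\<close>
  (\<open>green_surj_from_deletions\<close>).

  If Green's conjecture holds for one curve of genus \<open>2k - 1\<close>, then by openness it holds for
  generic parameters of genus \<open>2k - 1\<close>, hence for all one-node normalizations of a curve of genus \<open>2k\<close>
  with generic parameters, and hence for that curve. Generic parameters also define a canonical binary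
  curve: it is enough that the nodes on each component are distinct and that no affine map
  sends \<open>\<alpha>\<^sub>i\<close> to \<open>\<beta>\<^sub>i\<close> for \<open>i = 1, 2, 3\<close> (\<open>canonical_binary_curveI\<close>).
\<close>

section \<open>Contraction and exterior multiplication on families indexed by sets\<close>

text \<open>
  The sign of moving \<open>e\<^sub>i\<close> past the factors of \<open>e\<^sub>I\<close> with a smaller index. An element \<open>\<Sum>\<^sub>I F\<^sub>I e\<^sub>I\<close> of an
  exterior algebra with basis \<open>e\<^sub>I\<close> is the function \<open>I \<mapsto> F\<^sub>I\<close>. In this encoding the degree of a form
  is the cardinality of the sets that are looked at, and no support condition is imposed.
\<close>

definition esign :: "nat \<Rightarrow> nat set \<Rightarrow> 'a::comm_ring_1" where
  "esign i I = (- 1) ^ card {j \<in> I. j < i}"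

definition wedge :: "(nat \<Rightarrow> 'a::comm_ring_1) \<Rightarrow> (nat set \<Rightarrow> 'a) \<Rightarrow> nat set \<Rightarrow> 'a" where
  "wedge v F I = (\<Sum>i\<in>I. esign i I * v i * F (I - {i}))"

definition contract :: "nat set \<Rightarrow> (nat \<Rightarrow> 'a::comm_ring_1) \<Rightarrow> (nat set \<Rightarrow> 'a) \<Rightarrow> nat set \<Rightarrow> 'a" where
  "contract N w F I = (\<Sum>i\<in>N - I. esign i I * w i * F (insert i I))"

lemma esign_square [simp]: "esign i I * esign i I = 1"
  by (simp add: esign_def flip: power_add mult_2)

lemma esign_square_mult [simp]: "esign i I * (esign i I * x) = x"
  by (simp flip: mult.assoc)

lemma esign_insert_self [simp]: "esign i (insert i I) = esign i I"
proof -
  have "{j \<in> insert i I. j < i} = {j \<in> I. j < i}" by auto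
  then show ?thesis by (simp only: esign_def)
qed

lemma esign_Diff_self [simp]: "esign i (I - {i}) = esign i I"
proof -
  have "{j \<in> I - {i}. j < i} = {j \<in> I. j < i}" by auto
  then show ?thesis by (simp only: esign_def)
qed

lemma esign_insert:
  assumes "finite I" "c \<notin> I"
  shows "esign i (insert c I) = (if c < i then - esign i I else esign i I)"
proof -
  have "{j \<in> insert c I. j < i} = (if c < i then insert c {j \<in> I. j < i} else {j \<in> I. j < i})"
    by auto
  then show ?thesis using assms by (simp add: esign_def)
qed

lemma esign_Diff:
  assumes "finite I" "c \<in> I"
  shows "esign i (I - {c}) = (if c < i then - esign i I else esign i I)"
proof -
  have "(esign i I :: 'a) = esign i (insert c (I - {c}))" using assms by (simp add: insert_absorb)
  then show ?thesis using assms by (auto simp: esign_insert simp del: insert_Diff_single)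
qed

lemma wedge_anticommute:
  assumes "finite I"
  shows "wedge u (wedge v F) I = - wedge v (wedge u F) I"
proof -
  have *: "wedge u (wedge v F) I =
      (\<Sum>(i, j)\<in>Sigma I (\<lambda>i. I - {i}). esign i I * esign j (I - {i}) * u i * v j * F (I - {i} - {j}))"
    for u v using assms
    by (simp add: wedge_def sum.Sigma[symmetric] sum_distrib_left mult_ac)
  have "wedge v (wedge u F) I =
      (\<Sum>(i, j)\<in>Sigma I (\<lambda>i. I - {i}). esign j I * esign i (I - {j}) * v j * u i * F (I - {j} - {i}))"
    unfolding * by (rule sum.reindex_bij_witness[of _ prod.swap prod.swap]) auto
  also have "\<dots> = - wedge u (wedge v F) I"
    unfolding * sum_negf[symmetric]
    by (intro sum.cong)
      (auto simp: esign_Diff assms insert_commute Diff_insert[symmetric] mult_ac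
        split: if_splits)
  finally show ?thesis by simp
qed

lemma eq_uminus_imp_zero: "(x::'a::{idom,ring_char_0}) = - x \<Longrightarrow> x = 0"
proof -
  assume "x = - x"
  then have "2 * x = 0" by (metis add.right_inverse mult_2)
  then show ?thesis by simp
qed

lemma wedge_wedge_self:
  fixes v :: "nat \<Rightarrow> 'a::{idom,ring_char_0}"
  assumes "finite I"
  shows "wedge v (wedge v F) I = 0"
  using wedge_anticommute[OF assms, of v v F] by (rule eq_uminus_imp_zero)

text \<open>
  The two insertions of indices can be interchanged at the cost of a sign, so the double sum is its
  own negative.
\<close>

lemma contract_contract:
  fixes w :: "nat \<Rightarrow> 'a::{idom,ring_char_0}"
  assumes "finite N" "I \<subseteq> N"
  shows "contract N w (contract N w F) I = 0"
proof -
  have fin: "finite I" using assms finite_subset by auto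
  have *: "contract N w (contract N w F) I =
      (\<Sum>(i, j)\<in>Sigma (N - I) (\<lambda>i. N - insert i I).
         esign i I * esign j (insert i I) * w i * w j * F (insert j (insert i I)))"
    using assms by (simp add: contract_def sum.Sigma[symmetric] sum_distrib_left mult_ac)
  also have "\<dots> =
      (\<Sum>(i, j)\<in>Sigma (N - I) (\<lambda>i. N - insert i I).
         esign j I * esign i (insert j I) * w j * w i * F (insert i (insert j I)))"
    by (rule sum.reindex_bij_witness[of _ prod.swap prod.swap]) auto
  also have "\<dots> = - contract N w (contract N w F) I"
    unfolding * sum_negf[symmetric]
    by (intro sum.cong)
      (auto simp: esign_insert fin insert_commute mult_ac split: if_splits)
  finally show ?thesis by (rule eq_uminus_imp_zero)
qed

text \<open>
  Contraction is an antiderivation. In coordinates: the terms of the left-hand side in which the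
  inserted index is removed again give the scalar product, and in all other terms the insertion and
  the removal concern different indices and anticommute.
\<close>

lemma contract_wedge:
  assumes "finite N" "I \<subseteq> N"
  shows "contract N w (wedge v F) I = (\<Sum>i\<in>N. w i * v i) * F I - wedge v (contract N w F) I"
proof -
  have fin: "finite I" using assms finite_subset by auto
  define X where "X = (\<Sum>i\<in>N - I. \<Sum>c\<in>I. esign i I * esign c (insert i I) * w i * v c * F (insert i I - {c}))"
  have 1: "contract N w (wedge v F) I = (\<Sum>i\<in>N - I. w i * v i * F I) + X"
  proof -
    have "esign i I * w i * wedge v F (insert i I) =
      w i * v i * F I + (\<Sum>c\<in>I. esign i I * esign c (insert i I) * w i * v c * F (insert i I - {c}))"
      if "i \<in> N - I" for i
    proof -
      have "esign i I * w i * wedge v F (insert i I) = esign i I * w i * (esign i I * v i * F I) +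
        esign i I * w i * (\<Sum>c\<in>I. esign c (insert i I) * v c * F (insert i I - {c}))"
        using that fin by (simp add: wedge_def distrib_left)
      also have "esign i I * w i * (esign i I * v i * F I) = w i * v i * F I" 
        by (simp add: mult_ac)
      finally show ?thesis by (simp add: sum_distrib_left mult_ac)
    qed
    then show ?thesis by (simp add: contract_def X_def sum.distrib)
  qed
  have 2: "wedge v (contract N w F) I = (\<Sum>i\<in>I. w i * v i * F I) - X"
  proof -
    have "esign c I * v c * contract N w F (I - {c}) = 
       w c * v c * F I - (\<Sum>i\<in>N - I. esign i I * esign c (insert i I) * w i * v c * F (insert i I - {c}))"
      if c: "c \<in> I" for c
    proof -
      have N: "N - (I - {c}) = insert c (N - I)" using c assms by auto
      have "(\<Sum>i\<in>N - I. esign i (I - {c}) * w i * F (insert i (I - {c}))) =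
         (\<Sum>i\<in>N - I. - (esign c I * (esign i I * esign c (insert i I) * w i * F (insert i I - {c}))))"
      proof (rule sum.cong[OF refl])
        fix i assume i: "i \<in> N - I"
        then have "insert i (I - {c}) = insert i I - {c}" using c by auto
        then show "esign i (I - {c}) * w i * F (insert i (I - {c})) = 
            - (esign c I * (esign i I * esign c (insert i I) * w i * F (insert i I - {c})))"
          using i c fin by (auto simp: esign_Diff esign_insert mult_ac)
      qed
      then have "contract N w F (I - {c}) = esign c I * w c * F I
        - esign c I * (\<Sum>i\<in>N - I. esign i I * esign c (insert i I) * w i * F (insert i I - {c}))"
        using c assms fin by (simp add: contract_def N insert_absorb sum_negf sum_distrib_left)
      then show ?thesis
        by (simp add: right_diff_distrib sum_distrib_left mult_ac)
    qed
    then have "wedge v (contract N w F) I = (\<Sum>c\<in>I. w c * v c * F I) - 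
      (\<Sum>c\<in>I. \<Sum>i\<in>N - I. esign i I * esign c (insert i I) * w i * v c * F (insert i I - {c}))"
      by (simp add: wedge_def sum_subtractf)
    then show ?thesis unfolding X_def by (subst sum.swap)
  qed
  have "(\<Sum>i\<in>N. w i * v i) * F I = (\<Sum>i\<in>N - I. w i * v i * F I) + (\<Sum>i\<in>I. w i * v i * F I)"
    using assms by (simp add: sum.subset_diff[of I N] distrib_right flip: sum_distrib_right)
  then show ?thesis by (simp add: 1 2)
qed

section \<open>Closed families of polynomials\<close>

definition node_poly :: "(nat \<Rightarrow> complex) \<Rightarrow> nat set \<Rightarrow> complex poly" where
  "node_poly a I = (\<Prod>r\<in>I. [:- a r, 1:])"

lemma poly_node_poly: "poly (node_poly a I) x = (\<Prod>r\<in>I. x - a r)"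
  by (simp add: node_poly_def poly_prod)

lemma node_poly_nonzero [simp]: "node_poly a I \<noteq> 0"
proof (cases "finite I")
  case True
  then show ?thesis by (simp add: node_poly_def)
qed (simp add: node_poly_def)

lemma degree_node_poly [simp]: "degree (node_poly a I) = card I"
proof (cases "finite I")
  case True
  then show ?thesis by (simp add: node_poly_def degree_prod_eq_sum_degree)
qed (simp add: node_poly_def)

lemma lead_coeff_node_poly [simp]: "coeff (node_poly a I) (card I) = 1"
  using lead_coeff_prod[of "\<lambda>r. [:- a r, 1:]" I] by (simp flip: node_poly_def)

lemma node_poly_insert:
  "finite I \<Longrightarrow> i \<notin> I \<Longrightarrow> node_poly a (insert i I) = [:- a i, 1:] * node_poly a I"
  by (simp add: node_poly_def)

lemma node_poly_remove:
  "finite I \<Longrightarrow> i \<in> I \<Longrightarrow> node_poly a I = [:- a i, 1:] * node_poly a (I - {i})"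
  by (simp add: node_poly_def prod.remove)

lemma node_poly_split:
  "finite I \<Longrightarrow> J \<subseteq> I \<Longrightarrow> node_poly a I = node_poly a (I - J) * node_poly a J"
  by (simp add: node_poly_def prod.subset_diff)

lemma poly_node_poly_eq_0_iff:
  assumes "finite N" "inj_on a N" "I \<subseteq> N" "l \<in> N"
  shows "poly (node_poly a I) (a l) = 0 \<longleftrightarrow> l \<in> I"
  using assms finite_subset[OF assms(3,1)] by (auto simp: poly_node_poly inj_on_def)

lemma node_poly_dvd:
  assumes "finite I" "inj_on a I" "\<And>i. i \<in> I \<Longrightarrow> poly f (a i) = 0"
  shows "node_poly a I dvd f"
  using assms
proof (induction I arbitrary: f)
  case empty
  then show ?case by (simp add: node_poly_def)
next
  case (insert i I)
  then have "[:- a i, 1:] dvd f" by (simp flip: poly_eq_0_iff_dvd)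
  then obtain h where f: "f = [:- a i, 1:] * h" by (rule dvdE)
  have "poly h (a j) = 0" if "j \<in> I" for j
  proof -
    have "a j \<noteq> a i" using insert.prems(1) insert.hyps(2) that by (auto simp: image_iff)
    then show ?thesis using insert.prems(2)[of j] that by (simp add: f)
  qed
  then have "node_poly a I dvd h" using insert by auto
  then show ?case
    unfolding f node_poly_insert[OF insert.hyps(1,2)] by (rule mult_dvd_mono[OF dvd_refl])
qed

lemma Lagrange_interpolation:
  assumes "finite N" "inj_on a N" "degree f < card N"
  shows "f = (\<Sum>l\<in>N. smult (poly f (a l) / poly (node_poly a (N - {l})) (a l)) (node_poly a (N - {l})))"
    (is "f = ?g")
proof (rule ccontr)
  assume "f \<noteq> ?g"
  have "poly (f - ?g) (a k) = 0" if k: "k \<in> N" for k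
  proof -
    have "poly ?g (a k) = (\<Sum>l\<in>N. if l = k then poly f (a k) else 0)"
      unfolding poly_sum
    proof (rule sum.cong[OF refl])
      fix l assume "l \<in> N"
      then show "poly (smult (poly f (a l) / poly (node_poly a (N - {l})) (a l)) (node_poly a (N - {l}))) (a k)
         = (if l = k then poly f (a k) else 0)"
        using k poly_node_poly_eq_0_iff[OF assms(1,2), of "N - {l}" k] by auto
    qed
    then show ?thesis using k assms(1) by simp
  qed
  then have "node_poly a N dvd f - ?g" by (rule node_poly_dvd[OF assms(1,2)])
  then have "card N \<le> degree (f - ?g)"
    using \<open>f \<noteq> ?g\<close> dvd_imp_degree_le by fastforce
  moreover have "degree (f - ?g) < card N"
  proof (intro degree_diff_less assms degree_sum_less)
    show "degree (smult c (node_poly a (N - {l}))) < card N" if "l \<in> N" for l c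
      using that assms(1) degree_smult_le[of c "node_poly a (N - {l})"] card_gt_0_iff[of N] by auto
    show "0 < card N" using assms by simp
  qed
  ultimately show False by simp
qed

lemma Lagrange_lead_coeff:
  assumes "finite N" "inj_on a N" "degree f < card N"
  shows "coeff f (card N - 1) = (\<Sum>l\<in>N. poly f (a l) / poly (node_poly a (N - {l})) (a l))"
proof -
  have "coeff (node_poly a (N - {l})) (card N - 1) = 1" if "l \<in> N" for l
    using lead_coeff_node_poly[of a "N - {l}"] that assms(1) by simp
  then show ?thesis
    by (subst Lagrange_interpolation[OF assms]) (simp add: coeff_sum)
qed

text \<open>
  The products of linear factors turn the contraction with the coordinate functions of the curve
  into the contraction with a constant vector.
\<close>

lemma contract_node_poly:
  assumes "finite N" "I \<subseteq> N"
  shows "contract N (\<lambda>i. node_poly a (N - {i})) (\<lambda>I. node_poly a I * G I) I =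
    node_poly a N * node_poly a I * contract N (\<lambda>_. 1) G I"
  unfolding contract_def sum_distrib_left
proof (rule sum.cong[OF refl])
  fix i assume i: "i \<in> N - I"
  have fin: "finite I" using assms finite_subset by auto
  have "node_poly a N = [:- a i, 1:] * node_poly a (N - {i})"
    using i assms by (intro node_poly_remove) auto
  moreover have "node_poly a (insert i I) = [:- a i, 1:] * node_poly a I"
    using i fin by (intro node_poly_insert) auto
  ultimately show "esign i I * node_poly a (N - {i}) * (node_poly a (insert i I) * G (insert i I)) =
      node_poly a N * node_poly a I * (esign i I * 1 * G (insert i I))"
    by (simp only: mult_ac mult_1_left)
qed

section \<open>The map between closed families that governs Koszul cohomology\<close>

text \<open>
  Closed families of \<open>p\<close>-forms with coefficients of degree at most \<open>n\<close>: the kernel of the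
  contraction with \<open>(1, \<dots>, 1)\<close>. Values outside the \<open>p\<close>-element subsets of \<open>N\<close> are unconstrained.
\<close>

definition closed_families :: "nat set \<Rightarrow> nat \<Rightarrow> nat \<Rightarrow> (nat set \<Rightarrow> complex poly) set" where
  "closed_families N p n = {G. (\<forall>I\<subseteq>N. card I = p \<longrightarrow> degree (G I) \<le> n) \<and>
     (\<forall>I\<subseteq>N. Suc (card I) = p \<longrightarrow> contract N (\<lambda>_. 1) G I = 0)}"

lemma contract_cong:
  assumes "finite N" "I \<subseteq> N" "\<And>J. J \<subseteq> N \<Longrightarrow> card J = Suc (card I) \<Longrightarrow> F J = G J"
  shows "contract N w F I = contract N w G I"
  unfolding contract_def using assms finite_subset[of I N] by (intro sum.cong) auto

text \<open>
  The kernel of the Koszul differential on one component. Evaluation of the contraction of \<open>F\<close> on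
  \<open>J = I - {i}\<close> at the node \<open>a i\<close> leaves only the term with \<open>F I\<close>, hence \<open>F I\<close> vanishes there.
\<close>

theorem closed_family_factor:
  assumes N: "finite N" "inj_on a N"
    and deg: "\<And>I. I \<subseteq> N \<Longrightarrow> card I = p \<Longrightarrow> degree (F I) \<le> n"
    and closed: "\<And>I. I \<subseteq> N \<Longrightarrow> Suc (card I) = p \<Longrightarrow> contract N (\<lambda>i. node_poly a (N - {i})) F I = 0"
  shows "\<exists>G\<in>closed_families N p (n - p). \<forall>I\<subseteq>N. card I = p \<longrightarrow> F I = node_poly a I * G I"
proof -
  define G where "G I = F I div node_poly a I" for I
  have fin: "finite I" if "I \<subseteq> N" for I using that N finite_subset by auto
  have F: "F I = node_poly a I * G I" if I: "I \<subseteq> N" "card I = p" for I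
  proof -
    have "node_poly a I dvd F I"
    proof (rule node_poly_dvd)
      fix i assume i: "i \<in> I"
      define J where "J = I - {i}"
      have J: "J \<subseteq> N" "Suc (card J) = p" "i \<in> N" "i \<notin> J" "insert i J = I"
        using i I fin[of I] card_Suc_Diff1[of I i] by (auto simp: J_def simp del: card_Diff_insert)
      have "0 = poly (contract N (\<lambda>i. node_poly a (N - {i})) F J) (a i)"
        using closed J by simp
      also have "\<dots> = (\<Sum>k\<in>N - J. if k = i then poly (esign i J * node_poly a (N - {i}) * F I) (a i) else 0)"
        unfolding contract_def poly_sum
        using J by (intro sum.cong) (auto simp: poly_node_poly_eq_0_iff[OF N])
      also have "\<dots> = poly (esign i J * node_poly a (N - {i}) * F I) (a i)"
        using J N by simp
      finally have "poly (esign i J) (a i) * poly (node_poly a (N - {i})) (a i) * poly (F I) (a i) = 0"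
        by simp
      moreover have "poly (esign i J) (a i) \<noteq> 0" by (simp add: esign_def)
      moreover have "poly (node_poly a (N - {i})) (a i) \<noteq> 0"
        using J by (simp add: poly_node_poly_eq_0_iff[OF N])
      ultimately show "poly (F I) (a i) = 0" by auto
    qed (use I fin N inj_on_subset in auto)
    then show ?thesis by (simp add: G_def)
  qed
  have "degree (G I) \<le> n - p" if I: "I \<subseteq> N" "card I = p" for I
  proof (cases "G I = 0")
    case False
    then have "degree (F I) = p + degree (G I)" using F[OF I] I by (simp add: degree_mult_eq)
    then show ?thesis using deg[OF I] by simp
  qed simp
  moreover have "contract N (\<lambda>_. 1) G I = 0" if I: "I \<subseteq> N" "Suc (card I) = p" for I
  proof -
    have "node_poly a N * node_poly a I * contract N (\<lambda>_. 1) G I =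
        contract N (\<lambda>i. node_poly a (N - {i})) (\<lambda>I. node_poly a I * G I) I"
      using contract_node_poly[OF N(1) I(1)] by simp
    also have "\<dots> = contract N (\<lambda>i. node_poly a (N - {i})) F I"
      by (rule contract_cong) (use N I F in auto)
    also have "\<dots> = 0" using closed I by simp
    finally show ?thesis by simp
  qed
  ultimately show ?thesis using F by (intro bexI[of _ G]) (auto simp: closed_families_def)
qed

text \<open>
  A polynomial \<open>f\<close> of degree less than \<open>card (N - J)\<close> is determined by the residues of
  \<open>f(y) dy / \<Prod>\<^sub>r (y - \<alpha>\<^sub>r)\<close>, where \<open>r\<close> runs through \<open>N - J\<close>. The transferred polynomial has the same
  residues when the nodes \<open>\<alpha>\<^sub>r\<close> are replaced by \<open>\<beta>\<^sub>r\<close>. The factor \<open>node_poly \<alpha> J\<close> cancels against part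
  of the denominator, which runs through \<open>N - {l}\<close>; this form is the one in which the map arises
  from sections of the dualizing sheaf.
\<close>

definition transfer ::
    "nat set \<Rightarrow> (nat \<Rightarrow> complex) \<Rightarrow> (nat \<Rightarrow> complex) \<Rightarrow> nat set \<Rightarrow> complex poly \<Rightarrow> complex poly" where
  "transfer N \<alpha> \<beta> J f =
     (\<Sum>l\<in>N - J. smult (poly (node_poly \<alpha> J * f) (\<alpha> l) / poly (node_poly \<alpha> (N - {l})) (\<alpha> l))
        (node_poly \<beta> (N - J - {l})))"

definition green_map ::
    "nat set \<Rightarrow> (nat \<Rightarrow> complex) \<Rightarrow> (nat \<Rightarrow> complex) \<Rightarrow> (nat set \<Rightarrow> complex poly) \<Rightarrow> nat set \<Rightarrow> complex poly" where
  "green_map N \<alpha> \<beta> L = contract N (\<lambda>_. 1) (\<lambda>J. transfer N \<alpha> \<beta> J (L J))"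

text \<open>
  For \<open>p + 3 \<le> card N\<close>, by \<open>koszul_vanishes_iff_green_surj\<close> below, this is the vanishing of \<open>K\<^sub>p\<^sub>,\<^sub>2\<close>
  of the binary curve with nodes \<open>\<alpha>\<close>, \<open>\<beta>\<close>, which has genus \<open>card N\<close>. The index set \<open>N\<close> is arbitrary
  so that a node can be deleted without renumbering the others.
\<close>

definition green_surj :: "nat set \<Rightarrow> (nat \<Rightarrow> complex) \<Rightarrow> (nat \<Rightarrow> complex) \<Rightarrow> nat \<Rightarrow> bool" where
  "green_surj N \<alpha> \<beta> p \<longleftrightarrow>
     (\<forall>G\<in>closed_families N p (card N - 3 - p). \<exists>L\<in>closed_families N (Suc p) (card N - 2 - p).
        \<forall>I\<subseteq>N. card I = p \<longrightarrow> green_map N \<alpha> \<beta> L I = G I)"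

lemma esign_poly: "(esign i I :: 'a::comm_ring_1 poly) = [:esign i I:]"
proof -
  have "(- 1 :: 'a poly) ^ n = [:(- 1) ^ n:]" for n
    by (induction n) (auto simp: one_pCons)
  then show ?thesis by (simp add: esign_def)
qed

lemma degree_esign_mult [simp]: "degree (esign i I * f) = degree (f :: 'a::comm_ring_1 poly)"
  by (cases "even (card {j \<in> I. j < i})") (auto simp: esign_def)

lemma coeff_contract:
  "coeff (contract N (\<lambda>_. 1) F I) n = contract N (\<lambda>_. 1) (\<lambda>J. coeff (F J) n) I"
  by (simp add: contract_def coeff_sum esign_poly)

lemma degree_contract_le:
  assumes "finite N" "I \<subseteq> N"
    and "\<And>J. J \<subseteq> N \<Longrightarrow> card J = Suc (card I) \<Longrightarrow> degree (F J) \<le> n"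
  shows "degree (contract N (\<lambda>_. 1) F I :: complex poly) \<le> n"
  unfolding contract_def using assms finite_subset[of I N] by (intro degree_sum_le) auto

text \<open>
  By Lagrange interpolation the coefficient of degree \<open>m\<close> is the sum of the residues, which are
  preserved. This is the residue theorem, with the node at infinity.
\<close>

lemma transfer_lead_coeff:
  assumes N: "finite N" "inj_on \<alpha> N" and J: "J \<subseteq> N" "card N = Suc (card J + m)"
    and f: "degree f \<le> m"
  shows "degree (transfer N \<alpha> \<beta> J f) \<le> m" "coeff (transfer N \<alpha> \<beta> J f) m = coeff f m"
proof -
  have fin: "finite J" using J N finite_subset by auto
  have card: "card (N - J) = Suc m" using J N fin by (simp add: card_Diff_subset)
  then have card': "card (N - J - {l}) = m" if "l \<in> N - J" for l
    using that N by (subst card_Diff_singleton) auto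
  show "degree (transfer N \<alpha> \<beta> J f) \<le> m"
    unfolding transfer_def using N card'
    by (intro degree_sum_le order.trans[OF degree_smult_le]) auto
  have "coeff (node_poly \<beta> (N - J - {l})) m = 1" if "l \<in> N - J" for l
    using lead_coeff_node_poly[of \<beta> "N - J - {l}"] card'[OF that] by simp
  then have "coeff (transfer N \<alpha> \<beta> J f) m =
      (\<Sum>l\<in>N - J. poly (node_poly \<alpha> J * f) (\<alpha> l) / poly (node_poly \<alpha> (N - {l})) (\<alpha> l))"
    unfolding transfer_def coeff_sum by (intro sum.cong) auto
  also have "\<dots> = (\<Sum>l\<in>N - J. poly f (\<alpha> l) / poly (node_poly \<alpha> (N - J - {l})) (\<alpha> l))"
  proof (rule sum.cong[OF refl])
    fix l assume l: "l \<in> N - J"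
    have "N - {l} - J = N - J - {l}" by auto
    then have "node_poly \<alpha> (N - {l}) = node_poly \<alpha> (N - J - {l}) * node_poly \<alpha> J"
      using node_poly_split[of "N - {l}" J \<alpha>] l J N by auto
    moreover have "poly (node_poly \<alpha> J) (\<alpha> l) \<noteq> 0"
      using l J by (simp add: poly_node_poly_eq_0_iff[OF N])
    ultimately show "poly (node_poly \<alpha> J * f) (\<alpha> l) / poly (node_poly \<alpha> (N - {l})) (\<alpha> l) =
        poly f (\<alpha> l) / poly (node_poly \<alpha> (N - J - {l})) (\<alpha> l)"
      by simp
  qed
  also have "\<dots> = coeff f m"
    using Lagrange_lead_coeff[of "N - J" \<alpha> f] N f card inj_on_subset[OF N(2), of "N - J"] by simp
  finally show "coeff (transfer N \<alpha> \<beta> J f) m = coeff f m" .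
qed

text \<open>
  The degree drops by one because the leading coefficients of the transferred polynomials form again
  a closed family.
\<close>

lemma green_map_closed:
  assumes N: "finite N" "inj_on \<alpha> N" and p: "p + 3 \<le> card N"
    and L: "L \<in> closed_families N (Suc p) (card N - 2 - p)"
  shows "green_map N \<alpha> \<beta> L \<in> closed_families N p (card N - 3 - p)"
proof -
  define m where "m = card N - 2 - p"
  define Q where "Q J = transfer N \<alpha> \<beta> J (L J)" for J
  have m: "card N = Suc (Suc p + m)" "card N - 3 - p = m - 1" using p by (auto simp: m_def)
  have Q: "degree (Q J) \<le> m" "coeff (Q J) m = coeff (L J) m" if "J \<subseteq> N" "card J = Suc p" for J
    using transfer_lead_coeff[OF N, of J m "L J" \<beta>] that L m(1) 
    by (auto simp: Q_def closed_families_def m_def[symmetric])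
  have "degree (green_map N \<alpha> \<beta> L I) \<le> m - 1" if I: "I \<subseteq> N" "card I = p" for I
  proof -
    have "degree (contract N (\<lambda>_. 1) Q I) \<le> m"
      using I Q N by (intro degree_contract_le) auto
    moreover have "coeff (contract N (\<lambda>_. 1) Q I) m = 0"
    proof -
      have "contract N (\<lambda>_. 1) (\<lambda>J. coeff (Q J) m) I = contract N (\<lambda>_. 1) (\<lambda>J. coeff (L J) m) I"
        using N I Q by (intro contract_cong) auto
      also have "\<dots> = coeff (contract N (\<lambda>_. 1) L I) m"
        by (simp add: coeff_contract)
      also have "contract N (\<lambda>_. 1) L I = 0"
        using L I by (auto simp: closed_families_def)
      finally show ?thesis by (simp add: coeff_contract)
    qed
    ultimately have "degree (contract N (\<lambda>_. 1) Q I) < m \<or> contract N (\<lambda>_. 1) Q I = 0"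
      by (metis leading_coeff_neq_0 order_le_less)
    then show ?thesis by (auto simp: green_map_def Q_def[abs_def])
  qed
  moreover have "contract N (\<lambda>_. 1) (green_map N \<alpha> \<beta> L) I = 0" if "I \<subseteq> N" for I
    unfolding green_map_def by (rule contract_contract[OF N(1) that])
  ultimately show ?thesis unfolding closed_families_def m(2) by auto
qed


section \<open>Deleting a node\<close>

lemma contract_extend_by_zero:
  assumes "finite N" "c \<in> N"
  shows "contract N w (\<lambda>I. if c \<in> I then 0 else q * F I) I =
    (if c \<in> I then 0 else q * contract (N - {c}) w F I)"
proof (cases "c \<in> I")
  case False
  have "contract N w (\<lambda>I. if c \<in> I then 0 else q * F I) I =
      (\<Sum>i\<in>N - {c} - I. esign i I * w i * (if c \<in> insert i I then 0 else q * F (insert i I)))"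
    unfolding contract_def using assms False by (intro sum.mono_neutral_right) auto
  also have "\<dots> = q * contract (N - {c}) w F I"
    unfolding contract_def sum_distrib_left using False
    by (intro sum.cong) (auto simp: mult_ac)
  finally show ?thesis using False by simp
qed (simp add: contract_def)

lemma transfer_0 [simp]: "transfer N \<alpha> \<beta> J 0 = 0"
  by (simp add: transfer_def)

lemma transfer_add: "transfer N \<alpha> \<beta> J (f + h) = transfer N \<alpha> \<beta> J f + transfer N \<alpha> \<beta> J h"
  by (simp add: transfer_def distrib_left add_divide_distrib smult_add_left sum.distrib)

lemma transfer_smult: "transfer N \<alpha> \<beta> J (smult c f) = smult c (transfer N \<alpha> \<beta> J f)"
proof -
  have "smult c (sum F A) = (\<Sum>x\<in>A. smult c (F x))" for F :: "nat \<Rightarrow> complex poly" and A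
    by (induction A rule: infinite_finite_induct) (auto simp: smult_add_right)
  then show ?thesis
    by (simp add: transfer_def mult_ac)
qed

lemma contract_0 [simp]: "contract N w (\<lambda>_. 0) I = 0"
  by (simp add: contract_def)

lemma contract_add: "contract N w (\<lambda>I. F I + G I) I = contract N w F I + contract N w G I"
  by (simp add: contract_def distrib_left sum.distrib)

lemma contract_sum: "contract N w (\<lambda>I. \<Sum>x\<in>A. F x I) I = (\<Sum>x\<in>A. contract N w (F x) I)"
  by (induction A rule: infinite_finite_induct) (auto simp: contract_add)

lemma contract_mult: "contract N w (\<lambda>I. q * F I) I = q * contract N w F I"
  by (simp add: contract_def sum_distrib_left mult_ac)

lemma contract_smult: "contract N w (\<lambda>I. smult c (F I)) I = smult c (contract N w F I)"
  using contract_mult[of N w "[:c:]" F I] by simp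

lemma green_map_add:
  "green_map N \<alpha> \<beta> (\<lambda>J. L J + L' J) I = green_map N \<alpha> \<beta> L I + green_map N \<alpha> \<beta> L' I"
  by (simp add: green_map_def transfer_add contract_add)

lemma green_map_0 [simp]: "green_map N \<alpha> \<beta> (\<lambda>_. 0) I = 0"
  by (simp add: green_map_def)

lemma green_map_smult: "green_map N \<alpha> \<beta> (\<lambda>J. smult c (L J)) I = smult c (green_map N \<alpha> \<beta> L I)"
  by (simp add: green_map_def transfer_smult contract_smult)

lemma green_map_sum:
  "green_map N \<alpha> \<beta> (\<lambda>J. \<Sum>x\<in>A. L x J) I = (\<Sum>x\<in>A. green_map N \<alpha> \<beta> (L x) I)"
  by (induction A rule: infinite_finite_induct) (auto simp: green_map_add)

lemma closed_families_0 [simp]: "(\<lambda>_. 0) \<in> closed_families N p n"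
  by (simp add: closed_families_def)

lemma closed_families_add:
  "F \<in> closed_families N p n \<Longrightarrow> G \<in> closed_families N p n \<Longrightarrow> (\<lambda>I. F I + G I) \<in> closed_families N p n"
  by (auto simp: closed_families_def contract_add intro: degree_add_le)

lemma closed_families_smult:
  "F \<in> closed_families N p n \<Longrightarrow> (\<lambda>I. smult c (F I)) \<in> closed_families N p n"
  by (auto simp: closed_families_def contract_smult intro: order.trans[OF degree_smult_le])

lemma closed_families_sum:
  "(\<And>x. x \<in> A \<Longrightarrow> F x \<in> closed_families N p n) \<Longrightarrow> (\<lambda>I. \<Sum>x\<in>A. F x I) \<in> closed_families N p n"
  by (induction A rule: infinite_finite_induct) (auto simp: closed_families_add)

text \<open>
  The factor \<open>y - \<alpha>\<^sub>c\<close> kills the term of the interpolation at \<open>c\<close>, and in all other terms it cancels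
  against the denominator, where \<open>\<alpha>\<^sub>l - \<alpha>\<^sub>c\<close> occurs because the node \<open>c\<close> is present.
\<close>

lemma transfer_delete_node:
  assumes N: "finite N" "inj_on \<alpha> N" and c: "c \<in> N" "c \<notin> J" and J: "J \<subseteq> N"
  shows "transfer N \<alpha> \<beta> J ([:- \<alpha> c, 1:] * f) = [:- \<beta> c, 1:] * transfer (N - {c}) \<alpha> \<beta> J f"
proof -
  let ?t = "\<lambda>N l f. smult (poly (node_poly \<alpha> J * f) (\<alpha> l) / poly (node_poly \<alpha> (N - {l})) (\<alpha> l))
        (node_poly \<beta> (N - J - {l}))"
  have "transfer N \<alpha> \<beta> J ([:- \<alpha> c, 1:] * f) = (\<Sum>l\<in>N - {c} - J. ?t N l ([:- \<alpha> c, 1:] * f))"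
    unfolding transfer_def using N c by (intro sum.mono_neutral_right) auto
  also have "\<dots> = (\<Sum>l\<in>N - {c} - J. [:- \<beta> c, 1:] * ?t (N - {c}) l f)"
  proof (rule sum.cong[OF refl])
    fix l assume l: "l \<in> N - {c} - J"
    have "\<alpha> l \<noteq> \<alpha> c" using l N c by (auto simp: inj_on_def)
    have "N - {l} - {c} = N - {c} - {l}" "N - J - {l} - {c} = N - {c} - J - {l}" by auto
    then have 1: "node_poly \<alpha> (N - {l}) = [:- \<alpha> c, 1:] * node_poly \<alpha> (N - {c} - {l})"
      and 2: "node_poly \<beta> (N - J - {l}) = [:- \<beta> c, 1:] * node_poly \<beta> (N - {c} - J - {l})"
      using node_poly_remove[of "N - {l}" c \<alpha>] node_poly_remove[of "N - J - {l}" c \<beta>] l c N by auto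
    show "?t N l ([:- \<alpha> c, 1:] * f) = [:- \<beta> c, 1:] * ?t (N - {c}) l f"
      unfolding 1 2 using \<open>\<alpha> l \<noteq> \<alpha> c\<close> by (simp only: poly_mult mult_smult_right) simp
  qed
  finally show ?thesis by (simp only: transfer_def sum_distrib_left)
qed

text \<open>
  The inclusion of the dualizing sheaf of the curve normalized at \<open>c\<close> into that of the curve.
\<close>

lemma green_map_extend_by_zero:
  assumes N: "finite N" "inj_on \<alpha> N" and c: "c \<in> N" and I: "I \<subseteq> N"
  shows "green_map N \<alpha> \<beta> (\<lambda>J. if c \<in> J then 0 else [:- \<alpha> c, 1:] * L J) I =
    (if c \<in> I then 0 else [:- \<beta> c, 1:] * green_map (N - {c}) \<alpha> \<beta> L I)"
proof -
  have "green_map N \<alpha> \<beta> (\<lambda>J. if c \<in> J then 0 else [:- \<alpha> c, 1:] * L J) I =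
     contract N (\<lambda>_. 1) (\<lambda>J. if c \<in> J then 0 else [:- \<beta> c, 1:] * transfer (N - {c}) \<alpha> \<beta> J (L J)) I"
    unfolding green_map_def using N I c transfer_delete_node[OF N, of c]
    by (intro contract_cong) (auto simp del: mult_pCons_left)
  then show ?thesis
    unfolding contract_extend_by_zero[OF N(1) c] by (simp add: green_map_def)
qed

lemma closed_families_extend_by_zero:
  assumes "finite N" "c \<in> N" "F \<in> closed_families (N - {c}) p n"
  shows "(\<lambda>I. if c \<in> I then 0 else [:- x, 1:] * F I) \<in> closed_families N p (Suc n)"
proof -
  have "degree ([:- x, 1:] * F I) \<le> Suc n" if "degree (F I) \<le> n" for I
    using degree_mult_le[of "[:- x, 1:]" "F I"] that by simp
  then show ?thesis
    using assms by (auto simp: closed_families_def contract_extend_by_zero subset_Diff_insert simp del: mult_pCons_left)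
qed

lemma split_at_two_points:
  fixes K :: "complex poly"
  assumes "b \<noteq> b'" "degree K \<le> Suc n"
  shows "\<exists>A B. degree A \<le> n \<and> degree B \<le> n \<and> K = [:- b, 1:] * A + [:- b', 1:] * B"
proof -
  define B where "B = [:poly K b / (b - b'):]"
  have "poly [:- b', 1:] b = b - b'" by simp
  then have "poly ([:- b', 1:] * B) b = poly K b"
    using assms(1) by (simp only: poly_mult) (simp add: B_def)
  then have "poly (K - [:- b', 1:] * B) b = 0" by (simp only: poly_diff) simp
  then have "[:- b, 1:] dvd K - [:- b', 1:] * B" by (simp only: poly_eq_0_iff_dvd)
  then obtain A where A: "K - [:- b', 1:] * B = [:- b, 1:] * A" by (rule dvdE)
  have "degree A \<le> n"
  proof (cases "A = 0")
    case False
    then have "Suc (degree A) = degree (K - [:- b', 1:] * B)"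
      by (simp add: A degree_mult_eq del: mult_pCons_left)
    also have "\<dots> \<le> Suc n"
      using assms(2) degree_mult_le[of "[:- b', 1:]" B] by (intro degree_diff_le) (auto simp: B_def)
    finally show ?thesis by simp
  qed simp
  then show ?thesis using A by (intro exI[of _ A] exI[of _ B]) (auto simp: B_def algebra_simps)
qed

text \<open>
  The set \<open>R\<close> of all families in the image is closed under addition. It contains the contraction of
  a single term \<open>(y - \<beta>\<^sub>c) A e\<^sub>J\<close> with \<open>c \<notin> J\<close>, because this contraction involves no set that contains
  \<open>c\<close> and so comes from the curve without the node \<open>c\<close>. The bound on \<open>p\<close> provides two indices
  outside \<open>J\<close> and makes \<open>A\<close>, whose degree is at most \<open>card N - 4 - p\<close>, available.
\<close>

theorem green_surj_from_deletions:
  assumes N: "finite N" "inj_on \<alpha> N" "inj_on \<beta> N" and p: "p + 4 \<le> card N"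
    and del: "\<And>c. c \<in> N \<Longrightarrow> green_surj (N - {c}) \<alpha> \<beta> p"
  shows "green_surj N \<alpha> \<beta> p"
  unfolding green_surj_def
proof
  fix G assume G: "G \<in> closed_families N p (card N - 3 - p)"
  define n where "n = card N - 4 - p"
  have n: "card N - 3 - p = Suc n" "card N - 2 - p = Suc (Suc n)" using p by (auto simp: n_def)
  define R where "R = {G. \<exists>L\<in>closed_families N (Suc p) (card N - 2 - p).
        \<forall>I\<subseteq>N. card I = p \<longrightarrow> green_map N \<alpha> \<beta> L I = G I}"
  have R_add: "(\<lambda>I. F I + F' I) \<in> R" if FF: "F \<in> R" "F' \<in> R" for F F'
  proof -
    obtain L L' where L: "L \<in> closed_families N (Suc p) (card N - 2 - p)"
       "L' \<in> closed_families N (Suc p) (card N - 2 - p)" 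
       "\<forall>I\<subseteq>N. card I = p \<longrightarrow> green_map N \<alpha> \<beta> L I = F I"
       "\<forall>I\<subseteq>N. card I = p \<longrightarrow> green_map N \<alpha> \<beta> L' I = F' I"
      using FF unfolding R_def mem_Collect_eq by blast
    then show ?thesis unfolding R_def
      by (auto intro!: bexI[of _ "\<lambda>J. L J + L' J"] closed_families_add simp: green_map_add)
  qed
  have R_0: "(\<lambda>_. 0) \<in> R"
    unfolding R_def by (auto intro!: bexI[of _ "\<lambda>_. 0"])
  have R_sum: "(\<lambda>I. \<Sum>x\<in>A. F x I) \<in> R" if "\<And>x. x \<in> A \<Longrightarrow> F x \<in> R" for A :: "nat set set" and F
    using that by (induction A rule: infinite_finite_induct) (auto simp: R_0 R_add)
  have piece: "(\<lambda>I. contract N (\<lambda>_. 1) (\<lambda>J'. if J' = J then [:- \<beta> c, 1:] * A else 0) I) \<in> R"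
    if J: "J \<subseteq> N" "card J = Suc p" and c: "c \<in> N - J" and A: "degree A \<le> n" for J c A
  proof -
    let ?F = "\<lambda>J'. if J' = J then A else 0"
    define G' where "G' = contract (N - {c}) (\<lambda>_. 1) ?F"
    have card: "card (N - {c}) - 3 - p = n" "card (N - {c}) - 2 - p = Suc n"
      using c N p by (auto simp: n_def)
    have "G' \<in> closed_families (N - {c}) p n"
      using N A unfolding closed_families_def G'_def
      by (auto intro!: degree_contract_le contract_contract)
    then obtain L where L: "L \<in> closed_families (N - {c}) (Suc p) (Suc n)"
       "\<forall>I\<subseteq>N - {c}. card I = p \<longrightarrow> green_map (N - {c}) \<alpha> \<beta> L I = G' I"
      using del[of c] c unfolding green_surj_def card by blast
    define L' where "L' J = (if c \<in> J then 0 else [:- \<alpha> c, 1:] * L J)" for J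
    have "L' \<in> closed_families N (Suc p) (card N - 2 - p)"
      unfolding L'_def n using N c L by (intro closed_families_extend_by_zero) auto
    moreover have "green_map N \<alpha> \<beta> L' I =
        contract N (\<lambda>_. 1) (\<lambda>J'. if J' = J then [:- \<beta> c, 1:] * A else 0) I"
      if I: "I \<subseteq> N" "card I = p" for I
    proof -
      have "green_map N \<alpha> \<beta> L' I = (if c \<in> I then 0 else [:- \<beta> c, 1:] * green_map (N - {c}) \<alpha> \<beta> L I)"
        unfolding L'_def using c I N by (intro green_map_extend_by_zero) auto
      also have "\<dots> = (if c \<in> I then 0 else [:- \<beta> c, 1:] * G' I)"
        using L(2) I by (simp add: subset_Diff_insert)
      also have "\<dots> = contract N (\<lambda>_. 1) (\<lambda>I. if c \<in> I then 0 else [:- \<beta> c, 1:] * ?F I) I"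
        unfolding G'_def using N c by (subst contract_extend_by_zero) auto
      also have "(\<lambda>I. if c \<in> I then 0 else [:- \<beta> c, 1:] * ?F I) =
          (\<lambda>J'. if J' = J then [:- \<beta> c, 1:] * A else 0)"
        using c by auto
      finally show ?thesis .
    qed
    ultimately show ?thesis unfolding R_def by blast
  qed
  have "card N > 0" using p by simp
  then obtain m where m: "m \<in> N" by (auto simp: card_gt_0_iff)
  \<comment> \<open>Contraction with (1, ..., 1) has the contracting homotopy given by multiplication with
    \<open>e\<^sub>m\<close>.\<close>
  define K where "K = wedge (\<lambda>i. if i = m then 1 else 0) G"
  have GK: "G I = contract N (\<lambda>_. 1) K I" if I: "I \<subseteq> N" "card I = p" for I
  proof -
    have "wedge (\<lambda>i. if i = m then 1 else 0) (contract N (\<lambda>_. 1) G) I = 0"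
      unfolding wedge_def
    proof (rule sum.neutral, rule ballI)
      fix i assume i: "i \<in> I"
      have "Suc (card (I - {i})) = p" using i I N finite_subset[of I N] card_Suc_Diff1[of I i] by (simp del: card_Diff_insert)
      moreover have "I - {i} \<subseteq> N" using I by auto
      ultimately have "contract N (\<lambda>_. 1) G (I - {i}) = 0" using G unfolding closed_families_def by blast
      then show "esign i I * (if i = m then 1 else 0) * contract N (\<lambda>_. 1) G (I - {i}) = 0" by simp
    qed
    then show ?thesis
      using m N I by (simp add: K_def contract_wedge)
  qed
  have degK: "degree (K J) \<le> Suc n" if J: "J \<subseteq> N" "card J = Suc p" for J
    unfolding K_def wedge_def
  proof (intro degree_sum_le)
    show "finite J" using J N finite_subset by auto
    fix i assume i: "i \<in> J"
    have "J - {i} \<subseteq> N" "card (J - {i}) = p" using J i \<open>finite J\<close> by auto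
    then have "degree (G (J - {i})) \<le> Suc n"
      using G unfolding closed_families_def n by blast
    then show "degree (esign i J * (if i = m then 1 else 0) * G (J - {i})) \<le> Suc n" by auto
  qed
  define \<J> where "\<J> = {J. J \<subseteq> N \<and> card J = Suc p}"
  have "finite \<J>" using N by (simp add: \<J>_def)
  have sum_in: "(\<lambda>I. contract N (\<lambda>_. 1) (\<lambda>J'. if J' = J then K J else 0) I) \<in> R" if J: "J \<in> \<J>" for J
  proof -
    have "finite J" using J N finite_subset by (auto simp: \<J>_def)
    then have "\<not> card (N - J) \<le> Suc 0" using J N p by (auto simp: \<J>_def card_Diff_subset)
    then obtain c c' where c: "c \<in> N - J" "c' \<in> N - J" "c \<noteq> c'"
      using card_le_Suc0_iff_eq[of "N - J"] N by auto
    then have "\<beta> c \<noteq> \<beta> c'" using N by (auto simp: inj_on_def)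
    then obtain A B where AB: "degree A \<le> n" "degree B \<le> n" 
        "K J = [:- \<beta> c, 1:] * A + [:- \<beta> c', 1:] * B"
      using split_at_two_points degK J unfolding \<J>_def by blast
    have "(\<lambda>I. contract N (\<lambda>_. 1) (\<lambda>J'. if J' = J then [:- \<beta> c, 1:] * A else 0) I +
      contract N (\<lambda>_. 1) (\<lambda>J'. if J' = J then [:- \<beta> c', 1:] * B else 0) I) \<in> R"
      using J c AB by (intro R_add piece) (auto simp: \<J>_def)
    also have "(\<lambda>I. contract N (\<lambda>_. 1) (\<lambda>J'. if J' = J then [:- \<beta> c, 1:] * A else 0) I +
      contract N (\<lambda>_. 1) (\<lambda>J'. if J' = J then [:- \<beta> c', 1:] * B else 0) I) = 
      (\<lambda>I. contract N (\<lambda>_. 1) (\<lambda>J'. if J' = J then K J else 0) I)"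
      unfolding contract_add[symmetric] by (intro ext arg_cong2[of _ _ _ _ "contract N (\<lambda>_. 1)"] refl) (simp add: AB(3) del: mult_pCons_left)
    finally show ?thesis .
  qed
  have "(\<lambda>I. \<Sum>J\<in>\<J>. contract N (\<lambda>_. 1) (\<lambda>J'. if J' = J then K J else 0) I) \<in> R"
    by (intro R_sum sum_in)
  then obtain L where L: "L \<in> closed_families N (Suc p) (card N - 2 - p)"
    "\<forall>I\<subseteq>N. card I = p \<longrightarrow> green_map N \<alpha> \<beta> L I =
        (\<Sum>J\<in>\<J>. contract N (\<lambda>_. 1) (\<lambda>J'. if J' = J then K J else 0) I)"
    unfolding R_def by auto
  moreover have "(\<Sum>J\<in>\<J>. contract N (\<lambda>_. 1) (\<lambda>J'. if J' = J then K J else 0) I) = G I"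
    if I: "I \<subseteq> N" "card I = p" for I
    unfolding contract_sum[symmetric] GK[OF I] using \<open>finite \<J>\<close> N I
    by (intro contract_cong) (auto simp: \<J>_def)
  ultimately show "\<exists>L\<in>closed_families N (Suc p) (card N - 2 - p).
        \<forall>I\<subseteq>N. card I = p \<longrightarrow> green_map N \<alpha> \<beta> L I = G I"
    by (intro bexI[of _ L]) auto
qed

lemma esign_image:
  assumes "strict_mono_on N \<sigma>" "i \<in> N" "I \<subseteq> N"
  shows "esign (\<sigma> i) (\<sigma> ` I) = esign i I"
proof -
  have "{j \<in> \<sigma> ` I. j < \<sigma> i} = \<sigma> ` {j \<in> I. j < i}"
    using assms by (auto simp: strict_mono_on_less)
  moreover have "inj_on \<sigma> {j \<in> I. j < i}"
    using assms strict_mono_on_imp_inj_on[OF assms(1)] by (auto intro: inj_on_subset)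
  ultimately show ?thesis by (simp add: esign_def card_image)
qed

lemma contract_image:
  assumes "strict_mono_on N \<sigma>" "I \<subseteq> N"
  shows "contract (\<sigma> ` N) (\<lambda>_. 1) F (\<sigma> ` I) = contract N (\<lambda>_. 1) (\<lambda>J. F (\<sigma> ` J)) I"
proof -
  have inj: "inj_on \<sigma> N" using assms(1) by (rule strict_mono_on_imp_inj_on)
  have *: "\<sigma> ` N - \<sigma> ` I = \<sigma> ` (N - I)"
    using inj_on_image_set_diff[OF inj, of N I] assms(2) by auto
  have "inj_on \<sigma> (N - I)" using inj by (rule inj_on_subset) auto
  then show ?thesis
    unfolding contract_def * using assms
    by (subst sum.reindex) (auto intro!: sum.cong simp: esign_image)
qed

lemma node_poly_image: "inj_on \<sigma> I \<Longrightarrow> node_poly a (\<sigma> ` I) = node_poly (a \<circ> \<sigma>) I"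
  by (simp add: node_poly_def prod.reindex)

lemma transfer_image:
  assumes inj: "inj_on \<sigma> N" and J: "J \<subseteq> N"
  shows "transfer (\<sigma> ` N) \<alpha> \<beta> (\<sigma> ` J) f = transfer N (\<alpha> \<circ> \<sigma>) (\<beta> \<circ> \<sigma>) J f"
proof -
  have sub: "inj_on \<sigma> X" if "X \<subseteq> N" for X using inj that by (rule inj_on_subset)
  have [simp]: "\<sigma> ` N - \<sigma> ` J = \<sigma> ` (N - J)"
    using inj_on_image_set_diff[OF inj, of N J] J by auto
  have [simp]: "N - J - X \<subseteq> N" for X by auto
  have [simp]: "\<sigma> ` X - {\<sigma> l} = \<sigma> ` (X - {l})" if "l \<in> X" "X \<subseteq> N" for l X
    using inj_on_image_set_diff[OF inj, of X "{l}"] that by auto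
  show ?thesis
    unfolding transfer_def using J
    by (auto simp: sum.reindex sub node_poly_image intro!: sum.cong)
qed

text \<open>
  Only the order of the indices enters the definition, through the signs.
\<close>

lemma green_surj_relabel:
  assumes mono: "strict_mono_on N \<sigma>" and surj: "green_surj N (\<alpha> \<circ> \<sigma>) (\<beta> \<circ> \<sigma>) p"
  shows "green_surj (\<sigma> ` N) \<alpha> \<beta> p"
proof -
  have inj: "inj_on \<sigma> N" using mono by (rule strict_mono_on_imp_inj_on)
  have sub: "inj_on \<sigma> X" if "X \<subseteq> N" for X using inj that by (rule inj_on_subset)
  have card [simp]: "card (\<sigma> ` I) = card I" if "I \<subseteq> N" for I
    using sub[OF that] by (rule card_image)
  define pull where "pull J = {x \<in> N. \<sigma> x \<in> J}" for J
  have pull: "pull (\<sigma> ` I) = I" if I: "I \<subseteq> N" for I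
  proof
    show "pull (\<sigma> ` I) \<subseteq> I"
    proof
      fix x assume "x \<in> pull (\<sigma> ` I)"
      then have "x \<in> N" "\<sigma> x \<in> \<sigma> ` I" by (simp_all add: pull_def)
      then show "x \<in> I" using inj_on_image_mem_iff[OF inj _ I] by simp
    qed
    show "I \<subseteq> pull (\<sigma> ` I)" using I by (auto simp: pull_def)
  qed
  have closed_iff: "G \<in> closed_families (\<sigma> ` N) q n \<longleftrightarrow> (\<lambda>I. G (\<sigma> ` I)) \<in> closed_families N q n" for G q n
    unfolding closed_families_def mem_Collect_eq all_subset_image
    by (intro conj_cong iff_allI imp_cong refl) (simp_all add: contract_image[OF mono])
  show ?thesis
    unfolding green_surj_def
  proof
    fix G assume "G \<in> closed_families (\<sigma> ` N) p (card (\<sigma> ` N) - 3 - p)"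
    then have "(\<lambda>I. G (\<sigma> ` I)) \<in> closed_families N p (card N - 3 - p)"
      unfolding closed_iff card[OF subset_refl] .
    from surj[unfolded green_surj_def, rule_format, OF this]
    obtain L where L: "L \<in> closed_families N (Suc p) (card N - 2 - p)"
      "\<forall>I\<subseteq>N. card I = p \<longrightarrow> green_map N (\<alpha> \<circ> \<sigma>) (\<beta> \<circ> \<sigma>) L I = G (\<sigma> ` I)"
      by blast
    define L' where "L' J = L (pull J)" for J
    have L': "L' (\<sigma> ` J) = L J" if "J \<subseteq> N" for J using that by (simp only: L'_def pull)
    have "contract N (\<lambda>_. 1) (\<lambda>I. L' (\<sigma> ` I)) I = contract N (\<lambda>_. 1) L I" if "I \<subseteq> N" for I
      unfolding contract_def
    proof (rule sum.cong[OF refl])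
      fix i assume "i \<in> N - I"
      then have "insert i I \<subseteq> N" using that by auto
      then show "esign i I * 1 * L' (\<sigma> ` insert i I) = esign i I * 1 * L (insert i I)"
        by (simp only: L')
    qed
    then have "L' \<in> closed_families (\<sigma> ` N) (Suc p) (card N - 2 - p)"
      unfolding closed_iff using L(1) unfolding closed_families_def mem_Collect_eq
      using L' by simp
    moreover have "green_map (\<sigma> ` N) \<alpha> \<beta> L' (\<sigma> ` I) = green_map N (\<alpha> \<circ> \<sigma>) (\<beta> \<circ> \<sigma>) L I" if "I \<subseteq> N" for I
      unfolding green_map_def contract_image[OF mono that]
      unfolding contract_def
    proof (rule sum.cong[OF refl])
      fix i assume "i \<in> N - I"
      then have "insert i I \<subseteq> N" using that by auto
      then show "esign i I * 1 * transfer (\<sigma> ` N) \<alpha> \<beta> (\<sigma> ` insert i I) (L' (\<sigma> ` insert i I)) =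
          esign i I * 1 * transfer N (\<alpha> \<circ> \<sigma>) (\<beta> \<circ> \<sigma>) (insert i I) (L (insert i I))"
        by (simp only: L' transfer_image[OF inj])
    qed
    ultimately show "\<exists>L\<in>closed_families (\<sigma> ` N) (Suc p) (card (\<sigma> ` N) - 2 - p).
        \<forall>I\<subseteq>\<sigma> ` N. card I = p \<longrightarrow> green_map (\<sigma> ` N) \<alpha> \<beta> L I = G I"
      unfolding all_subset_image using L(2) by (intro bexI[of _ L']) (simp_all add: card)
  qed
qed

section \<open>Polynomial maps and openness\<close>

lemma polynomial_maps_sum:
  "(\<And>x. x \<in> A \<Longrightarrow> f x \<in> polynomial_maps I) \<Longrightarrow> (\<lambda>a. \<Sum>x\<in>A. f x a) \<in> polynomial_maps I"
  by (induction A rule: infinite_finite_induct) (auto intro: polynomial_maps.intros)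

lemma polynomial_maps_prod:
  "(\<And>x. x \<in> A \<Longrightarrow> f x \<in> polynomial_maps I) \<Longrightarrow> (\<lambda>a. \<Prod>x\<in>A. f x a) \<in> polynomial_maps I"
  by (induction A rule: infinite_finite_induct) (auto intro: polynomial_maps.intros)

lemma polynomial_maps_uminus:
  "f \<in> polynomial_maps I \<Longrightarrow> (\<lambda>a. - f a) \<in> polynomial_maps I"
  using polynomial_maps.mult[OF polynomial_maps.const[of "- 1"], of f I] by simp

lemma polynomial_maps_diff:
  "f \<in> polynomial_maps I \<Longrightarrow> h \<in> polynomial_maps I \<Longrightarrow> (\<lambda>a. f a - h a) \<in> polynomial_maps I"
  using polynomial_maps.add[of f I "\<lambda>a. - h a"] polynomial_maps_uminus[of h I] by simp

lemma polynomial_maps_power: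
  "f \<in> polynomial_maps I \<Longrightarrow> (\<lambda>a. f a ^ n) \<in> polynomial_maps I"
  by (induction n) (auto intro: polynomial_maps.intros)

lemmas polynomial_maps_intros = polynomial_maps.intros polynomial_maps_sum polynomial_maps_prod
  polynomial_maps_uminus polynomial_maps_diff polynomial_maps_power

lemma polynomial_maps_cong:
  "f \<in> polynomial_maps I \<Longrightarrow> (\<And>i. i \<in> I \<Longrightarrow> a i = b i) \<Longrightarrow> f a = f b"
  by (induction rule: polynomial_maps.induct) auto

text \<open>
  Nonzero polynomial maps in many variables are compared on the line through two points where they
  do not vanish. There they are polynomials in one variable, with finitely many zeros.
\<close>

lemma polynomial_maps_on_line:
  assumes "f \<in> polynomial_maps I"
  shows "\<exists>P. \<forall>z. f (\<lambda>i. a i + z * (b i - a i)) = poly P z"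
  using assms
proof (induction rule: polynomial_maps.induct)
  case (const c)
  then show ?case by (intro exI[of _ "[:c:]"]) simp
next
  case (coord i)
  then show ?case by (intro exI[of _ "[:a i, b i - a i:]"]) simp
next
  case (add f h)
  from add.IH(1) obtain P where P: "\<forall>z. f (\<lambda>i. a i + z * (b i - a i)) = poly P z" ..
  from add.IH(2) obtain Q where Q: "\<forall>z. h (\<lambda>i. a i + z * (b i - a i)) = poly Q z" ..
  show ?case by (rule exI[of _ "P + Q"]) (simp only: poly_add spec[OF P] spec[OF Q] simp_thms)
next
  case (mult f h)
  from mult.IH(1) obtain P where P: "\<forall>z. f (\<lambda>i. a i + z * (b i - a i)) = poly P z" ..
  from mult.IH(2) obtain Q where Q: "\<forall>z. h (\<lambda>i. a i + z * (b i - a i)) = poly Q z" ..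
  show ?case by (rule exI[of _ "P * Q"]) (simp only: poly_mult spec[OF P] spec[OF Q] simp_thms)
qed

lemma polynomial_maps_mult_nonzero:
  assumes "f \<in> polynomial_maps I" "h \<in> polynomial_maps I" "f a \<noteq> 0" "h b \<noteq> 0"
  shows "\<exists>c. f c * h c \<noteq> 0"
proof -
  from polynomial_maps_on_line[OF assms(1)] obtain P
    where P: "\<forall>z. f (\<lambda>i. a i + z * (b i - a i)) = poly P z" ..
  from polynomial_maps_on_line[OF assms(2)] obtain Q
    where Q: "\<forall>z. h (\<lambda>i. a i + z * (b i - a i)) = poly Q z" ..
  have "poly P 0 \<noteq> 0" using spec[OF P, of 0] assms(3) by simp
  moreover have "poly Q 1 \<noteq> 0" using spec[OF Q, of 1] assms(4) by simp
  ultimately have "P * Q \<noteq> 0" by (metis mult_eq_0_iff poly_0)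
  then have "finite {z. poly (P * Q) z = 0}" by (rule poly_roots_finite)
  from ex_new_if_finite[OF infinite_UNIV_char_0 this]
  obtain z where z: "z \<notin> {z. poly (P * Q) z = 0}" ..
  show ?thesis
    using z by (intro exI[of _ "\<lambda>i. a i + z * (b i - a i)"]) (simp add: spec[OF P] spec[OF Q])
qed

lemma polynomial_maps_prod_nonzero:
  assumes "finite A" "\<And>x. x \<in> A \<Longrightarrow> f x \<in> polynomial_maps I" "\<And>x. x \<in> A \<Longrightarrow> \<exists>a. f x a \<noteq> 0"
  shows "\<exists>a. (\<Prod>x\<in>A. f x a) \<noteq> 0"
  using assms
proof (induction A rule: finite_induct)
  case (insert x A)
  from insert.prems(2)[OF insertI1] obtain a where a: "f x a \<noteq> 0" ..
  from insert.IH[OF insert.prems[OF insertI2]] obtain b where b: "(\<Prod>x\<in>A. f x b) \<noteq> 0" by blast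
  have "(\<lambda>c. \<Prod>x\<in>A. f x c) \<in> polynomial_maps I"
    by (rule polynomial_maps_prod[OF insert.prems(1)[OF insertI2]])
  from polynomial_maps_mult_nonzero[OF insert.prems(1)[OF insertI1] this, of a b] a b
  show ?case using insert.hyps by simp
qed simp

lemma for_generic_parametersI:
  assumes f: "f \<in> polynomial_maps ({1..g} \<times> {1, 2})" "f b \<noteq> 0"
    and P: "\<And>a. f a \<noteq> 0 \<Longrightarrow> P a"
  shows "for_generic_parameters g P"
proof -
  let ?I = "{1..g} \<times> {1, 2 :: nat}"
  define U where "U = (?I \<rightarrow>\<^sub>E UNIV) - {a. f a = 0}"
  have "zariski_open ?I U"
    unfolding zariski_open_def U_def using f(1) by (intro exI[of _ "{f}"]) simp
  moreover have "f (restrict b ?I) = f b"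
    using f(1) by (rule polynomial_maps_cong) simp
  then have "restrict b ?I \<in> U" using f(2) by (simp add: U_def)
  then have "U \<noteq> {}" by blast
  moreover have "\<forall>a\<in>U. P a" using P by (simp add: U_def)
  ultimately show ?thesis unfolding for_generic_parameters_def by blast
qed

text \<open>
  A square matrix with polynomial entries that is the identity at one point remains invertible off a
  hypersurface which avoids that point. The proof is Gaussian elimination: the pivot is 1 at the
  base point and the Schur complement, cleared of its denominator, is again the identity there.
\<close>

lemma linear_system_solvable_near_identity:
  assumes "finite X"
    and "\<And>x y. x \<in> X \<Longrightarrow> y \<in> X \<Longrightarrow> m x y \<in> polynomial_maps I"
    and "\<And>x y. x \<in> X \<Longrightarrow> y \<in> X \<Longrightarrow> m x y b = (if x = y then 1 else 0)"
  shows "\<exists>f\<in>polynomial_maps I. f b \<noteq> 0 \<and>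
    (\<forall>a. f a \<noteq> 0 \<longrightarrow> (\<forall>w. \<exists>v. \<forall>x\<in>X. (\<Sum>y\<in>X. m x y a * v y) = w x))"
  using assms
proof (induction X arbitrary: m rule: finite_induct)
  case empty
  then show ?case by (intro bexI[of _ "\<lambda>_. 1"]) (auto intro: polynomial_maps.intros)
next
  case (insert x0 X)
  define m' where "m' x y a = m x0 x0 a * m x y a - m x x0 a * m x0 y a" for x y a
  have "\<exists>f\<in>polynomial_maps I. f b \<noteq> 0 \<and>
    (\<forall>a. f a \<noteq> 0 \<longrightarrow> (\<forall>w. \<exists>v. \<forall>x\<in>X. (\<Sum>y\<in>X. m' x y a * v y) = w x))"
  proof (rule insert.IH)
    fix x y assume xy: "x \<in> X" "y \<in> X"
    show "m' x y \<in> polynomial_maps I"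
      unfolding m'_def[abs_def] using xy insert.prems(1)
      by (intro polynomial_maps_diff polynomial_maps.mult) auto
    show "m' x y b = (if x = y then 1 else 0)"
      unfolding m'_def using xy insert.prems(2) insert.hyps by auto
  qed
  then obtain f where f: "f \<in> polynomial_maps I" "f b \<noteq> 0"
    and sol: "\<And>a w. f a \<noteq> 0 \<Longrightarrow> \<exists>v. \<forall>x\<in>X. (\<Sum>y\<in>X. m' x y a * v y) = w x"
    by blast
  have "\<exists>v. \<forall>x\<in>insert x0 X. (\<Sum>y\<in>insert x0 X. m x y a * v y) = w x"
    if a: "f a * m x0 x0 a \<noteq> 0" for a w
  proof -
    have pivot: "m x0 x0 a \<noteq> 0" using a by auto
    obtain v where v: "\<And>x. x \<in> X \<Longrightarrow> (\<Sum>y\<in>X. m' x y a * v y) = m x0 x0 a * w x - m x x0 a * w x0"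
      using sol[of a "\<lambda>x. m x0 x0 a * w x - m x x0 a * w x0"] a by auto
    define v' where "v' = v(x0 := (w x0 - (\<Sum>y\<in>X. m x0 y a * v y)) / m x0 x0 a)"
    have sum: "(\<Sum>y\<in>insert x0 X. m x y a * v' y) = m x x0 a * v' x0 + (\<Sum>y\<in>X. m x y a * v y)" for x
      using insert.hyps by (simp add: v'_def) (intro sum.cong, auto)
    have v'0: "m x0 x0 a * v' x0 = w x0 - (\<Sum>y\<in>X. m x0 y a * v y)"
      using pivot by (simp add: v'_def)
    have "(\<Sum>y\<in>insert x0 X. m x y a * v' y) = w x" if x: "x \<in> insert x0 X" for x
    proof (cases "x = x0")
      case True
      then show ?thesis using sum[of x0] v'0 by simp
    next
      case False
      then have "x \<in> X" using x by simp
      have "m x0 x0 a * (\<Sum>y\<in>insert x0 X. m x y a * v' y) =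
          m x x0 a * (m x0 x0 a * v' x0) + m x0 x0 a * (\<Sum>y\<in>X. m x y a * v y)"
        unfolding sum by (simp add: distrib_left mult_ac)
      also have "\<dots> = m x x0 a * w x0 + (\<Sum>y\<in>X. m' x y a * v y)"
        unfolding v'0 m'_def
        by (simp add: algebra_simps sum_subtractf sum_distrib_left)
      also have "\<dots> = m x0 x0 a * w x" by (simp add: v[OF \<open>x \<in> X\<close>])
      finally show ?thesis using pivot by simp
    qed
    then show ?thesis by blast
  qed
  moreover have "(\<lambda>a. f a * m x0 x0 a) \<in> polynomial_maps I"
    using f insert.prems(1) by (intro polynomial_maps.mult) auto
  moreover have "f b * m x0 x0 b \<noteq> 0" using f insert.prems(2) by simp
  ultimately show ?case by (intro bexI[of _ "\<lambda>a. f a * m x0 x0 a"]) auto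
qed

lemma polynomial_maps_poly:
  "h \<in> polynomial_maps I \<Longrightarrow> (\<lambda>a. poly P (h a)) \<in> polynomial_maps I"
  unfolding poly_altdef by (intro polynomial_maps_intros)

lemma polynomial_maps_poly_node_poly:
  assumes "\<And>r. r \<in> S \<Longrightarrow> (r, j) \<in> I" "h \<in> polynomial_maps I"
  shows "(\<lambda>a. poly (node_poly (\<lambda>l. a (l, j)) S) (h a)) \<in> polynomial_maps I"
  unfolding poly_node_poly using assms by (intro polynomial_maps_intros) auto

lemma polynomial_maps_coeff_node_poly:
  assumes "\<And>r. r \<in> S \<Longrightarrow> (r, j) \<in> I"
  shows "(\<lambda>a. coeff (node_poly (\<lambda>l. a (l, j)) S) n) \<in> polynomial_maps I"
proof (cases "finite S")
  case True
  then show ?thesis using assms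
  proof (induction S arbitrary: n rule: finite_induct)
    case empty
    then show ?case by (simp add: node_poly_def polynomial_maps.const)
  next
    case (insert x S)
    have *: "coeff (node_poly (\<lambda>l. a (l, j)) (insert x S)) n =
      (case n of 0 \<Rightarrow> 0 | Suc n' \<Rightarrow> coeff (node_poly (\<lambda>l. a (l, j)) S) n')
        - a (x, j) * coeff (node_poly (\<lambda>l. a (l, j)) S) n" for a :: "nat \<times> 'a \<Rightarrow> complex"
      using insert.hyps by (simp add: node_poly_insert coeff_pCons split: nat.splits)
    show ?case
      unfolding * using insert.IH insert.prems
      by (cases n) (auto intro!: polynomial_maps_intros)
  qed
qed (simp add: node_poly_def polynomial_maps.const)

section \<open>Openness of surjectivity\<close>

text \<open>
  The coefficients on the sets that avoid a fixed index \<open>m\<close> are coordinates on the space of closed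
  families: closedness on \<open>I - {m}\<close> expresses the coefficient on a set \<open>I\<close> containing \<open>m\<close> through
  them.
\<close>

lemma closed_families_eqI:
  assumes N: "finite N" "m \<in> N"
    and F: "F \<in> closed_families N p n" and G: "G \<in> closed_families N p n"
    and eq: "\<And>I. I \<subseteq> N - {m} \<Longrightarrow> card I = p \<Longrightarrow> F I = G I"
    and I: "I \<subseteq> N" "card I = p"
  shows "F I = G I"
proof (cases "m \<in> I")
  case False
  then show ?thesis using eq I by (simp add: subset_Diff_insert)
next
  case True
  define J where "J = I - {m}"
  have fin: "finite I" using I N finite_subset by auto
  have J: "J \<subseteq> N" "Suc (card J) = p" "m \<notin> J" "I = insert m J" "finite J"
    using True I fin card_Suc_Diff1[OF fin True] by (auto simp: J_def simp del: card_Diff_insert)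
  have *: "H I = - (esign m J * (\<Sum>i\<in>N - J - {m}. esign i J * H (insert i J)))"
    if "H \<in> closed_families N p n" for H
  proof -
    have "0 = contract N (\<lambda>_. 1) H J" using that J by (auto simp: closed_families_def)
    also have "\<dots> = esign m J * H I + (\<Sum>i\<in>N - J - {m}. esign i J * H (insert i J))"
      unfolding contract_def using N J by (subst sum.remove[of _ m]) auto
    finally have "esign m J * H I = - (\<Sum>i\<in>N - J - {m}. esign i J * H (insert i J))"
      by (simp add: eq_neg_iff_add_eq_0)
    then have "esign m J * (esign m J * H I) = - (esign m J * (\<Sum>i\<in>N - J - {m}. esign i J * H (insert i J)))"
      by simp
    then show ?thesis by simp
  qed
  have "(\<Sum>i\<in>N - J - {m}. esign i J * F (insert i J)) = (\<Sum>i\<in>N - J - {m}. esign i J * G (insert i J))"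
  proof (rule sum.cong[OF refl])
    fix i assume "i \<in> N - J - {m}"
    then have "insert i J \<subseteq> N - {m}" "card (insert i J) = p" using J by auto
    then show "esign i J * F (insert i J) = esign i J * G (insert i J)" using eq by simp
  qed
  then show ?thesis using *[OF F] *[OF G] by simp
qed

text \<open>
  The witness is the contraction of a multiple of \<open>e\<^sub>m \<and> e\<^sub>I\<close>.
\<close>

lemma ex_closed_family_coordinate:
  assumes N: "finite N" "m \<in> N" and I: "I \<subseteq> N - {m}" "card I = p" and j: "j \<le> n"
  shows "\<exists>G\<in>closed_families N p n. \<forall>I'\<subseteq>N - {m}. G I' = (if I' = I then monom 1 j else 0)"
proof -
  define K where "K J = (if J = insert m I then esign m I * monom 1 j else (0 :: complex poly))" for J
  have "contract N (\<lambda>_. 1) K \<in> closed_families N p n"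
    unfolding closed_families_def mem_Collect_eq
    using N j contract_contract[OF N(1), of _ "\<lambda>_. 1" K]
    by (intro conjI allI impI degree_contract_le) (simp_all add: K_def degree_monom_eq)
  moreover have "contract N (\<lambda>_. 1) K I' = (if I' = I then monom 1 j else 0)" if I': "I' \<subseteq> N - {m}" for I'
  proof -
    have "contract N (\<lambda>_. 1) K I' = (\<Sum>i\<in>N - I'. if i = m then (if I' = I then monom 1 j else 0) else 0)"
      unfolding contract_def
    proof (rule sum.cong[OF refl])
      fix i assume i: "i \<in> N - I'"
      have mI: "m \<notin> I" "m \<notin> I'" "i \<notin> I'" using I I' i by auto
      have "i = m \<and> I' = I" if eq: "insert i I' = insert m I"
      proof -
        have "m \<in> insert i I'" unfolding eq by simp
        then have "i = m" using mI by simp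
        then show ?thesis using eq mI by (simp add: insert_ident)
      qed
      then have "insert i I' = insert m I \<longleftrightarrow> i = m \<and> I' = I" by auto
      then show "esign i I' * 1 * K (insert i I') = (if i = m then (if I' = I then monom 1 j else 0) else 0)"
        by (auto simp: K_def)
    qed
    moreover have "m \<in> N - I'" using N I' by auto
    ultimately show ?thesis using N by simp
  qed
  ultimately show ?thesis by (intro bexI[of _ "contract N (\<lambda>_. 1) K"] allI impI)
qed

text \<open>
  The map \<open>green_map\<close> multiplied by the common denominator of its interpolation coefficients, so
  that it depends polynomially on the nodes.
\<close>

definition green_map_numerator ::
    "nat set \<Rightarrow> (nat \<Rightarrow> complex) \<Rightarrow> (nat \<Rightarrow> complex) \<Rightarrow> (nat set \<Rightarrow> complex poly) \<Rightarrow> nat set \<Rightarrow> complex poly" where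
  "green_map_numerator N \<alpha> \<beta> L = contract N (\<lambda>_. 1) (\<lambda>J. \<Sum>l\<in>N - J.
      smult (poly (node_poly \<alpha> J) (\<alpha> l) * poly (L J) (\<alpha> l) *
          (\<Prod>l'\<in>N - {l}. poly (node_poly \<alpha> (N - {l'})) (\<alpha> l')))
        (node_poly \<beta> (N - J - {l})))"

lemma green_map_numerator:
  assumes N: "finite N" "inj_on \<alpha> N" and I: "I \<subseteq> N"
  shows "green_map_numerator N \<alpha> \<beta> L I =
    smult (\<Prod>l\<in>N. poly (node_poly \<alpha> (N - {l})) (\<alpha> l)) (green_map N \<alpha> \<beta> L I)"
proof -
  have *: "smult c (sum F A) = (\<Sum>x\<in>A. smult c (F x))" for F :: "nat \<Rightarrow> complex poly" and A c
    by (induction A rule: infinite_finite_induct) (auto simp: smult_add_right)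
  have "(\<Prod>l\<in>N. poly (node_poly \<alpha> (N - {l})) (\<alpha> l)) * (x / poly (node_poly \<alpha> (N - {l})) (\<alpha> l)) =
      x * (\<Prod>l'\<in>N - {l}. poly (node_poly \<alpha> (N - {l'})) (\<alpha> l'))" if "l \<in> N" for l x
    using that N poly_node_poly_eq_0_iff[OF N, of "N - {l}" l] by (simp add: prod.remove[of N l])
  then show ?thesis
    unfolding green_map_numerator_def green_map_def contract_smult[symmetric]
    by (intro arg_cong[of _ _ "\<lambda>f. contract N (\<lambda>_. 1) f I"] ext) (simp add: transfer_def * )
qed

text \<open>
  Preimages \<open>L x\<close> of the coordinate vectors of the target at the base point \<open>b\<close> are kept fixed when
  the parameters vary. The matrix \<open>M\<close> of their images is the identity at \<open>b\<close>, and wherever it is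
  invertible these images span the target. Since \<open>M\<close> records only the coefficients up to degree \<open>n\<close>,
  the degree bound of \<open>green_map_closed\<close> is needed to conclude that two families agree.
\<close>

theorem green_surj_open:
  assumes N: "finite N" "N \<times> {1, 2} \<subseteq> V" and p: "p + 3 \<le> card N"
    and inj: "inj_on (\<lambda>l. b (l, 1)) N"
    and surj: "green_surj N (\<lambda>l. b (l, 1)) (\<lambda>l. b (l, 2)) p"
  shows "\<exists>f\<in>polynomial_maps V. f b \<noteq> 0 \<and>
    (\<forall>a. f a \<noteq> 0 \<longrightarrow> inj_on (\<lambda>l. a (l, 1)) N \<longrightarrow> green_surj N (\<lambda>l. a (l, 1)) (\<lambda>l. a (l, 2 :: nat)) p)"
proof -
  define n where "n = card N - 3 - p"
  have n: "card N - 2 - p = Suc n" using p by (simp add: n_def)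
  obtain m where m: "m \<in> N" using p by (cases "N = {}") auto
  define X where "X = {I. I \<subseteq> N - {m} \<and> card I = p} \<times> {..n}"
  have "finite X" using N by (auto simp: X_def)
  let ?T = "\<lambda>a. green_map N (\<lambda>l. a (l, 1)) (\<lambda>l. a (l, 2 :: nat))"
  let ?T' = "\<lambda>a. green_map_numerator N (\<lambda>l. a (l, 1)) (\<lambda>l. a (l, 2 :: nat))"
  define \<Delta> where "\<Delta> a = (\<Prod>l\<in>N. poly (node_poly (\<lambda>l. a (l, 1 :: nat)) (N - {l})) (a (l, 1)))" for a
  have T': "?T' a L I = smult (\<Delta> a) (?T a L I)" if "inj_on (\<lambda>l. a (l, 1)) N" "I \<subseteq> N" for a L I
    unfolding \<Delta>_def by (rule green_map_numerator[OF N(1) that])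
  have \<Delta>: "\<Delta> a \<noteq> 0" if "inj_on (\<lambda>l. a (l, 1)) N" for a
    using poly_node_poly_eq_0_iff[OF N(1) that] N(1) by (auto simp: \<Delta>_def)
  have "\<exists>L\<in>closed_families N (Suc p) (Suc n). \<forall>I'\<subseteq>N - {m}. card I' = p \<longrightarrow>
      ?T b L I' = (if I' = fst x then monom 1 (snd x) else 0)" if x: "x \<in> X" for x
  proof -
    obtain G where G: "G \<in> closed_families N p n"
      "\<forall>I'\<subseteq>N - {m}. G I' = (if I' = fst x then monom 1 (snd x) else 0)"
      using ex_closed_family_coordinate[OF N(1) m, of "fst x" p "snd x" n] x by (auto simp: X_def)
    obtain L where "L \<in> closed_families N (Suc p) (Suc n)" "\<forall>I\<subseteq>N. card I = p \<longrightarrow> ?T b L I = G I"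
      using surj G(1) unfolding green_surj_def n_def[symmetric] n by blast
    moreover have "I' \<subseteq> N" if "I' \<subseteq> N - {m}" for I' using that by auto
    ultimately show ?thesis using G(2) by (intro bexI[of _ L]) auto
  qed
  then have "\<forall>x\<in>X. \<exists>L. L \<in> closed_families N (Suc p) (Suc n) \<and> (\<forall>I'\<subseteq>N - {m}. card I' = p \<longrightarrow>
      ?T b L I' = (if I' = fst x then monom 1 (snd x) else 0))"
    unfolding Bex_def by (rule ballI)
  from bchoice[OF this] obtain L where LL: "\<forall>x\<in>X. L x \<in> closed_families N (Suc p) (Suc n) \<and>
      (\<forall>I'\<subseteq>N - {m}. card I' = p \<longrightarrow> ?T b (L x) I' = (if I' = fst x then monom 1 (snd x) else 0))" ..
  have L: "L x \<in> closed_families N (Suc p) (Suc n)" if "x \<in> X" for x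
    using bspec[OF LL that] by (rule conjunct1)
  have TL: "?T b (L x) I' = (if I' = fst x then monom 1 (snd x) else 0)"
    if "x \<in> X" "I' \<subseteq> N - {m}" "card I' = p" for x I'
    using conjunct2[OF bspec[OF LL that(1)], rule_format, OF that(2,3)] .
  define M where "M y x a = coeff (?T' a (L x) (fst y)) (snd y) / \<Delta> b" for y x a
  have "\<exists>f\<in>polynomial_maps V. f b \<noteq> 0 \<and>
    (\<forall>a. f a \<noteq> 0 \<longrightarrow> (\<forall>w. \<exists>v. \<forall>y\<in>X. (\<Sum>x\<in>X. M y x a * v x) = w y))"
  proof (rule linear_system_solvable_near_identity[OF \<open>finite X\<close>])
    fix y x assume "y \<in> X" "x \<in> X"
    then have y: "fst y \<subseteq> N" "fst y \<subseteq> N - {m}" "card (fst y) = p" "snd y \<le> n" by (auto simp: X_def)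
    show "M y x b = (if y = x then 1 else 0)"
    proof -
      have "M y x b = coeff (?T b (L x) (fst y)) (snd y)"
        unfolding M_def T'[OF inj y(1)] using \<Delta>[OF inj] by simp
      then show ?thesis
        unfolding TL[OF \<open>x \<in> X\<close> y(2,3)] by (cases x; cases y) simp
    qed
    have "(\<lambda>a. coeff (?T' a (L x) (fst y)) (snd y)) \<in> polynomial_maps V"
      unfolding green_map_numerator_def coeff_contract
      unfolding contract_def coeff_sum coeff_smult
      using N y(1) by (intro polynomial_maps_intros polynomial_maps_poly polynomial_maps_poly_node_poly
          polynomial_maps_coeff_node_poly) auto
    from polynomial_maps.mult[OF polynomial_maps.const[of "1 / \<Delta> b"] this]
    show "M y x \<in> polynomial_maps V" by (simp add: M_def[abs_def])
  qed
  then obtain f where f: "f \<in> polynomial_maps V" "f b \<noteq> 0"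
    and sol: "\<forall>a. f a \<noteq> 0 \<longrightarrow> (\<forall>w. \<exists>v. \<forall>y\<in>X. (\<Sum>x\<in>X. M y x a * v x) = w y)"
    by (elim bexE conjE)
  have "green_surj N (\<lambda>l. a (l, 1)) (\<lambda>l. a (l, 2)) p"
    if a: "f a \<noteq> 0" "inj_on (\<lambda>l. a (l, 1)) N" for a
    unfolding green_surj_def n n_def[symmetric]
  proof
    fix G assume G: "G \<in> closed_families N p n"
    from sol[rule_format, OF a(1), of "\<lambda>y. coeff (G (fst y)) (snd y)"]
    obtain v where v: "\<forall>y\<in>X. (\<Sum>x\<in>X. M y x a * v x) = coeff (G (fst y)) (snd y)" ..
    define L' where "L' J = (\<Sum>x\<in>X. smult (v x * \<Delta> a / \<Delta> b) (L x J))" for J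
    have L': "L' \<in> closed_families N (Suc p) (Suc n)"
      unfolding L'_def by (intro closed_families_sum closed_families_smult L)
    have TL': "?T a L' \<in> closed_families N p n"
      by (rule green_map_closed[OF N(1) a(2) p, unfolded n n_def[symmetric], OF L'])
    have "?T a L' I = G I" if I: "I \<subseteq> N - {m}" "card I = p" for I
    proof (rule poly_eqI)
      fix j
      have IN: "I \<subseteq> N" using I by auto
      show "coeff (?T a L' I) j = coeff (G I) j"
      proof (cases "j \<le> n")
        case True
        have "coeff (?T a L' I) j = (\<Sum>x\<in>X. M (I, j) x a * v x)"
          unfolding L'_def green_map_sum green_map_smult coeff_sum coeff_smult
        proof (rule sum.cong[OF refl])
          fix x
          have "M (I, j) x a = \<Delta> a * coeff (?T a (L x) I) j / \<Delta> b"
            unfolding M_def fst_conv snd_conv T'[OF a(2) IN] by simp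
          then show "v x * \<Delta> a / \<Delta> b * coeff (?T a (L x) I) j = M (I, j) x a * v x" by simp
        qed
        also have "\<dots> = coeff (G I) j"
          using bspec[OF v, of "(I, j)"] I True by (simp add: X_def)
        finally show ?thesis .
      next
        case False
        have "degree (?T a L' I) \<le> n" "degree (G I) \<le> n"
          using TL' G IN I(2) unfolding closed_families_def by blast+
        then show ?thesis using False by (simp add: coeff_eq_0)
      qed
    qed
    then have "?T a L' I = G I" if "I \<subseteq> N" "card I = p" for I
      by (rule closed_families_eqI[OF N(1) m TL' G _ that])
    then show "\<exists>L\<in>closed_families N (Suc p) (Suc n). \<forall>I\<subseteq>N. card I = p \<longrightarrow> ?T a L I = G I"
      using L' by blast
  qed
  then show ?thesis using f by (intro bexI[of _ f] conjI allI impI)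
qed

section \<open>Koszul chains modulo relations\<close>

text \<open>
  The coefficient is an argument of \<open>f\<close> instead of a factor, so that one notion covers values in
  sections, in chains, and relabellings of symbols.
\<close>

definition lin_ext :: "('k \<Rightarrow> complex \<Rightarrow> 'b::ab_group_add) \<Rightarrow> ('k \<Rightarrow>\<^sub>0 complex) \<Rightarrow> 'b" where
  "lin_ext f x = (\<Sum>k\<in>Poly_Mapping.keys x. f k (Poly_Mapping.lookup x k))"

lemma lin_ext_superset:
  assumes "finite A" "Poly_Mapping.keys x \<subseteq> A" "\<And>k. f k 0 = 0"
  shows "lin_ext f x = (\<Sum>k\<in>A. f k (Poly_Mapping.lookup x k))"
  unfolding lin_ext_def using assms
  by (intro sum.mono_neutral_left) (auto simp: in_keys_iff)

lemma additive_0: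
  fixes f :: "complex \<Rightarrow> 'b::ab_group_add"
  assumes "\<And>c d. f (c + d) = f c + f d"
  shows "f 0 = 0"
  using assms[of 0 0] by simp

lemma lin_ext_single: "f k 0 = 0 \<Longrightarrow> lin_ext f (Poly_Mapping.single k c) = f k c"
  by (cases "c = 0") (simp_all add: lin_ext_def)

lemma lin_ext_add:
  assumes "\<And>k c d. f k (c + d) = f k c + f k d"
  shows "lin_ext f (x + y) = lin_ext f x + lin_ext f y"
proof -
  have 0: "f k 0 = 0" for k using assms by (rule additive_0)
  let ?A = "Poly_Mapping.keys x \<union> Poly_Mapping.keys y"
  have "lin_ext f (x + y) = (\<Sum>k\<in>?A. f k (Poly_Mapping.lookup (x + y) k))"
    using keys_add[of x y] by (intro lin_ext_superset 0) auto
  also have "\<dots> = (\<Sum>k\<in>?A. f k (Poly_Mapping.lookup x k)) + (\<Sum>k\<in>?A. f k (Poly_Mapping.lookup y k))"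
    by (simp add: lookup_add assms sum.distrib)
  also have "\<dots> = lin_ext f x + lin_ext f y"
    using lin_ext_superset[of ?A x f] lin_ext_superset[of ?A y f] 0 by simp
  finally show ?thesis .
qed

lemma lin_ext_0 [simp]: "lin_ext f 0 = 0"
  by (simp add: lin_ext_def)

lemma lin_ext_uminus:
  assumes "\<And>k c d. f k (c + d) = f k c + f k d"
  shows "lin_ext f (- x) = - lin_ext f x"
  using lin_ext_add[of f "- x" x, OF assms] by (simp add: eq_neg_iff_add_eq_0)

lemma lin_ext_diff:
  assumes "\<And>k c d. f k (c + d) = f k c + f k d"
  shows "lin_ext f (x - y) = lin_ext f x - lin_ext f y"
  using lin_ext_add[of f x "- y", OF assms] lin_ext_uminus[of f y, OF assms] by simp

lemma lin_ext_sum: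
  assumes "\<And>k c d. f k (c + d) = f k c + f k d"
  shows "lin_ext f (sum g A) = (\<Sum>x\<in>A. lin_ext f (g x))"
  by (induction A rule: infinite_finite_induct) (auto simp: lin_ext_add[OF assms])

lemma single_sum: "Poly_Mapping.single k (sum g A) = (\<Sum>x\<in>A. Poly_Mapping.single k (g x))"
  by (induction A rule: infinite_finite_induct) (auto simp: single_add)

lemma sum_singles: "(\<Sum>k\<in>Poly_Mapping.keys x. Poly_Mapping.single k (Poly_Mapping.lookup x k)) = x"
proof (rule poly_mapping_eqI)
  fix k
  show "Poly_Mapping.lookup (\<Sum>k\<in>Poly_Mapping.keys x. Poly_Mapping.single k (Poly_Mapping.lookup x k)) k =
      Poly_Mapping.lookup x k"
    by (simp add: lookup_sum lookup_single when_def in_keys_iff)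
qed

lemma fst_sec_scale [simp]: "fst (sec_scale c s) = smult c (fst s)"
  and snd_sec_scale [simp]: "snd (sec_scale c s) = smult c (snd s)"
  and fst_sec_mult [simp]: "fst (sec_mult s u) = fst s * fst u"
  and snd_sec_mult [simp]: "snd (sec_mult s u) = snd s * snd u"
  by (simp_all add: sec_scale_def sec_mult_def)

lemma sec_scale_add_left: "sec_scale (b + c) s = sec_scale b s + sec_scale c s"
  by (rule prod_eqI) (simp_all add: smult_add_left)

lemma sec_scale_add_right: "sec_scale c (s + t) = sec_scale c s + sec_scale c t"
  by (rule prod_eqI) (simp_all add: smult_add_right)

lemma sec_scale_sec_scale [simp]: "sec_scale b (sec_scale c s) = sec_scale (b * c) s"
  by (rule prod_eqI) simp_all

lemma sec_scale_0 [simp]: "sec_scale 0 s = 0"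
  and sec_scale_1 [simp]: "sec_scale 1 s = s"
  and sec_scale_0_right [simp]: "sec_scale c 0 = 0"
  by (rule prod_eqI; simp)+

lemma sec_scale_minus [simp]: "sec_scale (- c) s = - sec_scale c s"
  by (rule prod_eqI) simp_all

text \<open>
  The coordinates of \<open>s\<^sub>1 \<and> \<dots> \<and> s\<^sub>m\<close> in the basis \<open>e\<^sub>I\<close>, where \<open>\<kappa> i s\<close> is the \<open>i\<close>-th coordinate of \<open>s\<close>;
  the minors of the coordinate matrix, expanded along the first row.
\<close>

primrec wedge_coeff :: "(nat \<Rightarrow> sec \<Rightarrow> complex) \<Rightarrow> sec list \<Rightarrow> nat set \<Rightarrow> complex" where
  "wedge_coeff \<kappa> [] = (\<lambda>I. if I = {} then 1 else 0)"
| "wedge_coeff \<kappa> (s # ss) = wedge (\<lambda>i. \<kappa> i s) (wedge_coeff \<kappa> ss)"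

lemma wedge_add_left: "wedge (\<lambda>i. u i + v i) F I = wedge u F I + wedge v F I"
  by (simp add: wedge_def algebra_simps sum.distrib)

lemma wedge_add_right: "wedge u (\<lambda>I. F I + G I) I = wedge u F I + wedge u G I"
  by (simp add: wedge_def algebra_simps sum.distrib)

lemma wedge_mult_left: "wedge (\<lambda>i. c * u i) F I = c * wedge u F I"
  by (simp add: wedge_def sum_distrib_left mult_ac)

lemma wedge_mult_right: "wedge u (\<lambda>I. c * F I) I = c * wedge u F I"
  by (simp add: wedge_def sum_distrib_left mult_ac)

lemma wedge_cong: "(\<And>i. i \<in> I \<Longrightarrow> F (I - {i}) = G (I - {i})) \<Longrightarrow> wedge u F I = wedge u G I"
  by (simp add: wedge_def)

lemma wedge_coeff_update_add:
  assumes "\<And>i s t. \<kappa> i (s + t) = \<kappa> i s + \<kappa> i t" "k < length ss"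
  shows "wedge_coeff \<kappa> (ss[k := s + t]) I = wedge_coeff \<kappa> (ss[k := s]) I + wedge_coeff \<kappa> (ss[k := t]) I"
  using assms(2)
proof (induction ss arbitrary: k I)
  case (Cons r ss)
  then show ?case
    by (cases k) (auto simp: assms(1) wedge_add_left wedge_add_right[symmetric] intro!: wedge_cong)
qed simp

lemma wedge_coeff_update_scale:
  assumes "\<And>i c s. \<kappa> i (sec_scale c s) = c * \<kappa> i s" "k < length ss"
  shows "wedge_coeff \<kappa> (ss[k := sec_scale c s]) I = c * wedge_coeff \<kappa> (ss[k := s]) I"
  using assms(2)
proof (induction ss arbitrary: k I)
  case (Cons r ss)
  then show ?case
    by (cases k) (auto simp: assms(1) wedge_mult_left wedge_mult_right[symmetric] intro!: wedge_cong)
qed simp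

text \<open>
  Move \<open>s\<close> to the right until it meets its copy.
\<close>

lemma wedge_coeff_Cons_mem:
  "s \<in> set ss \<Longrightarrow> finite I \<Longrightarrow> wedge_coeff \<kappa> (s # ss) I = 0"
proof (induction ss arbitrary: I)
  case (Cons t ss)
  show ?case
  proof (cases "s = t")
    case True
    then show ?thesis using Cons.prems by (simp add: wedge_wedge_self)
  next
    case False
    have "wedge_coeff \<kappa> (s # t # ss) I = - wedge (\<lambda>i. \<kappa> i t) (wedge_coeff \<kappa> (s # ss)) I"
      using wedge_anticommute[OF Cons.prems(2)] by simp
    also have "wedge (\<lambda>i. \<kappa> i t) (wedge_coeff \<kappa> (s # ss)) I = 0"
      unfolding wedge_def using Cons False by (intro sum.neutral) auto
    finally show ?thesis by simp
  qed
qed simp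

lemma wedge_coeff_not_distinct:
  "\<not> distinct ss \<Longrightarrow> finite I \<Longrightarrow> wedge_coeff \<kappa> ss I = 0"
proof (induction ss arbitrary: I)
  case (Cons s ss)
  show ?case
  proof (cases "s \<in> set ss")
    case False
    then have "wedge_coeff \<kappa> ss (I - {i}) = 0" for i using Cons by auto
    then show ?thesis by (simp add: wedge_def)
  qed (use Cons wedge_coeff_Cons_mem in auto)
qed simp

definition chain_coeff :: "(nat \<Rightarrow> sec \<Rightarrow> complex) \<Rightarrow> (sec list \<times> sec \<Rightarrow>\<^sub>0 complex) \<Rightarrow> nat set \<Rightarrow> sec" where
  "chain_coeff \<kappa> x I = lin_ext (\<lambda>k c. sec_scale (c * wedge_coeff \<kappa> (fst k) I) (snd k)) x"

lemma chain_coeff_single [simp]: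
  "chain_coeff \<kappa> (Poly_Mapping.single (ss, u) c) I = sec_scale (c * wedge_coeff \<kappa> ss I) u"
  unfolding chain_coeff_def by (subst lin_ext_single) simp_all

lemma chain_coeff_add: "chain_coeff \<kappa> (x + y) I = chain_coeff \<kappa> x I + chain_coeff \<kappa> y I"
  and chain_coeff_diff: "chain_coeff \<kappa> (x - y) I = chain_coeff \<kappa> x I - chain_coeff \<kappa> y I"
  and chain_coeff_sum: "chain_coeff \<kappa> (sum g A) I = (\<Sum>x\<in>A. chain_coeff \<kappa> (g x) I)" for g :: "'x \<Rightarrow> _"
  unfolding chain_coeff_def
  by (intro lin_ext_add lin_ext_diff lin_ext_sum; simp add: distrib_right sec_scale_add_left)+

lemma chain_coeff_0 [simp]: "chain_coeff \<kappa> 0 I = 0"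
  by (simp add: chain_coeff_def)

text \<open>
  The coordinates are well defined on the quotient by the relations.
\<close>

lemma chain_coeff_relations:
  assumes \<kappa>: "\<And>i s t. \<kappa> i (s + t) = \<kappa> i s + \<kappa> i t" "\<And>i c s. \<kappa> i (sec_scale c s) = c * \<kappa> i s"
    and x: "x \<in> relations H m q" and I: "finite I"
  shows "chain_coeff \<kappa> x I = 0"
  using x
proof (induction rule: relations.induct)
  case (slot_add ss u i s s' c)
  then show ?case
    by (simp add: chain_coeff_diff wedge_coeff_update_add[of \<kappa>, OF \<kappa>(1)] symbols_def distrib_left sec_scale_add_left)
next
  case (slot_scale ss u i s z c)
  then show ?case
    by (simp add: chain_coeff_diff wedge_coeff_update_scale[of \<kappa>, OF \<kappa>(2)] symbols_def mult_ac)
next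
  case (alternating ss u i j c)
  then have "\<not> distinct ss" by (auto simp: symbols_def nth_eq_iff_index_eq)
  then show ?case using wedge_coeff_not_distinct[OF _ I] by simp
qed (simp_all add: chain_coeff_add chain_coeff_diff sec_scale_add_right mult_ac)

lemma koszul_d_lin_ext:
  "koszul_d = lin_ext (\<lambda>k c. \<Sum>l<length (fst k).
     Poly_Mapping.single (take l (fst k) @ drop (Suc l) (fst k), sec_mult (fst k ! l) (snd k))
       ((- 1) ^ Suc l * c))"
  by (rule ext) (simp add: koszul_d_def lin_ext_def case_prod_unfold)

lemma koszul_d_single:
  "koszul_d (Poly_Mapping.single (ss, u) c) = (\<Sum>l<length ss.
     Poly_Mapping.single (take l ss @ drop (Suc l) ss, sec_mult (ss ! l) u) ((- 1) ^ Suc l * c))"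
  unfolding koszul_d_lin_ext by (subst lin_ext_single) simp_all

lemma koszul_d_sum: "koszul_d (sum g A) = (\<Sum>x\<in>A. koszul_d (g x))"
  unfolding koszul_d_lin_ext by (intro lin_ext_sum) (simp only: distrib_left single_add sum.distrib)

lemma relations_uminus:
  assumes "x \<in> relations H m q"
  shows "- x \<in> relations H m q"
  using assms
proof (induction rule: relations.induct)
  case zero
  then show ?case using relations.zero by simp
next
  case (add x y)
  then show ?case using relations.add by fastforce
next
  case (slot_add ss u i s s' c)
  from relations.slot_add[OF this, of "- c"] show ?case by (simp add: single_uminus algebra_simps)
next
  case (slot_scale ss u i s z c)
  from relations.slot_scale[OF this, of z "- c"] show ?case by (simp add: single_uminus algebra_simps)
next
  case (coeff_add ss u u' c)
  from relations.coeff_add[OF this, of "- c"] show ?case by (simp add: single_uminus algebra_simps)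
next
  case (coeff_scale ss u z c)
  from relations.coeff_scale[OF this, of z "- c"] show ?case by (simp add: single_uminus algebra_simps)
next
  case (alternating ss u i j c)
  from relations.alternating[OF this, of "- c"] show ?case by (simp add: single_uminus)
qed

lemma relations_diff: "x \<in> relations H m q \<Longrightarrow> y \<in> relations H m q \<Longrightarrow> x - y \<in> relations H m q"
  using relations.add[OF _ relations_uminus] by fastforce

lemma relations_sum: "(\<And>i. i \<in> A \<Longrightarrow> f i \<in> relations H m q) \<Longrightarrow> sum f A \<in> relations H m q"
  by (induction A rule: infinite_finite_induct) (auto intro: relations.zero relations.add)

lemma relations_trans:
  "x - y \<in> relations H m q \<Longrightarrow> y - z \<in> relations H m q \<Longrightarrow> x - z \<in> relations H m q"
  using relations.add[of "x - y" H m q "y - z"] by simp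

lemma chains_0: "0 \<in> chains H m q"
  by (simp add: chains_def)

lemma chains_add: "x \<in> chains H m q \<Longrightarrow> y \<in> chains H m q \<Longrightarrow> x + y \<in> chains H m q"
  using keys_add[of x y] by (auto simp: chains_def)

lemma chains_diff: "x \<in> chains H m q \<Longrightarrow> y \<in> chains H m q \<Longrightarrow> x - y \<in> chains H m q"
  using keys_diff[of x y] by (auto simp: chains_def)

lemma chains_sum: "(\<And>i. i \<in> A \<Longrightarrow> f i \<in> chains H m q) \<Longrightarrow> sum f A \<in> chains H m q"
  by (induction A rule: infinite_finite_induct) (auto intro: chains_add simp: chains_0)

lemma chains_single: "(ss, u) \<in> symbols H m q \<Longrightarrow> Poly_Mapping.single (ss, u) c \<in> chains H m q"
  by (simp add: chains_def)

text \<open>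
  Multiplication with \<open>s\<close> from the left, on representatives.
\<close>

definition cons_chain :: "sec \<Rightarrow> (sec list \<times> sec \<Rightarrow>\<^sub>0 complex) \<Rightarrow> (sec list \<times> sec \<Rightarrow>\<^sub>0 complex)" where
  "cons_chain s = lin_ext (\<lambda>k. Poly_Mapping.single (s # fst k, snd k))"

lemma cons_chain_single [simp]:
  "cons_chain s (Poly_Mapping.single (ss, u) c) = Poly_Mapping.single (s # ss, u) c"
  unfolding cons_chain_def by (subst lin_ext_single) simp_all

lemma cons_chain_add: "cons_chain s (x + y) = cons_chain s x + cons_chain s y"
  and cons_chain_diff: "cons_chain s (x - y) = cons_chain s x - cons_chain s y"
  and cons_chain_sum: "cons_chain s (sum g A) = (\<Sum>x\<in>A. cons_chain s (g x))" for g :: "'x \<Rightarrow> _"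
  unfolding cons_chain_def by (intro lin_ext_add lin_ext_diff lin_ext_sum; simp add: single_add)+

lemma cons_chain_relations:
  assumes "x \<in> relations H m q" "s \<in> H 1"
  shows "cons_chain s x \<in> relations H (Suc m) q"
  using assms(1)
proof (induction rule: relations.induct)
  case zero
  then show ?case by (simp add: cons_chain_def relations.zero)
next
  case (add x y)
  then show ?case by (simp add: cons_chain_add relations.add)
next
  case (slot_add ss u i t t' c)
  with relations.slot_add[of "s # ss" u H "Suc m" q "Suc i" t t' c] assms(2)
  show ?case by (simp add: cons_chain_diff symbols_def)
next
  case (slot_scale ss u i t z c)
  with relations.slot_scale[of "s # ss" u H "Suc m" q "Suc i" t z c] assms(2)
  show ?case by (simp add: cons_chain_diff symbols_def)
next
  case (coeff_add ss u u' c)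
  with relations.coeff_add[of "s # ss" u H "Suc m" q u' c] assms(2)
  show ?case by (simp add: cons_chain_diff symbols_def)
next
  case (coeff_scale ss u z c)
  with relations.coeff_scale[of "s # ss" u H "Suc m" q z c] assms(2)
  show ?case by (simp add: cons_chain_diff symbols_def)
next
  case (alternating ss u i j c)
  with relations.alternating[of "s # ss" u H "Suc m" q "Suc i" "Suc j" c] assms(2)
  show ?case by (simp add: symbols_def)
qed

section \<open>Coordinates on the Koszul complex\<close>

locale koszul_basis =
  fixes H :: "nat \<Rightarrow> sec set" and N :: "nat set" and e :: "nat \<Rightarrow> sec" and \<kappa> :: "nat \<Rightarrow> sec \<Rightarrow> complex"
  assumes finite_N: "finite N"
    and H_0: "0 \<in> H q"
    and H_add: "s \<in> H q \<Longrightarrow> t \<in> H q \<Longrightarrow> s + t \<in> H q"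
    and H_scale: "s \<in> H q \<Longrightarrow> sec_scale c s \<in> H q"
    and H_mult: "s \<in> H 1 \<Longrightarrow> u \<in> H q \<Longrightarrow> sec_mult s u \<in> H (Suc q)"
    and e_in: "i \<in> N \<Longrightarrow> e i \<in> H 1"
    and \<kappa>_add: "\<kappa> i (s + t) = \<kappa> i s + \<kappa> i t"
    and \<kappa>_scale: "\<kappa> i (sec_scale c s) = c * \<kappa> i s"
    and \<kappa>_e: "i \<in> N \<Longrightarrow> j \<in> N \<Longrightarrow> \<kappa> i (e j) = (if i = j then 1 else 0)"
    and expansion: "s \<in> H 1 \<Longrightarrow> s = (\<Sum>i\<in>N. sec_scale (\<kappa> i s) (e i))"
begin

lemma H_sum: "(\<And>x. x \<in> A \<Longrightarrow> f x \<in> H q) \<Longrightarrow> sum f A \<in> H q"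
  by (induction A rule: infinite_finite_induct) (auto simp: H_0 H_add)

lemma chain_coeff_in:
  assumes "x \<in> chains H m q"
  shows "chain_coeff \<kappa> x I \<in> H q"
  unfolding chain_coeff_def lin_ext_def
  using assms by (intro H_sum H_scale) (auto simp: chains_def symbols_def)

lemma koszul_d_in:
  assumes "x \<in> chains H (Suc m) q"
  shows "koszul_d x \<in> chains H m (Suc q)"
  unfolding koszul_d_def case_prod_unfold
proof (intro chains_sum chains_single)
  fix k l assume k: "k \<in> Poly_Mapping.keys x" and l: "l \<in> {..<length (fst k)}"
  have "k \<in> symbols H (Suc m) q" using assms k by (auto simp: chains_def)
  then have "length (fst k) = Suc m" "set (fst k) \<subseteq> H 1" "snd k \<in> H q"
    by (simp_all add: symbols_def case_prod_unfold)
  moreover have "fst k ! l \<in> set (fst k)" using l by simp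
  moreover have "set (take l (fst k)) \<subseteq> set (fst k)" "set (drop (Suc l) (fst k)) \<subseteq> set (fst k)"
    by (rule set_take_subset, rule set_drop_subset)
  moreover have "sec_mult (fst k ! l) (snd k) \<in> H (Suc q)"
    using calculation(2,3,4) by (intro H_mult) auto
  ultimately show "(take l (fst k) @ drop (Suc l) (fst k), sec_mult (fst k ! l) (snd k)) \<in> symbols H m (Suc q)"
    using l by (simp add: symbols_def subset_iff)
qed

text \<open>
  Expand the vanishing symbol with \<open>s + t\<close> in both slots.
\<close>

lemma swap_relation:
  assumes "s \<in> H 1" "t \<in> H 1" "(ss, u) \<in> symbols H m q"
  shows "Poly_Mapping.single (s # t # ss, u) c + Poly_Mapping.single (t # s # ss, u) c \<in> relations H (Suc (Suc m)) q"
proof -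
  let ?S = "\<lambda>a b. Poly_Mapping.single (a # b # ss, u) c"
  have sym: "(a # b # ss, u) \<in> symbols H (Suc (Suc m)) q" if "a \<in> H 1" "b \<in> H 1" for a b
    using that assms(3) by (auto simp: symbols_def)
  have add0: "?S (a + a') b - ?S a b - ?S a' b \<in> relations H (Suc (Suc m)) q"
    if "a \<in> H 1" "a' \<in> H 1" "b \<in> H 1" for a a' b
    using relations.slot_add[OF sym[OF that(1,3)], of 0 a a' c] that by simp
  have add1: "?S a (b + b') - ?S a b - ?S a b' \<in> relations H (Suc (Suc m)) q"
    if "a \<in> H 1" "b \<in> H 1" "b' \<in> H 1" for a b b'
    using relations.slot_add[OF sym[OF that(1,2)], of 1 b b' c] that by simp
  have alt: "?S a a \<in> relations H (Suc (Suc m)) q" if "a \<in> H 1" for a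
    using relations.alternating[OF sym[OF that that], of 0 1 c] by simp
  have st: "s + t \<in> H 1" using assms H_add by simp
  let ?R = "relations H (Suc (Suc m)) q"
  have "?S (s + t) (s + t) - (?S (s + t) (s + t) - ?S s (s + t) - ?S t (s + t)) - (?S s (s + t) - ?S s s - ?S s t)
    - (?S t (s + t) - ?S t s - ?S t t) - ?S s s - ?S t t \<in> ?R"
    using assms st by (intro relations_diff add0 add1 alt)
  then show ?thesis by (simp add: algebra_simps)
qed

text \<open>
  Each step of the new basis vector past a smaller one is a transposition and contributes a sign.
\<close>

lemma insort_relation:
  assumes "sorted xs" "distinct xs" "set xs \<subseteq> N" "i \<in> N" "i \<notin> set xs" "u \<in> H q"
  shows "Poly_Mapping.single (map e (i # xs), u) c
     - Poly_Mapping.single (map e (insort i xs), u) (c * esign i (set xs)) \<in> relations H (Suc (length xs)) q"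
  using assms
proof (induction xs arbitrary: c)
  case Nil
  then show ?case by (simp add: esign_def relations.zero)
next
  case (Cons x xs)
  show ?case
  proof (cases "i < x")
    case True
    then have "{j \<in> set (x # xs). j < i} = {}" using Cons.prems by auto
    then have "esign i (set (x # xs)) = (1 :: complex)" by (simp only: esign_def) simp
    then show ?thesis using True by (simp add: relations.zero)
  next
    case False
    then have "x < i" using Cons.prems by auto
    have esign: "esign i (set (x # xs)) = (- esign i (set xs) :: complex)"
      using Cons.prems \<open>x < i\<close> by (simp add: esign_insert)
    let ?R = "relations H (Suc (length (x # xs))) q"
    have 1: "Poly_Mapping.single (map e (i # x # xs), u) c + Poly_Mapping.single (map e (x # i # xs), u) c \<in> ?R"
      using swap_relation[of "e i" "e x" "map e xs" u "length xs" q c] Cons.prems e_in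
      by (auto simp: symbols_def)
    have 2: "cons_chain (e x) (Poly_Mapping.single (map e (i # xs), u) c
       - Poly_Mapping.single (map e (insort i xs), u) (c * esign i (set xs))) \<in> ?R"
      using cons_chain_relations[OF Cons.IH] Cons.prems e_in by simp
    from relations_diff[OF 1 2] show ?thesis
      using \<open>x < i\<close> esign by (simp add: cons_chain_diff single_uminus algebra_simps)
  qed
qed

definition basis_list :: "nat set \<Rightarrow> sec list" where
  "basis_list I = map e (sorted_list_of_set I)"

lemma basis_list_symbol: "I \<subseteq> N \<Longrightarrow> u \<in> H q \<Longrightarrow> (basis_list I, u) \<in> symbols H (card I) q"
  using finite_subset[OF _ finite_N, of I] e_in by (auto simp: basis_list_def symbols_def)

lemma basis_insert_relation:
  assumes "I \<subseteq> N" "i \<in> N" "u \<in> H q"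
  shows "Poly_Mapping.single (e i # basis_list I, u) c
    - (if i \<in> I then 0 else Poly_Mapping.single (basis_list (insert i I), u) (c * esign i I)) \<in> relations H (Suc (card I)) q"
proof -
  have fin: "finite I" using assms finite_N finite_subset by auto
  show ?thesis
  proof (cases "i \<in> I")
    case True
    then have "e i \<in> set (basis_list I)" using fin by (simp add: basis_list_def)
    then obtain k where "k < length (basis_list I)" "basis_list I ! k = e i" by (auto simp: in_set_conv_nth)
    moreover have "(e i # basis_list I, u) \<in> symbols H (Suc (card I)) q"
      using basis_list_symbol[OF assms(1,3)] e_in[OF assms(2)] by (auto simp: symbols_def)
    ultimately have "Poly_Mapping.single (e i # basis_list I, u) c \<in> relations H (Suc (card I)) q"
      using relations.alternating[of "e i # basis_list I" u H "Suc (card I)" q 0 "Suc k" c]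
      by (simp add: symbols_def)
    then show ?thesis using True by simp
  next
    case False
    then show ?thesis
      using insort_relation[of "sorted_list_of_set I" i u q c] assms fin
      by (simp add: basis_list_def sorted_list_of_set_insert)
  qed
qed

lemma expand_first_slot:
  assumes s: "s \<in> H 1" and ss: "(ss, u) \<in> symbols H m q"
  shows "Poly_Mapping.single (s # ss, u) c - (\<Sum>i\<in>N. Poly_Mapping.single (e i # ss, u) (c * \<kappa> i s)) \<in> relations H (Suc m) q"
proof -
  have sym: "(t # ss, u) \<in> symbols H (Suc m) q" if "t \<in> H 1" for t
    using that ss by (auto simp: symbols_def)
  have scale: "Poly_Mapping.single (sec_scale z t # ss, u) c - Poly_Mapping.single (t # ss, u) (c * z) \<in> relations H (Suc m) q"
    if "t \<in> H 1" for t z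
    using relations.slot_scale[OF sym[OF that], of 0 t z c] that by simp
  have "Poly_Mapping.single ((\<Sum>i\<in>A. sec_scale (\<kappa> i s) (e i)) # ss, u) c
      - (\<Sum>i\<in>A. Poly_Mapping.single (e i # ss, u) (c * \<kappa> i s)) \<in> relations H (Suc m) q"
    if "finite A" "A \<subseteq> N" for A
    using that
  proof (induction A rule: finite_induct)
    case empty
    from scale[OF s, of 0] show ?case by simp
  next
    case (insert i A)
    let ?t = "\<Sum>i\<in>A. sec_scale (\<kappa> i s) (e i)" and ?t' = "sec_scale (\<kappa> i s) (e i)"
    have t: "?t \<in> H 1" "?t' \<in> H 1" "e i \<in> H 1" using insert.prems by (auto intro!: H_sum H_scale e_in simp del: One_nat_def)
    have 1: "Poly_Mapping.single ((?t' + ?t) # ss, u) c - Poly_Mapping.single (?t' # ss, u) c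
        - Poly_Mapping.single (?t # ss, u) c \<in> relations H (Suc m) q"
      using relations.slot_add[OF sym[OF t(1)], of 0 ?t' ?t c] t by simp
    have 2: "Poly_Mapping.single (?t # ss, u) c
      - (\<Sum>i\<in>A. Poly_Mapping.single (e i # ss, u) (c * \<kappa> i s)) \<in> relations H (Suc m) q"
      using insert by simp
    from relations.add[OF relations.add[OF 1 2] scale[OF t(3), of "\<kappa> i s"]] insert.hyps
    show ?case by (simp add: algebra_simps)
  qed
  from this[OF finite_N subset_refl] show ?thesis by (simp flip: expansion[OF s])
qed

text \<open>
  By induction on the symbol: normalize the tail, expand the first slot in the basis, and sort the
  new basis vector into its place. A set \<open>K\<close> then arises once for each of its elements \<open>i\<close>, from
  \<open>K - {i}\<close>, and this is the expansion of \<open>wedge_coeff\<close>.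
\<close>

lemma symbol_normal_form:
  assumes "(ss, u) \<in> symbols H m q"
  shows "Poly_Mapping.single (ss, u) c
    - (\<Sum>I | I \<subseteq> N \<and> card I = m. Poly_Mapping.single (basis_list I, u) (c * wedge_coeff \<kappa> ss I)) \<in> relations H m q"
  using assms
proof (induction ss arbitrary: m)
  case Nil
  then have "m = 0" "{I. I \<subseteq> N \<and> card I = m} = {{}}"
    using finite_subset[OF _ finite_N] by (auto simp: symbols_def)
  then show ?case by (simp add: basis_list_def relations.zero)
next
  case (Cons s ss)
  then obtain m' where m: "m = Suc m'" and ss: "(ss, u) \<in> symbols H m' q" and s: "s \<in> H 1" and u: "u \<in> H q"
    by (auto simp: symbols_def)
  define \<I> where "\<I> m = {I. I \<subseteq> N \<and> card I = m}" for m
  have fin: "finite (\<I> m)" "I \<in> \<I> m \<Longrightarrow> finite I" for I m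
    using finite_N finite_subset by (auto simp: \<I>_def)
  let ?B = "\<lambda>I. Poly_Mapping.single (basis_list I, u)"
  let ?w = "wedge_coeff \<kappa> ss"
  have 1: "Poly_Mapping.single (s # ss, u) c
      - (\<Sum>I\<in>\<I> m'. Poly_Mapping.single (s # basis_list I, u) (c * ?w I)) \<in> relations H m q"
    using cons_chain_relations[OF Cons.IH[OF ss] s] by (simp add: cons_chain_diff cons_chain_sum m \<I>_def)
  have 2: "(\<Sum>I\<in>\<I> m'. Poly_Mapping.single (s # basis_list I, u) (c * ?w I))
     - (\<Sum>I\<in>\<I> m'. \<Sum>i\<in>N. Poly_Mapping.single (e i # basis_list I, u) (c * ?w I * \<kappa> i s)) \<in> relations H m q"
    unfolding sum_subtractf[symmetric]
  proof (rule relations_sum)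
    fix I assume "I \<in> \<I> m'"
    then have "(basis_list I, u) \<in> symbols H m' q"
      using basis_list_symbol[OF _ u, of I] by (auto simp: \<I>_def)
    from expand_first_slot[OF s this]
    show "Poly_Mapping.single (s # basis_list I, u) (c * ?w I)
     - (\<Sum>i\<in>N. Poly_Mapping.single (e i # basis_list I, u) (c * ?w I * \<kappa> i s)) \<in> relations H m q"
      unfolding m .
  qed
  have 3: "(\<Sum>I\<in>\<I> m'. \<Sum>i\<in>N. Poly_Mapping.single (e i # basis_list I, u) (c * ?w I * \<kappa> i s))
     - (\<Sum>I\<in>\<I> m'. \<Sum>i\<in>N. if i \<in> I then 0 else ?B (insert i I) (c * ?w I * \<kappa> i s * esign i I)) \<in> relations H m q"
    unfolding sum_subtractf[symmetric]
  proof (intro relations_sum)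
    fix I i assume "I \<in> \<I> m'" "i \<in> N"
    then show "Poly_Mapping.single (e i # basis_list I, u) (c * ?w I * \<kappa> i s)
     - (if i \<in> I then 0 else ?B (insert i I) (c * ?w I * \<kappa> i s * esign i I)) \<in> relations H m q"
      using basis_insert_relation[OF _ _ u, of I i "c * ?w I * \<kappa> i s"] by (simp add: \<I>_def m)
  qed
  have 4: "(\<Sum>I\<in>\<I> m'. \<Sum>i\<in>N. if i \<in> I then 0 else ?B (insert i I) (c * ?w I * \<kappa> i s * esign i I)) =
      (\<Sum>K\<in>\<I> m. ?B K (c * wedge_coeff \<kappa> (s # ss) K))"
  proof -
    have "(\<Sum>I\<in>\<I> m'. \<Sum>i\<in>N. if i \<in> I then 0 else ?B (insert i I) (c * ?w I * \<kappa> i s * esign i I)) =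
       (\<Sum>I\<in>\<I> m'. \<Sum>i\<in>N - I. ?B (insert i I) (c * ?w I * \<kappa> i s * esign i I))"
      using finite_N by (intro sum.cong sum.mono_neutral_cong_right refl) auto
    also have "\<dots> = (\<Sum>(I, i)\<in>Sigma (\<I> m') (\<lambda>I. N - I). ?B (insert i I) (c * ?w I * \<kappa> i s * esign i I))"
      using fin finite_N by (subst sum.Sigma) auto
    also have "\<dots> = (\<Sum>(K, i)\<in>Sigma (\<I> m) (\<lambda>K. K). ?B K (c * ?w (K - {i}) * \<kappa> i s * esign i K))"
    proof (rule sum.reindex_bij_witness[of _ "\<lambda>(K, i). (K - {i}, i)" "\<lambda>(I, i). (insert i I, i)"])
      fix a assume a: "a \<in> Sigma (\<I> m) (\<lambda>K. K)"
      then obtain K i where [simp]: "a = (K, i)" and K: "K \<subseteq> N" "card K = Suc m'" "i \<in> K"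
        by (auto simp: \<I>_def m)
      then have "finite K" using finite_N finite_subset by auto
      then show "(case a of (K, i) \<Rightarrow> (K - {i}, i)) \<in> Sigma (\<I> m') (\<lambda>I. N - I)"
        using K by (auto simp: \<I>_def)
      show "(case case a of (K, i) \<Rightarrow> (K - {i}, i) of (I, i) \<Rightarrow> (insert i I, i)) = a"
        using K by (simp add: insert_absorb)
    next
      fix b assume b: "b \<in> Sigma (\<I> m') (\<lambda>I. N - I)"
      then obtain I i where [simp]: "b = (I, i)" and I: "I \<subseteq> N" "card I = m'" "i \<in> N" "i \<notin> I"
        by (auto simp: \<I>_def)
      then have "finite I" using finite_N finite_subset by auto
      then show "(case b of (I, i) \<Rightarrow> (insert i I, i)) \<in> Sigma (\<I> m) (\<lambda>K. K)"
        using I by (auto simp: \<I>_def m)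
      show "(case case b of (I, i) \<Rightarrow> (insert i I, i) of (K, i) \<Rightarrow> (K - {i}, i)) = b"
        using I by simp
      show "(case case b of (I, i) \<Rightarrow> (insert i I, i) of (K, i) \<Rightarrow> ?B K (c * ?w (K - {i}) * \<kappa> i s * esign i K)) =
         (case b of (I, i) \<Rightarrow> ?B (insert i I) (c * ?w I * \<kappa> i s * esign i I))"
        using I by simp
    qed
    also have "\<dots> = (\<Sum>K\<in>\<I> m. \<Sum>i\<in>K. ?B K (c * ?w (K - {i}) * \<kappa> i s * esign i K))"
      using fin by (subst sum.Sigma) auto
    also have "\<dots> = (\<Sum>K\<in>\<I> m. ?B K (c * wedge_coeff \<kappa> (s # ss) K))"
      by (simp add: wedge_def sum_distrib_left single_sum mult_ac)
    finally show ?thesis .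
  qed
  from relations_trans[OF 1 relations_trans[OF 2 3]] show ?case
    unfolding 4 by (simp only: \<I>_def)
qed

text \<open>
  Chains with the same exterior part are merged by means of linearity in the last factor.
\<close>

lemma collect_coefficients:
  assumes "ss \<in> lists (H 1)" "length ss = m" "finite A" "\<And>k. k \<in> A \<Longrightarrow> f k \<in> H q"
  shows "(\<Sum>k\<in>A. Poly_Mapping.single (ss, f k) (z k)) - Poly_Mapping.single (ss, \<Sum>k\<in>A. sec_scale (z k) (f k)) 1 \<in> relations H m q"
  using assms(3,4)
proof (induction A rule: finite_induct)
  case empty
  have "(ss, 0) \<in> symbols H m q" using assms(1,2) H_0 by (auto simp: symbols_def)
  from relations_uminus[OF relations.coeff_scale[OF this, of 0 1]] show ?case by simp
next
  case (insert k A)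
  let ?t = "\<Sum>k\<in>A. sec_scale (z k) (f k)" and ?t' = "sec_scale (z k) (f k)"
  have sym: "(ss, v) \<in> symbols H m q" if "v \<in> H q" for v using assms(1,2) that by (auto simp: symbols_def)
  have t: "?t \<in> H q" "?t' \<in> H q" "f k \<in> H q" using insert.prems by (auto intro!: H_sum H_scale)
  have 1: "Poly_Mapping.single (ss, ?t' + ?t) 1 - Poly_Mapping.single (ss, ?t') 1 - Poly_Mapping.single (ss, ?t) 1
      \<in> relations H m q"
    by (rule relations.coeff_add) (use t sym in auto)
  have 2: "Poly_Mapping.single (ss, ?t') 1 - Poly_Mapping.single (ss, f k) (1 * z k) \<in> relations H m q"
    by (rule relations.coeff_scale) (use t sym in auto)
  have 3: "(\<Sum>k\<in>A. Poly_Mapping.single (ss, f k) (z k)) - Poly_Mapping.single (ss, ?t) 1 \<in> relations H m q"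
    using insert by simp
  from relations_diff[OF relations_diff[OF 3 1] 2] show ?case
    using insert.hyps by (simp add: algebra_simps)
qed

text \<open>
  Together with \<open>chain_coeff_relations\<close> this identifies \<open>\<Lambda>\<^sup>m H\<^sup>0(L) \<otimes> H\<^sup>0(L\<^sup>q)\<close>, defined by generators
  and relations, with the families of elements of \<open>H q\<close> indexed by the \<open>m\<close>-element subsets of \<open>N\<close>.
\<close>

theorem chain_normal_form:
  assumes x: "x \<in> chains H m q"
  shows "x - (\<Sum>I | I \<subseteq> N \<and> card I = m. Poly_Mapping.single (basis_list I, chain_coeff \<kappa> x I) 1) \<in> relations H m q"
proof -
  define \<I> where "\<I> = {I. I \<subseteq> N \<and> card I = m}"
  let ?K = "Poly_Mapping.keys x"
  let ?l = "Poly_Mapping.lookup x"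
  have 1: "(\<Sum>k\<in>?K. Poly_Mapping.single k (?l k))
     - (\<Sum>k\<in>?K. \<Sum>I\<in>\<I>. Poly_Mapping.single (basis_list I, snd k) (?l k * wedge_coeff \<kappa> (fst k) I)) \<in> relations H m q"
    unfolding sum_subtractf[symmetric]
  proof (rule relations_sum)
    fix k assume "k \<in> ?K"
    then have "(fst k, snd k) \<in> symbols H m q" using x by (auto simp: chains_def)
    from symbol_normal_form[OF this, of "?l k"]
    show "Poly_Mapping.single k (?l k)
     - (\<Sum>I\<in>\<I>. Poly_Mapping.single (basis_list I, snd k) (?l k * wedge_coeff \<kappa> (fst k) I)) \<in> relations H m q"
      by (simp add: \<I>_def)
  qed
  have 2: "(\<Sum>I\<in>\<I>. \<Sum>k\<in>?K. Poly_Mapping.single (basis_list I, snd k) (?l k * wedge_coeff \<kappa> (fst k) I))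
    - (\<Sum>I\<in>\<I>. Poly_Mapping.single (basis_list I, chain_coeff \<kappa> x I) 1) \<in> relations H m q"
    unfolding sum_subtractf[symmetric]
  proof (rule relations_sum)
    fix I assume "I \<in> \<I>"
    then have "basis_list I \<in> lists (H 1)" "length (basis_list I) = m"
      using basis_list_symbol[OF _ H_0, of I] by (auto simp: \<I>_def symbols_def)
    then show "(\<Sum>k\<in>?K. Poly_Mapping.single (basis_list I, snd k) (?l k * wedge_coeff \<kappa> (fst k) I))
      - Poly_Mapping.single (basis_list I, chain_coeff \<kappa> x I) 1 \<in> relations H m q"
      unfolding chain_coeff_def lin_ext_def
      using x by (intro collect_coefficients) (auto simp: chains_def symbols_def)
  qed
  from relations_trans[OF 1[unfolded sum_singles] 2[unfolded sum.swap[of _ ?K \<I>]]] show ?thesis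
    by (simp add: \<I>_def)
qed

corollary relations_if_coeff_zero:
  assumes x: "x \<in> chains H m q" and "\<And>I. I \<subseteq> N \<Longrightarrow> card I = m \<Longrightarrow> chain_coeff \<kappa> x I = 0"
  shows "x \<in> relations H m q"
proof -
  have "Poly_Mapping.single (basis_list I, chain_coeff \<kappa> x I) 1 \<in> relations H m q" if I: "I \<subseteq> N" "card I = m" for I
  proof -
    have "(basis_list I, 0) \<in> symbols H m q" using basis_list_symbol[OF I(1) H_0] I(2) by simp
    from relations.coeff_scale[OF this, of 0 1] assms(2)[OF I] show ?thesis by simp
  qed
  then have "(\<Sum>I | I \<subseteq> N \<and> card I = m. Poly_Mapping.single (basis_list I, chain_coeff \<kappa> x I) 1) \<in> relations H m q"
    by (intro relations_sum) auto
  from relations.add[OF chain_normal_form[OF x] this] show ?thesis by simp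
qed

lemma wedge_coeff_map_e:
  assumes "sorted xs" "distinct xs" "set xs \<subseteq> N" "I \<subseteq> N"
  shows "wedge_coeff \<kappa> (map e xs) I = (if I = set xs then 1 else 0)"
  using assms
proof (induction xs arbitrary: I)
  case (Cons x xs)
  have fin: "finite I" using Cons.prems finite_N finite_subset by auto
  have "wedge_coeff \<kappa> (map e (x # xs)) I = (\<Sum>i\<in>I. if i = x then (if I = set (x # xs) then 1 else 0) else 0)"
    unfolding list.map wedge_coeff.simps wedge_def
  proof (rule sum.cong[OF refl])
    fix i assume i: "i \<in> I"
    have wc: "wedge_coeff \<kappa> (map e xs) (I - {i}) = (if I - {i} = set xs then 1 else 0)"
      using Cons.prems by (intro Cons.IH) auto
    have \<kappa>: "\<kappa> i (e x) = (if i = x then 1 else 0)" using Cons.prems i by (intro \<kappa>_e) auto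
    have "I - {x} = set xs \<longleftrightarrow> I = set (x # xs)" if "x \<in> I" using that Cons.prems(2) by auto
    moreover have "esign x (set (x # xs)) = (1 :: complex)"
    proof -
      have "{j \<in> set (x # xs). j < x} = {}" using Cons.prems(1) by auto
      then show ?thesis by (simp only: esign_def) simp
    qed
    ultimately show "esign i I * \<kappa> i (e x) * wedge_coeff \<kappa> (map e xs) (I - {i}) =
        (if i = x then (if I = set (x # xs) then 1 else 0) else 0)"
      unfolding wc \<kappa> using i by auto
  qed
  then show ?case using fin by auto
qed auto

definition chain_of :: "nat \<Rightarrow> (nat set \<Rightarrow> sec) \<Rightarrow> (sec list \<times> sec \<Rightarrow>\<^sub>0 complex)" where
  "chain_of m F = (\<Sum>I | I \<subseteq> N \<and> card I = m. Poly_Mapping.single (basis_list I, F I) 1)"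

lemma chain_of_in: "(\<And>I. I \<subseteq> N \<Longrightarrow> card I = m \<Longrightarrow> F I \<in> H q) \<Longrightarrow> chain_of m F \<in> chains H m q"
  unfolding chain_of_def
proof (intro chains_sum chains_single)
  fix I assume F: "\<And>I. I \<subseteq> N \<Longrightarrow> card I = m \<Longrightarrow> F I \<in> H q" and "I \<in> {I. I \<subseteq> N \<and> card I = m}"
  then have I: "I \<subseteq> N" "card I = m" by simp_all
  show "(basis_list I, F I) \<in> symbols H m q" using basis_list_symbol[OF I(1) F[OF I]] I(2) by simp
qed

lemma chain_coeff_chain_of:
  assumes I: "I \<subseteq> N" "card I = m"
  shows "chain_coeff \<kappa> (chain_of m F) I = F I"
proof -
  have "chain_coeff \<kappa> (chain_of m F) I = (\<Sum>J | J \<subseteq> N \<and> card J = m. if J = I then F I else 0)"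
    unfolding chain_of_def chain_coeff_sum
  proof (rule sum.cong[OF refl])
    fix J assume "J \<in> {J. J \<subseteq> N \<and> card J = m}"
    then have J: "J \<subseteq> N" "finite J" using finite_N finite_subset by auto
    have "wedge_coeff \<kappa> (basis_list J) I = (if I = J then 1 else 0)"
      unfolding basis_list_def using wedge_coeff_map_e[of "sorted_list_of_set J" I] J I by simp
    then show "chain_coeff \<kappa> (Poly_Mapping.single (basis_list J, F J) 1) I = (if J = I then F I else 0)"
      by simp
  qed
  also have "\<dots> = F I" using I finite_N by simp
  finally show ?thesis .
qed

text \<open>
  The Koszul differential in coordinates, up to sign. It acts on the two components separately.
\<close>

definition differential :: "(nat set \<Rightarrow> sec) \<Rightarrow> nat set \<Rightarrow> sec" where
  "differential F I = (contract N (\<lambda>i. fst (e i)) (\<lambda>J. fst (F J)) I, contract N (\<lambda>i. snd (e i)) (\<lambda>J. snd (F J)) I)"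

text \<open>
  The antiderivation rule, applied to one factor after another. The map \<open>comp\<close> stands for the
  projection to either component of the curve.
\<close>

lemma contract_wedge_coeff:
  fixes comp :: "sec \<Rightarrow> complex poly"
  assumes comp: "\<And>s t. comp (s + t) = comp s + comp t" "\<And>c s. comp (sec_scale c s) = smult c (comp s)"
    and ss: "set ss \<subseteq> H 1" and I: "I \<subseteq> N"
  shows "contract N (\<lambda>i. comp (e i)) (\<lambda>J. [:wedge_coeff \<kappa> ss J:]) I =
    (\<Sum>l<length ss. (- 1) ^ l * comp (ss ! l) * [:wedge_coeff \<kappa> (take l ss @ drop (Suc l) ss) I:])"
  using ss I
proof (induction ss arbitrary: I)
  case Nil
  then show ?case by (simp add: contract_def)
next
  case (Cons s ss)
  have comp0: "comp 0 = 0" using comp(1)[of 0 0] by simp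
  have comp_sum: "comp (sum f A) = (\<Sum>x\<in>A. comp (f x))" for f :: "nat \<Rightarrow> sec" and A
    by (induction A rule: infinite_finite_induct) (auto simp: comp comp0)
  have pw: "[:wedge u F I:] = wedge (\<lambda>i. [:u i:]) (\<lambda>J. [:F J:]) I" for u :: "nat \<Rightarrow> complex" and F and I :: "nat set"
  proof -
    have "[:sum f A:] = (\<Sum>x\<in>A. [:f x:])" for f :: "nat \<Rightarrow> complex" and A
      by (rule poly_eqI) (simp add: coeff_sum coeff_pCons split: nat.splits)
    note const_sum = this
    have "wedge (\<lambda>i. [:u i:]) (\<lambda>J. [:F J:]) I = (\<Sum>i\<in>I. [:esign i I * u i * F (I - {i}):])"
      unfolding wedge_def by (intro sum.cong refl) (simp add: esign_poly)
    then show ?thesis by (simp only: wedge_def const_sum)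
  qed
  have fin: "finite I" using Cons.prems finite_N finite_subset by auto
  have s: "(\<Sum>i\<in>N. comp (e i) * [:\<kappa> i s:]) = comp s"
  proof -
    have "comp s = comp (\<Sum>i\<in>N. sec_scale (\<kappa> i s) (e i))"
      using expansion[of s] Cons.prems by simp
    then show ?thesis by (simp add: comp_sum comp)
  qed
  have "contract N (\<lambda>i. comp (e i)) (\<lambda>J. [:wedge_coeff \<kappa> (s # ss) J:]) I =
    contract N (\<lambda>i. comp (e i)) (wedge (\<lambda>i. [:\<kappa> i s:]) (\<lambda>J. [:wedge_coeff \<kappa> ss J:])) I"
    by (simp add: pw)
  also have "\<dots> = comp s * [:wedge_coeff \<kappa> ss I:]
     - wedge (\<lambda>i. [:\<kappa> i s:]) (contract N (\<lambda>i. comp (e i)) (\<lambda>J. [:wedge_coeff \<kappa> ss J:])) I"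
    unfolding contract_wedge[OF finite_N Cons.prems(2)] s ..
  also have "wedge (\<lambda>i. [:\<kappa> i s:]) (contract N (\<lambda>i. comp (e i)) (\<lambda>J. [:wedge_coeff \<kappa> ss J:])) I =
    wedge (\<lambda>i. [:\<kappa> i s:]) (\<lambda>I. \<Sum>l<length ss. (- 1) ^ l * comp (ss ! l) *
      [:wedge_coeff \<kappa> (take l ss @ drop (Suc l) ss) I:]) I"
    using Cons.prems by (intro wedge_cong Cons.IH) auto
  also have "\<dots> = (\<Sum>l<length ss. (- 1) ^ l * comp (ss ! l) *
      wedge (\<lambda>i. [:\<kappa> i s:]) (\<lambda>I. [:wedge_coeff \<kappa> (take l ss @ drop (Suc l) ss) I:]) I)"
    unfolding wedge_mult_right[symmetric] unfolding wedge_def sum_distrib_left by (rule sum.swap)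
  finally show ?case
    unfolding length_Cons sum.lessThan_Suc_shift
    by (simp add: pw sum_negf[symmetric])
qed

lemma comp_chain_coeff_koszul_d:
  fixes comp :: "sec \<Rightarrow> complex poly"
  assumes comp: "\<And>s t. comp (s + t) = comp s + comp t" "\<And>c s. comp (sec_scale c s) = smult c (comp s)"
      "\<And>s t. comp (sec_mult s t) = comp s * comp t"
    and x: "x \<in> chains H m q" and I: "I \<subseteq> N"
  shows "comp (chain_coeff \<kappa> (koszul_d x) I) = - contract N (\<lambda>i. comp (e i)) (\<lambda>J. comp (chain_coeff \<kappa> x J)) I"
proof -
  have comp0: "comp 0 = 0" using comp(1)[of 0 0] by simp
  have comp_sum: "comp (sum f A) = (\<Sum>x\<in>A. comp (f x))" for f :: "'x \<Rightarrow> sec" and A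
    by (induction A rule: infinite_finite_induct) (auto simp: comp comp0)
  have single: "comp (chain_coeff \<kappa> (koszul_d (Poly_Mapping.single (ss, u) c)) I) =
     - contract N (\<lambda>i. comp (e i)) (\<lambda>J. comp (chain_coeff \<kappa> (Poly_Mapping.single (ss, u) c) J)) I"
    if ss: "set ss \<subseteq> H 1" for ss u c
  proof -
    have "comp (chain_coeff \<kappa> (koszul_d (Poly_Mapping.single (ss, u) c)) I) =
      - (smult c (comp u) * (\<Sum>l<length ss. (- 1) ^ l * comp (ss ! l) * [:wedge_coeff \<kappa> (take l ss @ drop (Suc l) ss) I:]))"
    proof -
      have "(- 1 :: complex poly) ^ l = [:(- 1) ^ l:]" for l
        by (induction l) (auto simp: one_pCons)
      moreover have "comp (- s) = - comp s" for s using comp(2)[of "- 1" s] by simp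
      ultimately show ?thesis
        by (simp add: koszul_d_single chain_coeff_sum comp_sum comp comp0 sum_distrib_left sum_negf[symmetric] mult_ac)
    qed
    also have "\<dots> = - contract N (\<lambda>i. comp (e i)) (\<lambda>J. smult c (comp u) * [:wedge_coeff \<kappa> ss J:]) I"
      by (simp only: contract_mult contract_wedge_coeff[OF comp(1,2) ss I])
    also have "(\<lambda>J. smult c (comp u) * [:wedge_coeff \<kappa> ss J:]) = (\<lambda>J. comp (chain_coeff \<kappa> (Poly_Mapping.single (ss, u) c) J))"
      by (simp add: comp mult_ac)
    finally show ?thesis .
  qed
  let ?K = "Poly_Mapping.keys x"
  let ?g = "\<lambda>k. Poly_Mapping.single k (Poly_Mapping.lookup x k)"
  have "comp (chain_coeff \<kappa> (koszul_d (\<Sum>k\<in>?K. ?g k)) I) = (\<Sum>k\<in>?K. comp (chain_coeff \<kappa> (koszul_d (?g k)) I))"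
    by (simp add: koszul_d_sum chain_coeff_sum comp_sum)
  also have "\<dots> = (\<Sum>k\<in>?K. - contract N (\<lambda>i. comp (e i)) (\<lambda>J. comp (chain_coeff \<kappa> (?g k) J)) I)"
  proof (rule sum.cong[OF refl])
    fix k assume "k \<in> ?K"
    then have "k \<in> symbols H m q" using x by (auto simp: chains_def)
    then have "set (fst k) \<subseteq> H 1" by (simp add: symbols_def case_prod_unfold)
    from single[OF this, of "snd k" "Poly_Mapping.lookup x k"]
    show "comp (chain_coeff \<kappa> (koszul_d (?g k)) I) = - contract N (\<lambda>i. comp (e i)) (\<lambda>J. comp (chain_coeff \<kappa> (?g k) J)) I"
      by simp
  qed
  also have "\<dots> = - contract N (\<lambda>i. comp (e i)) (\<lambda>J. comp (chain_coeff \<kappa> (\<Sum>k\<in>?K. ?g k) J)) I"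
    by (simp add: chain_coeff_sum comp_sum contract_sum sum_negf)
  finally show ?thesis by (simp only: sum_singles)
qed

lemma chain_coeff_koszul_d:
  assumes "x \<in> chains H m q" "I \<subseteq> N"
  shows "chain_coeff \<kappa> (koszul_d x) I = - differential (chain_coeff \<kappa> x) I"
  using comp_chain_coeff_koszul_d[of fst, OF _ _ _ assms] comp_chain_coeff_koszul_d[of snd, OF _ _ _ assms]
  by (intro prod_eqI) (simp_all add: differential_def)

lemma differential_uminus: "differential (\<lambda>J. - F J) I = - differential F I"
  by (rule prod_eqI) (simp_all add: differential_def contract_def sum_negf)

lemma differential_cong:
  assumes "I \<subseteq> N" "\<And>J. J \<subseteq> N \<Longrightarrow> card J = Suc (card I) \<Longrightarrow> F J = G J"
  shows "differential F I = differential G I"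
  unfolding differential_def using assms finite_N
  by (intro arg_cong2[of _ _ _ _ Pair] contract_cong) auto

lemma H_uminus: "s \<in> H q \<Longrightarrow> - s \<in> H q"
  using H_scale[of s q "- 1"] by simp

text \<open>
  Koszul cohomology can be computed in coordinates. For \<open>p = 0\<close> the condition on \<open>F\<close> is empty, in
  accordance with the vanishing of the differential on symbols without exterior part.
\<close>

theorem koszul_vanishes_iff:
  "koszul_vanishes H p (Suc q) \<longleftrightarrow>
     (\<forall>F. (\<forall>I\<subseteq>N. card I = p \<longrightarrow> F I \<in> H (Suc q)) \<and> (\<forall>I\<subseteq>N. Suc (card I) = p \<longrightarrow> differential F I = 0) \<longrightarrow>
       (\<exists>G. (\<forall>J\<subseteq>N. card J = Suc p \<longrightarrow> G J \<in> H q) \<and> (\<forall>I\<subseteq>N. card I = p \<longrightarrow> differential G I = F I)))"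
    (is "_ \<longleftrightarrow> ?model")
proof
  assume van: "koszul_vanishes H p (Suc q)"
  show ?model
  proof (intro allI impI, elim conjE)
    fix F assume F: "\<forall>I\<subseteq>N. card I = p \<longrightarrow> F I \<in> H (Suc q)" "\<forall>I\<subseteq>N. Suc (card I) = p \<longrightarrow> differential F I = 0"
    define x where "x = chain_of p F"
    have x: "x \<in> chains H p (Suc q)" unfolding x_def using F by (intro chain_of_in) auto
    have "koszul_d x \<in> relations H (p - 1) (Suc q + 1)"
    proof (cases p)
      case 0
      then have "koszul_d x = 0"
        using x unfolding koszul_d_def by (intro sum.neutral) (auto simp: chains_def symbols_def)
      then show ?thesis by (simp add: relations.zero)
    next
      case (Suc p')
      have "koszul_d x \<in> relations H p' (Suc (Suc q))"
      proof (rule relations_if_coeff_zero)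
        show "koszul_d x \<in> chains H p' (Suc (Suc q))" using koszul_d_in x Suc by simp
        fix I assume I: "I \<subseteq> N" "card I = p'"
        have "differential (chain_coeff \<kappa> x) I = differential F I"
          using I Suc by (intro differential_cong) (auto simp: x_def chain_coeff_chain_of)
        then show "chain_coeff \<kappa> (koszul_d x) I = 0"
          using chain_coeff_koszul_d[OF x I(1)] F(2) I Suc by simp
      qed
      then show ?thesis by (simp add: Suc)
    qed
    then obtain y where y: "y \<in> chains H (Suc p) q" "x - koszul_d y \<in> relations H p (Suc q)"
      using van x unfolding koszul_vanishes_def by auto
    have "differential (\<lambda>J. - chain_coeff \<kappa> y J) I = F I" if I: "I \<subseteq> N" "card I = p" for I
    proof -
      have "chain_coeff \<kappa> (x - koszul_d y) I = 0"
        using chain_coeff_relations[of \<kappa>, OF \<kappa>_add \<kappa>_scale y(2)] finite_subset[OF I(1) finite_N] by simp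
      then show ?thesis
        using I by (simp add: chain_coeff_diff chain_coeff_koszul_d[OF y(1)] differential_uminus x_def
            chain_coeff_chain_of add_eq_0_iff)
    qed
    then show "\<exists>G. (\<forall>J\<subseteq>N. card J = Suc p \<longrightarrow> G J \<in> H q) \<and> (\<forall>I\<subseteq>N. card I = p \<longrightarrow> differential G I = F I)"
      using chain_coeff_in[OF y(1)] H_uminus by (intro exI[of _ "\<lambda>J. - chain_coeff \<kappa> y J"]) simp
  qed
next
  assume model: ?model
  show "koszul_vanishes H p (Suc q)"
    unfolding koszul_vanishes_def
  proof (intro ballI impI)
    fix x assume x: "x \<in> chains H p (Suc q)" "koszul_d x \<in> relations H (p - 1) (Suc q + 1)"
    have "differential (chain_coeff \<kappa> x) I = 0" if I: "I \<subseteq> N" for I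
    proof -
      have "chain_coeff \<kappa> (koszul_d x) I = 0"
        using chain_coeff_relations[of \<kappa>, OF \<kappa>_add \<kappa>_scale x(2)] finite_subset[OF I finite_N] by simp
      then show ?thesis using chain_coeff_koszul_d[OF x(1) I] by simp
    qed
    then obtain G where G: "\<And>J. J \<subseteq> N \<Longrightarrow> card J = Suc p \<Longrightarrow> G J \<in> H q"
      "\<And>I. I \<subseteq> N \<Longrightarrow> card I = p \<Longrightarrow> differential G I = chain_coeff \<kappa> x I"
      using model[rule_format, of "chain_coeff \<kappa> x"] chain_coeff_in[OF x(1)] by auto
    define y where "y = chain_of (Suc p) (\<lambda>J. - G J)"
    have y: "y \<in> chains H (Suc p) q" unfolding y_def using G(1) H_uminus by (intro chain_of_in) auto
    have "x - koszul_d y \<in> relations H p (Suc q)"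
    proof (rule relations_if_coeff_zero)
      show "x - koszul_d y \<in> chains H p (Suc q)" using x(1) koszul_d_in[OF y] by (rule chains_diff)
      fix I assume I: "I \<subseteq> N" "card I = p"
      have "differential (chain_coeff \<kappa> y) I = differential (\<lambda>J. - G J) I"
        using I by (intro differential_cong) (auto simp: y_def chain_coeff_chain_of)
      then show "chain_coeff \<kappa> (x - koszul_d y) I = 0"
        using I G(2) by (simp add: chain_coeff_diff chain_coeff_koszul_d[OF y] differential_uminus)
    qed
    then show "\<exists>y\<in>chains H (p + 1) (Suc q - 1). x - koszul_d y \<in> relations H p (Suc q)"
      using y by auto
  qed
qed

end

section \<open>Vanishing of Koszul cohomology of a binary curve\<close>

text \<open>
  Contraction with \<open>(1, \<dots>, 1)\<close> involves only sums and signs.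
\<close>

lemma contract_additive:
  fixes T :: "complex poly \<Rightarrow> complex poly"
  assumes T: "\<And>f h. T (f + h) = T f + T h"
  shows "contract N (\<lambda>_. 1) (\<lambda>J. T (G J)) I = T (contract N (\<lambda>_. 1) G I)"
proof -
  have T0: "T 0 = 0" using T[of 0 0] by simp
  have Tm: "T (- f) = - T f" for f using T[of "- f" f] T0 by (simp add: eq_neg_iff_add_eq_0)
  have "T (esign i I * f) = esign i I * T f" for i f
    by (cases "even (card {j \<in> I. j < i})") (auto simp: esign_def Tm)
  moreover have "T (sum f A) = (\<Sum>x\<in>A. T (f x))" for f :: "nat \<Rightarrow> complex poly" and A
    by (induction A rule: infinite_finite_induct) (auto simp: T T0)
  ultimately show ?thesis by (simp add: contract_def)
qed

lemma poly_shift_cutoff: "monom 1 n * poly_shift n f + poly_cutoff n f = (f :: complex poly)"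
  by (rule poly_eqI) (simp add: coeff_monom_mult coeff_poly_shift coeff_poly_cutoff)

lemma degree_node_poly_mult_le: "degree f \<le> n \<Longrightarrow> degree (node_poly a I * f) \<le> card I + n"
  using degree_mult_le[of "node_poly a I" f] by simp

text \<open>
  \<open>K\<^sub>p\<^sub>,\<^sub>2 = 0\<close> for the rational normal curve of degree \<open>d\<close>. A cycle is \<open>\<Prod>\<^sub>i\<^sub>\<in>\<^sub>I (y - a\<^sub>i) \<cdot> G\<^sub>I\<close> with \<open>G\<close>
  closed of degree at most \<open>2d - p\<close>. If \<open>X\<close> is such a cycle with a closed factor of degree at most
  \<open>d - p\<close>, then the differential of \<open>e\<^sub>c \<and> X\<close> is \<open>e\<^sub>c(y) X\<close>. The \<open>e\<^sub>c(y)\<close> span the polynomials of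
  degree at most \<open>d\<close>, and their products with the polynomials of degree at most \<open>d - p\<close> span
  everything of degree at most \<open>2d - p\<close>.
\<close>

theorem rational_normal_curve_exact:
  assumes N: "finite N" "inj_on a N" "card N = Suc d" and p: "p \<le> d"
    and deg: "\<And>I. I \<subseteq> N \<Longrightarrow> card I = p \<Longrightarrow> degree (F I) \<le> 2 * d"
    and closed: "\<And>I. I \<subseteq> N \<Longrightarrow> Suc (card I) = p \<Longrightarrow> contract N (\<lambda>i. node_poly a (N - {i})) F I = 0"
  shows "\<exists>H. (\<forall>J\<subseteq>N. card J = Suc p \<longrightarrow> degree (H J) \<le> d) \<and>
    (\<forall>I\<subseteq>N. card I = p \<longrightarrow> contract N (\<lambda>i. node_poly a (N - {i})) H I = F I)"
proof -
  have "\<exists>G\<in>closed_families N p (2 * d - p). \<forall>I\<subseteq>N. card I = p \<longrightarrow> F I = node_poly a I * G I"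
    by (rule closed_family_factor[OF N(1,2)]) (fact deg, fact closed)
  then obtain G where G: "G \<in> closed_families N p (2 * d - p)"
    and F: "\<forall>I\<subseteq>N. card I = p \<longrightarrow> F I = node_poly a I * G I"
    by (elim bexE)
  define n where "n = d - p"
  define w where "w c = node_poly a (N - {c})" for c
  define \<mu> where "\<mu> c = poly (w c) (a c)" for c
  \<comment> \<open>Write \<open>f = U y\<^sup>n + V\<close> with U and V of degree at most d, and expand U and V by Lagrange
    interpolation: then \<open>f = \<Sum>\<^sub>c e\<^sub>c(y) \<cdot> T c f\<close>. The operators T c are additive, so they
    preserve closed families.\<close>
  define T where "T c f = smult (poly (poly_shift n f) (a c) / \<mu> c) (monom 1 n) + [:poly (poly_cutoff n f) (a c) / \<mu> c:]" for c f
  have T_add: "T c (f + h) = T c f + T c h" for c f h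
  proof -
    have "poly_shift n (f + h) = poly_shift n f + poly_shift n h" "poly_cutoff n (f + h) = poly_cutoff n f + poly_cutoff n h"
      by (rule poly_eqI; simp add: coeff_poly_shift coeff_poly_cutoff)+
    then show ?thesis by (simp add: T_def add_divide_distrib smult_add_left del: smult_monom)
  qed
  have T_sum: "(\<Sum>c\<in>N. w c * T c f) = f" if f: "degree f \<le> 2 * d - p" for f
  proof -
    have 1: "degree (poly_shift n f) < card N"
    proof (rule le_less_trans[of _ d])
      show "degree (poly_shift n f) \<le> d"
        using f p by (intro degree_le) (auto simp: coeff_poly_shift n_def intro!: coeff_eq_0)
    qed (simp add: N(3))
    have 2: "degree (poly_cutoff n f) < card N"
    proof (rule le_less_trans[of _ d])
      show "degree (poly_cutoff n f) \<le> d"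
        using p by (intro degree_le) (auto simp: coeff_poly_cutoff n_def)
    qed (simp add: N(3))
    have "(\<Sum>c\<in>N. w c * T c f) = monom 1 n * (\<Sum>c\<in>N. smult (poly (poly_shift n f) (a c) / \<mu> c) (w c))
        + (\<Sum>c\<in>N. smult (poly (poly_cutoff n f) (a c) / \<mu> c) (w c))"
    proof -
      have "w c * T c f = monom 1 n * smult (poly (poly_shift n f) (a c) / \<mu> c) (w c)
          + smult (poly (poly_cutoff n f) (a c) / \<mu> c) (w c)" for c
        by (simp add: T_def distrib_left mult_ac del: smult_monom)
      then show ?thesis by (simp only: sum_distrib_left sum.distrib)
    qed
    also have "(\<Sum>c\<in>N. smult (poly (poly_shift n f) (a c) / \<mu> c) (w c)) = poly_shift n f"
      unfolding \<mu>_def w_def by (rule Lagrange_interpolation[OF N(1,2) 1, symmetric])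
    also have "(\<Sum>c\<in>N. smult (poly (poly_cutoff n f) (a c) / \<mu> c) (w c)) = poly_cutoff n f"
      unfolding \<mu>_def w_def by (rule Lagrange_interpolation[OF N(1,2) 2, symmetric])
    finally show ?thesis by (simp only: poly_shift_cutoff)
  qed
  define X where "X c I = node_poly a I * T c (G I)" for c I
  define H where "H J = (\<Sum>c\<in>N. wedge (\<lambda>i. if i = c then 1 else 0) (X c) J)" for J
  have "degree (H J) \<le> d" if J: "J \<subseteq> N" "card J = Suc p" for J
    unfolding H_def wedge_def
  proof (intro degree_sum_le)
    show "finite J" using finite_subset[OF J(1) N(1)] .
    fix c i assume i: "i \<in> J"
    have "degree (T c (G (J - {i}))) \<le> n"
      unfolding T_def by (intro degree_add_le) (auto intro: order.trans[OF degree_smult_le] order.trans[OF degree_monom_le] simp del: smult_monom)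
    then have "degree (X c (J - {i})) \<le> d"
      unfolding X_def using degree_node_poly_mult_le[of "T c (G (J - {i}))" n a "J - {i}"] i J \<open>finite J\<close> p
      by (simp add: n_def)
    then show "degree (esign i J * (if i = c then 1 else 0) * X c (J - {i})) \<le> d" by auto
  qed (simp add: N(1))
  moreover have "contract N w H I = F I" if I: "I \<subseteq> N" "card I = p" for I
  proof -
    have "contract N w H I = (\<Sum>c\<in>N. contract N w (wedge (\<lambda>i. if i = c then 1 else 0) (X c)) I)"
      unfolding H_def by (rule contract_sum)
    also have "\<dots> = (\<Sum>c\<in>N. w c * X c I)"
    proof (rule sum.cong[OF refl])
      fix c assume c: "c \<in> N"
      have "wedge (\<lambda>i. if i = c then 1 else 0) (contract N w (X c)) I = 0"
        unfolding wedge_def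
      proof (rule sum.neutral, rule ballI)
        fix i assume i: "i \<in> I"
        have J: "I - {i} \<subseteq> N" "Suc (card (I - {i})) = p"
          using i I N(1) finite_subset[of I N] card_Suc_Diff1[of I i] by (auto simp del: card_Diff_insert)
        have "contract N w (X c) (I - {i}) = node_poly a N * node_poly a (I - {i}) * T c (contract N (\<lambda>_. 1) G (I - {i}))"
          unfolding w_def X_def contract_node_poly[OF N(1) J(1)] by (simp only: contract_additive[of "T c", OF T_add])
        also have "contract N (\<lambda>_. 1) G (I - {i}) = 0" using G J unfolding closed_families_def by blast
        finally have "contract N w (X c) (I - {i}) = 0" using T_add[of c 0 0] by simp
        then show "esign i I * (if i = c then 1 else 0) * contract N w (X c) (I - {i}) = 0" by simp
      qed
      then show "contract N w (wedge (\<lambda>i. if i = c then 1 else 0) (X c)) I = w c * X c I"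
        using contract_wedge[OF N(1) I(1), of w "\<lambda>i. if i = c then 1 else 0" "X c"] c N(1)
        by (simp add: mult_delta_right)
    qed
    also have "\<dots> = node_poly a I * (\<Sum>c\<in>N. w c * T c (G I))"
      by (simp only: X_def sum_distrib_left mult_ac)
    also have "(\<Sum>c\<in>N. w c * T c (G I)) = G I"
      using G I by (intro T_sum) (auto simp: closed_families_def)
    finally show ?thesis using F[rule_format, OF I] by simp
  qed
  ultimately show ?thesis unfolding w_def[abs_def] by (intro exI[of _ H] conjI allI impI)
qed

lemma coeff_mult_add:
  fixes f h :: "'a::comm_semiring_0 poly"
  assumes "degree f \<le> m" "degree h \<le> n"
  shows "coeff (f * h) (m + n) = coeff f m * coeff h n"
proof -
  have "coeff (f * h) (m + n) = (\<Sum>i\<le>m + n. if i = m then coeff f m * coeff h n else 0)"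
    unfolding coeff_mult
  proof (rule sum.cong[OF refl])
    fix i assume "i \<in> {..m + n}"
    then show "coeff f i * coeff h (m + n - i) = (if i = m then coeff f m * coeff h n else 0)"
      using assms by (cases i m rule: linorder_cases) (auto simp: coeff_eq_0)
  qed
  then show ?thesis by simp
qed

context koszul_basis
begin

lemma differential_eq_sum:
  "differential F I = (\<Sum>i\<in>N - I. sec_scale (esign i I) (sec_mult (e i) (F (insert i I))))"
  by (rule prod_eqI) (simp_all add: differential_def contract_def fst_sum snd_sum esign_poly[of _ _, where 'a = complex])

lemma differential_in:
  assumes "I \<subseteq> N" "\<And>J. J \<subseteq> N \<Longrightarrow> card J = Suc (card I) \<Longrightarrow> F J \<in> H q"
  shows "differential F I \<in> H (Suc q)"
  unfolding differential_eq_sum using assms finite_subset[OF assms(1) finite_N]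
  by (intro H_sum H_scale H_mult e_in) auto

lemma differential_add: "differential (\<lambda>J. F J + G J) I = differential F I + differential G I"
  by (rule prod_eqI) (simp_all add: differential_def contract_add)

lemma differential_diff: "differential (\<lambda>J. F J - G J) I = differential F I - differential G I"
  using differential_add[of F "\<lambda>J. - G J" I] by (simp add: differential_uminus)

lemma differential_differential: "I \<subseteq> N \<Longrightarrow> differential (differential F) I = 0"
  by (rule prod_eqI) (simp_all add: differential_def contract_contract[OF finite_N])

end

locale binary_curve =
  fixes g :: nat and a :: "nat \<times> nat \<Rightarrow> complex"
  assumes genus: "3 \<le> g"
    and inj1: "inj_on (\<lambda>l. a (l, 1)) {1..g}" and inj2: "inj_on (\<lambda>l. a (l, 2)) {1..g}"
begin

\<comment> \<open>The column index 1 and the degree in \<open>H 1\<close> are to stay in the form in which they are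
  stated.\<close>
declare One_nat_def [simp del]

abbreviation "N \<equiv> {1..g}"
abbreviation "\<alpha> \<equiv> \<lambda>l. a (l, 1)"
abbreviation "\<beta> \<equiv> \<lambda>l. a (l, 2)"
abbreviation "H \<equiv> H0_omega_power g a"

definition "M_deriv1 l = poly (node_poly \<alpha> (N - {l})) (a (l, 1))"
definition "M_deriv2 l = poly (node_poly \<beta> (N - {l})) (a (l, 2))"
definition "e l = (node_poly \<alpha> (N - {l}), - node_poly \<beta> (N - {l}))"
definition "\<kappa> l s = poly (fst s) (a (l, 1)) / M_deriv1 l"

lemma M_deriv_nonzero: "l \<in> N \<Longrightarrow> M_deriv1 l \<noteq> 0" "l \<in> N \<Longrightarrow> M_deriv2 l \<noteq> 0"
  using poly_node_poly_eq_0_iff[OF _ inj1, of "N - {l}" l] poly_node_poly_eq_0_iff[OF _ inj2, of "N - {l}" l]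
  by (auto simp: M_deriv1_def M_deriv2_def)

lemma poly_e:
  "l \<in> N \<Longrightarrow> i \<in> N \<Longrightarrow> poly (fst (e i)) (a (l, 1)) = (if l = i then M_deriv1 i else 0)"
  "l \<in> N \<Longrightarrow> i \<in> N \<Longrightarrow> poly (snd (e i)) (a (l, 2)) = (if l = i then - M_deriv2 i else 0)"
  using poly_node_poly_eq_0_iff[OF _ inj1, of "N - {i}" l] poly_node_poly_eq_0_iff[OF _ inj2, of "N - {i}" l]
  by (auto simp: e_def M_deriv1_def M_deriv2_def)

lemma poly_pderiv_M:
  assumes "l \<in> N"
  shows "poly (pderiv (M_poly g a j)) (a (l, j)) = poly (node_poly (\<lambda>l. a (l, j)) (N - {l})) (a (l, j))"
proof -
  have M: "M_poly g a j = [:- a (l, j), 1:] * node_poly (\<lambda>l. a (l, j)) (N - {l})"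
    using node_poly_remove[of N l "\<lambda>l. a (l, j)"] assms by (simp add: M_poly_def node_poly_def)
  show ?thesis unfolding M pderiv_mult by (simp add: pderiv_pCons)
qed

lemma H_iff:
  "s \<in> H q \<longleftrightarrow> degree (fst s) \<le> q * (g - 1) \<and> degree (snd s) \<le> q * (g - 1) \<and>
     (\<forall>l\<in>N. poly (fst s) (a (l, 1)) / M_deriv1 l ^ q = (- 1) ^ q * (poly (snd s) (a (l, 2)) / M_deriv2 l ^ q)) \<and>
     coeff (fst s) (q * (g - 1)) = (- 1) ^ q * coeff (snd s) (q * (g - 1))"
proof -
  have "{1..Suc g} = insert (Suc g) N" by auto
  moreover have "(- 1) ^ q * x = y \<longleftrightarrow> x = (- 1) ^ q * y" for x y :: complex
    by (cases "even q") auto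
  ultimately show ?thesis
    by (cases s) (auto simp: H0_omega_power_def leading_coefficient_def poly_pderiv_M M_deriv1_def M_deriv2_def)
qed

lemma fst_expansion:
  assumes "degree f \<le> g - 1"
  shows "(\<Sum>l\<in>N. smult (poly f (a (l, 1)) / M_deriv1 l) (fst (e l))) = f"
proof -
  have "degree f < card N" using assms genus by simp
  from Lagrange_interpolation[OF _ inj1 this, symmetric] show ?thesis
    unfolding e_def M_deriv1_def fst_conv by simp
qed

sublocale koszul_basis H N e \<kappa>
proof
  show "finite N" by simp
  show "0 \<in> H q" for q by (simp add: H_iff)
  show "s + t \<in> H q" if "s \<in> H q" "t \<in> H q" for s t q
    using that by (simp add: H_iff degree_add_le add_divide_distrib distrib_left)
  show "sec_scale c s \<in> H q" if "s \<in> H q" for c s q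
  proof -
    have "degree (smult c f) \<le> n" if "degree f \<le> n" for f n
      using degree_smult_le[of c f] that by simp
    then show ?thesis using that by (simp add: H_iff mult.left_commute[of c] flip: times_divide_eq_right)
  qed
  show "sec_mult s u \<in> H (Suc q)" if s: "s \<in> H 1" and u: "u \<in> H q" for s u q
  proof -
    have deg: "degree (fst s) \<le> g - 1" "degree (snd s) \<le> g - 1"
      "degree (fst u) \<le> q * (g - 1)" "degree (snd u) \<le> q * (g - 1)"
      using s u by (auto simp: H_iff)
    have "degree (fst s * fst u) \<le> g - 1 + q * (g - 1)" "degree (snd s * snd u) \<le> g - 1 + q * (g - 1)"
      using deg by (auto intro!: order.trans[OF degree_mult_le] add_mono)
    moreover have "coeff (fst s * fst u) (g - 1 + q * (g - 1)) = (- 1) ^ Suc q * coeff (snd s * snd u) (g - 1 + q * (g - 1))"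
      using s u deg by (simp add: H_iff coeff_mult_add)
    moreover have "poly (fst s * fst u) (a (l, 1)) / M_deriv1 l ^ Suc q =
        (- 1) ^ Suc q * (poly (snd s * snd u) (a (l, 2)) / M_deriv2 l ^ Suc q)" if l: "l \<in> N" for l
    proof -
      have "poly (fst s * fst u) (a (l, 1)) / M_deriv1 l ^ Suc q =
          (poly (fst s) (a (l, 1)) / M_deriv1 l) * (poly (fst u) (a (l, 1)) / M_deriv1 l ^ q)"
        by simp
      also have "\<dots> = (- (poly (snd s) (a (l, 2)) / M_deriv2 l)) * ((- 1) ^ q * (poly (snd u) (a (l, 2)) / M_deriv2 l ^ q))"
        using s u l by (simp add: H_iff)
      finally show ?thesis by simp
    qed
    ultimately show ?thesis by (simp add: H_iff)
  qed
  show "e i \<in> H 1" if "i \<in> N" for i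
  proof -
    have c: "coeff (node_poly b (N - {i})) (g - 1) = 1" for b
    proof -
      have "card (N - {i}) = g - 1" using that by simp
      then show ?thesis using lead_coeff_node_poly[of b "N - {i}"] by (simp only:)
    qed
    have d: "degree (fst (e i)) \<le> g - 1" "degree (snd (e i)) \<le> g - 1" using that by (simp_all add: e_def)
    show ?thesis
      using that d c M_deriv_nonzero by (simp add: H_iff poly_e) (simp add: e_def)
  qed
  show "\<kappa> i (s + t) = \<kappa> i s + \<kappa> i t" for i s t by (simp add: \<kappa>_def add_divide_distrib)
  show "\<kappa> i (sec_scale c s) = c * \<kappa> i s" for i c s by (simp add: \<kappa>_def)
  show "\<kappa> i (e j) = (if i = j then 1 else 0)" if "i \<in> N" "j \<in> N" for i j
    using that M_deriv_nonzero by (simp add: \<kappa>_def poly_e)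
  show "s = (\<Sum>i\<in>N. sec_scale (\<kappa> i s) (e i))" if s: "s \<in> H 1" for s
  proof (rule prod_eqI)
    have deg: "degree (fst s) \<le> g - 1" "degree (snd s) < card N" using s genus by (auto simp: H_iff)
    show "fst s = fst (\<Sum>i\<in>N. sec_scale (\<kappa> i s) (e i))"
      using fst_expansion[OF deg(1)] by (simp add: fst_sum \<kappa>_def)
    have "snd (\<Sum>i\<in>N. sec_scale (\<kappa> i s) (e i)) = (\<Sum>i\<in>N. smult (poly (snd s) (a (i, 2)) / M_deriv2 i) (node_poly \<beta> (N - {i})))"
      unfolding snd_sum
    proof (rule sum.cong[OF refl])
      fix i assume "i \<in> N"
      then have "\<kappa> i s = - (poly (snd s) (a (i, 2)) / M_deriv2 i)" using s by (simp add: H_iff \<kappa>_def)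
      then show "snd (sec_scale (\<kappa> i s) (e i)) = smult (poly (snd s) (a (i, 2)) / M_deriv2 i) (node_poly \<beta> (N - {i}))"
        by (simp add: e_def)
    qed
    also have "\<dots> = snd s"
      unfolding M_deriv2_def by (rule Lagrange_interpolation[OF finite_atLeastAtMost inj2 deg(2), symmetric])
    finally show "snd s = snd (\<Sum>i\<in>N. sec_scale (\<kappa> i s) (e i))" ..
  qed
qed

text \<open>
  The section of \<open>\<omega>\<^sub>C\<close> whose restriction to the first component is \<open>f\<close>, if the degree of \<open>f\<close> is at
  most \<open>g - 1\<close>; in general, whose values at the nodes are those of \<open>f\<close>.
\<close>

definition lift :: "complex poly \<Rightarrow> sec" where
  "lift f = (\<Sum>l\<in>N. sec_scale (poly f (a (l, 1)) / M_deriv1 l) (e l))"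

lemma lift_in: "lift f \<in> H 1"
  unfolding lift_def by (intro H_sum H_scale e_in)

lemma fst_lift: "degree f \<le> g - 1 \<Longrightarrow> fst (lift f) = f"
  by (simp add: lift_def fst_sum fst_expansion)

lemma lift_fst: "s \<in> H 1 \<Longrightarrow> lift (fst s) = s"
  using expansion[of s] by (simp add: lift_def \<kappa>_def)

text \<open>
  A section that vanishes on the first component at the nodes in \<open>J\<close> does so on the second
  component, and the remaining residues are carried over by \<open>transfer\<close>.
\<close>

lemma snd_lift_node_poly:
  assumes J: "J \<subseteq> N"
  shows "snd (lift (node_poly \<alpha> J * f)) = - (node_poly \<beta> J * transfer N \<alpha> \<beta> J f)"
proof -
  let ?c = "\<lambda>l. poly (node_poly \<alpha> J * f) (a (l, 1)) / M_deriv1 l"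
  have "snd (lift (node_poly \<alpha> J * f)) = (\<Sum>l\<in>N. smult (?c l) (snd (e l)))"
    by (simp add: lift_def snd_sum)
  also have "\<dots> = (\<Sum>l\<in>N - J. smult (?c l) (snd (e l)))"
    using J poly_node_poly_eq_0_iff[OF _ inj1 J] by (intro sum.mono_neutral_right) auto
  also have "\<dots> = (\<Sum>l\<in>N - J. - (node_poly \<beta> J * smult (?c l) (node_poly \<beta> (N - J - {l}))))"
  proof (rule sum.cong[OF refl])
    fix l assume l: "l \<in> N - J"
    have "N - {l} - J = N - J - {l}" by auto
    then have "node_poly \<beta> (N - {l}) = node_poly \<beta> (N - J - {l}) * node_poly \<beta> J"
      using node_poly_split[of "N - {l}" J \<beta>] l J by auto
    then show "smult (?c l) (snd (e l)) = - (node_poly \<beta> J * smult (?c l) (node_poly \<beta> (N - J - {l})))"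
      by (simp add: e_def mult_ac)
  qed
  finally show ?thesis by (simp add: transfer_def sum_negf sum_distrib_left M_deriv1_def)
qed

text \<open>
  This is where \<open>green_map\<close> comes from: the snake map from the cycles in \<open>\<Lambda>\<^sup>p\<^sup>+\<^sup>1 V \<otimes> V\<close> on the first
  component to the cycles in \<open>\<Lambda>\<^sup>p V \<otimes> H\<^sup>0(\<omega>\<^sub>C\<^sup>2)\<close> that live on the second one.
\<close>

lemma differential_lift_node_poly:
  assumes p: "p + 3 \<le> g" and L: "L \<in> closed_families N (Suc p) (g - 2 - p)" and I: "I \<subseteq> N" "card I = p"
  shows "differential (\<lambda>J. lift (node_poly \<alpha> J * L J)) I =
    (0, node_poly \<beta> N * node_poly \<beta> I * green_map N \<alpha> \<beta> L I)"
proof -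
  have "contract N (\<lambda>i. fst (e i)) (\<lambda>J. fst (lift (node_poly \<alpha> J * L J))) I =
      contract N (\<lambda>i. node_poly \<alpha> (N - {i})) (\<lambda>J. node_poly \<alpha> J * L J) I"
    unfolding e_def fst_conv
  proof (rule contract_cong)
    fix J assume J: "J \<subseteq> N" "card J = Suc (card I)"
    then have "degree (L J) \<le> g - 2 - p" using L I by (auto simp: closed_families_def)
    from degree_node_poly_mult_le[OF this, of \<alpha> J] J I p
    show "fst (lift (node_poly \<alpha> J * L J)) = node_poly \<alpha> J * L J" by (intro fst_lift) simp
  qed (use I in auto)
  also have "\<dots> = node_poly \<alpha> N * node_poly \<alpha> I * contract N (\<lambda>_. 1) L I"
    using I by (intro contract_node_poly) auto
  also have "contract N (\<lambda>_. 1) L I = 0" using L I by (auto simp: closed_families_def)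
  finally have 1: "contract N (\<lambda>i. fst (e i)) (\<lambda>J. fst (lift (node_poly \<alpha> J * L J))) I = 0" by simp
  have "contract N (\<lambda>i. snd (e i)) (\<lambda>J. snd (lift (node_poly \<alpha> J * L J))) I =
      contract N (\<lambda>i. - node_poly \<beta> (N - {i})) (\<lambda>J. - (node_poly \<beta> J * transfer N \<alpha> \<beta> J (L J))) I"
    unfolding e_def snd_conv using I by (intro contract_cong snd_lift_node_poly) auto
  also have "\<dots> = contract N (\<lambda>i. node_poly \<beta> (N - {i})) (\<lambda>J. node_poly \<beta> J * transfer N \<alpha> \<beta> J (L J)) I"
    by (simp add: contract_def)
  also have "\<dots> = node_poly \<beta> N * node_poly \<beta> I * green_map N \<alpha> \<beta> L I"
    unfolding green_map_def using I by (intro contract_node_poly) auto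
  finally show ?thesis using 1 by (simp add: differential_def)
qed

text \<open>
  The short exact sequence of a component and its complement: the first component contributes
  nothing to \<open>K\<^sub>p\<^sub>,\<^sub>2\<close>, hence \<open>K\<^sub>p\<^sub>,\<^sub>2(C, \<omega>\<^sub>C)\<close> is the cokernel of \<open>green_map\<close>.
\<close>

theorem koszul_vanishes_iff_green_surj:
  assumes p: "p + 3 \<le> g"
  shows "koszul_vanishes H p 2 \<longleftrightarrow> green_surj N \<alpha> \<beta> p"
proof -
  have card: "card N = g" by simp
  have "koszul_vanishes H p 2 = koszul_vanishes H p (Suc 1)"
    by (rule arg_cong[of _ _ "koszul_vanishes H p"]) simp
  moreover have "koszul_vanishes H p (Suc 1) \<longleftrightarrow> green_surj N \<alpha> \<beta> p"
    unfolding koszul_vanishes_iff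
  proof
    assume van: "\<forall>F. (\<forall>I\<subseteq>N. card I = p \<longrightarrow> F I \<in> H (Suc 1)) \<and> (\<forall>I\<subseteq>N. Suc (card I) = p \<longrightarrow> differential F I = 0) \<longrightarrow>
       (\<exists>G. (\<forall>J\<subseteq>N. card J = Suc p \<longrightarrow> G J \<in> H 1) \<and> (\<forall>I\<subseteq>N. card I = p \<longrightarrow> differential G I = F I))"
    show "green_surj N \<alpha> \<beta> p"
      unfolding green_surj_def card
    proof
      fix G' assume G': "G' \<in> closed_families N p (g - 3 - p)"
      \<comment> \<open>The cycle on the second component that belongs to the closed family G'.\<close>
      define F where "F I = (0 :: complex poly, node_poly \<beta> N * (node_poly \<beta> I * G' I))" for I
      have F: "F I \<in> H (Suc 1)" if I: "I \<subseteq> N" "card I = p" for I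
      proof -
        have "degree (G' I) \<le> g - 3 - p" using G' I by (auto simp: closed_families_def)
        from degree_node_poly_mult_le[OF degree_node_poly_mult_le[OF this], of \<beta> N \<beta> I]
        have deg: "degree (node_poly \<beta> N * (node_poly \<beta> I * G' I)) < 2 * (g - 1)" using I p by simp
        moreover have "poly (node_poly \<beta> N) (a (l, 2)) = 0" if "l \<in> N" for l
          using poly_node_poly_eq_0_iff[OF _ inj2, of N l] that by simp
        ultimately show ?thesis by (simp add: H_iff F_def coeff_eq_0)
      qed
      have "differential F I = 0" if I: "I \<subseteq> N" "Suc (card I) = p" for I
      proof -
        have "contract N (\<lambda>i. snd (e i)) (\<lambda>J. snd (F J)) I =
          - (node_poly \<beta> N * contract N (\<lambda>i. node_poly \<beta> (N - {i})) (\<lambda>J. node_poly \<beta> J * G' J) I)"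
          by (simp add: contract_def e_def F_def sum_negf sum_distrib_left mult_ac)
        also have "contract N (\<lambda>i. node_poly \<beta> (N - {i})) (\<lambda>J. node_poly \<beta> J * G' J) I = 0"
          using contract_node_poly[of N I \<beta> G'] I G' by (simp add: closed_families_def)
        finally show ?thesis by (simp add: differential_def F_def zero_prod_def)
      qed
      with F have "(\<forall>I\<subseteq>N. card I = p \<longrightarrow> F I \<in> H (Suc 1)) \<and> (\<forall>I\<subseteq>N. Suc (card I) = p \<longrightarrow> differential F I = 0)"
        by (intro conjI allI impI)
      from mp[OF spec[OF van] this] obtain G where "\<forall>J\<subseteq>N. card J = Suc p \<longrightarrow> G J \<in> H 1"
        and "\<forall>I\<subseteq>N. card I = p \<longrightarrow> differential G I = F I"
        by (elim exE conjE)
      note G = this(1)[rule_format] and dG = this(2)[rule_format]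
      have deg: "degree (fst (G J)) \<le> g - 1" if "J \<subseteq> N" "card J = Suc p" for J
        using G[OF that] by (simp add: H_iff)
      have closed: "contract N (\<lambda>i. node_poly \<alpha> (N - {i})) (\<lambda>J. fst (G J)) I = 0" if "I \<subseteq> N" "Suc (card I) = Suc p" for I
        using arg_cong[OF dG[of I], of fst] that by (simp add: differential_def e_def F_def)
      have "\<exists>L\<in>closed_families N (Suc p) (g - 1 - Suc p). \<forall>J\<subseteq>N. card J = Suc p \<longrightarrow> fst (G J) = node_poly \<alpha> J * L J"
        by (rule closed_family_factor[OF finite_N inj1]) (fact deg, fact closed)
      then obtain L where L: "L \<in> closed_families N (Suc p) (g - 1 - Suc p)"
          and GL: "\<forall>J\<subseteq>N. card J = Suc p \<longrightarrow> fst (G J) = node_poly \<alpha> J * L J"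
        by (elim bexE)
      have L': "L \<in> closed_families N (Suc p) (g - 2 - p)"
      proof -
        have "g - 1 - Suc p = g - 2 - p" by linarith
        then show ?thesis using L by (simp only:)
      qed
      have "green_map N \<alpha> \<beta> L I = G' I" if I: "I \<subseteq> N" "card I = p" for I
      proof -
        have "differential (\<lambda>J. lift (node_poly \<alpha> J * L J)) I = differential G I"
        proof (rule differential_cong[OF I(1)])
          fix J assume J: "J \<subseteq> N" "card J = Suc (card I)"
          then show "lift (node_poly \<alpha> J * L J) = G J"
            using GL[rule_format, of J] lift_fst[OF G[of J]] I by simp
        qed
        then have "node_poly \<beta> N * node_poly \<beta> I * green_map N \<alpha> \<beta> L I = node_poly \<beta> N * node_poly \<beta> I * G' I"
          using differential_lift_node_poly[OF p L' I] dG[OF I] by (simp add: F_def mult_ac)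
        then show ?thesis by simp
      qed
      then show "\<exists>L\<in>closed_families N (Suc p) (g - 2 - p). \<forall>I\<subseteq>N. card I = p \<longrightarrow> green_map N \<alpha> \<beta> L I = G' I"
        using L' by blast
    qed
  next
    assume surj: "green_surj N \<alpha> \<beta> p"
    show "\<forall>F. (\<forall>I\<subseteq>N. card I = p \<longrightarrow> F I \<in> H (Suc 1)) \<and> (\<forall>I\<subseteq>N. Suc (card I) = p \<longrightarrow> differential F I = 0) \<longrightarrow>
       (\<exists>G. (\<forall>J\<subseteq>N. card J = Suc p \<longrightarrow> G J \<in> H 1) \<and> (\<forall>I\<subseteq>N. card I = p \<longrightarrow> differential G I = F I))"
    proof (intro allI impI, elim conjE)
      fix F assume F: "\<forall>I\<subseteq>N. card I = p \<longrightarrow> F I \<in> H (Suc 1)"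
        and dF: "\<forall>I\<subseteq>N. Suc (card I) = p \<longrightarrow> differential F I = 0"
      have "\<exists>H1. (\<forall>J\<subseteq>N. card J = Suc p \<longrightarrow> degree (H1 J) \<le> g - 1) \<and>
        (\<forall>I\<subseteq>N. card I = p \<longrightarrow> contract N (\<lambda>i. node_poly \<alpha> (N - {i})) H1 I = fst (F I))"
      proof (rule rational_normal_curve_exact[OF _ inj1])
        fix I assume I: "I \<subseteq> N"
        show "degree (fst (F I)) \<le> 2 * (g - 1)" if "card I = p" using F that I by (simp add: H_iff)
        show "contract N (\<lambda>i. node_poly \<alpha> (N - {i})) (\<lambda>I. fst (F I)) I = 0" if "Suc (card I) = p"
          using arg_cong[OF dF[rule_format, OF I that], of fst] by (simp add: differential_def e_def)
      qed (use genus p in auto)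
      then obtain H1 where "\<forall>J\<subseteq>N. card J = Suc p \<longrightarrow> degree (H1 J) \<le> g - 1"
        and "\<forall>I\<subseteq>N. card I = p \<longrightarrow> contract N (\<lambda>i. node_poly \<alpha> (N - {i})) H1 I = fst (F I)"
        by (elim exE conjE)
      note H1 = this(1)[rule_format] and dH1 = this(2)[rule_format]
      \<comment> \<open>Subtracting the boundary of G1 removes the restriction of F to the first component.\<close>
      define G1 where "G1 J = lift (H1 J)" for J
      define F' where "F' I = F I - differential G1 I" for I
      have F': "F' I \<in> H 2" "fst (F' I) = 0" if I: "I \<subseteq> N" "card I = p" for I
      proof -
        have "differential G1 I \<in> H (Suc 1)" using I(1) by (rule differential_in) (simp only: G1_def lift_in)
        moreover have "F I \<in> H (Suc 1)" using F I by blast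
        ultimately have "F I + - differential G1 I \<in> H (Suc 1)" by (intro H_add H_uminus)
        then show "F' I \<in> H 2" by (simp add: F'_def numeral_2_eq_2)
        have "fst (differential G1 I) = contract N (\<lambda>i. node_poly \<alpha> (N - {i})) H1 I"
          unfolding differential_def fst_conv e_def G1_def
          by (rule contract_cong) (use I H1 fst_lift in auto)
        then show "fst (F' I) = 0" using dH1[OF I] by (simp add: F'_def)
      qed
      \<comment> \<open>What is left vanishes at all nodes including infinity, which lowers the degree to g - 3
        after the division.\<close>
      define h where "h I = snd (F' I) div node_poly \<beta> N" for I
      have h: "snd (F' I) = node_poly \<beta> N * h I" "degree (h I) \<le> g - 3" if I: "I \<subseteq> N" "card I = p" for I
      proof -
        have "node_poly \<beta> N dvd snd (F' I)"
        proof (rule node_poly_dvd[OF _ inj2])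
          fix l assume l: "l \<in> N"
          then have "poly (fst (F' I)) (a (l, 1)) / M_deriv1 l ^ 2 = poly (snd (F' I)) (a (l, 2)) / M_deriv2 l ^ 2"
            using F'(1)[OF I] by (simp add: H_iff)
          then show "poly (snd (F' I)) (a (l, 2)) = 0" using F'(2)[OF I] M_deriv_nonzero(2)[OF l] by simp
        qed simp
        then show *: "snd (F' I) = node_poly \<beta> N * h I" by (simp add: h_def)
        have deg: "degree (snd (F' I)) \<le> 2 * (g - 1)" "coeff (snd (F' I)) (2 * (g - 1)) = 0"
          using F'[OF I] by (auto simp: H_iff)
        show "degree (h I) \<le> g - 3"
        proof (cases "h I = 0")
          case False
          then have eq: "degree (snd (F' I)) = g + degree (h I)" "snd (F' I) \<noteq> 0"
            unfolding * by (simp_all add: degree_mult_eq)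
          have "degree (snd (F' I)) \<noteq> 2 * (g - 1)" using deg(2) eq(2) leading_coeff_0_iff by metis
          then show ?thesis using eq(1) deg(1) genus by simp
        qed simp
      qed
      have closed: "contract N (\<lambda>i. node_poly \<beta> (N - {i})) h I = 0" if I: "I \<subseteq> N" "Suc (card I) = p" for I
      proof -
        have "differential F' I = 0"
          unfolding F'_def differential_diff using dF I differential_differential[OF I(1)] by simp
        then have "0 = contract N (\<lambda>i. snd (e i)) (\<lambda>J. snd (F' J)) I"
          by (simp add: differential_def zero_prod_def)
        also have "\<dots> = contract N (\<lambda>i. snd (e i)) (\<lambda>J. node_poly \<beta> N * h J) I"
          using I h(1) by (intro contract_cong) auto
        also have "\<dots> = - (node_poly \<beta> N * contract N (\<lambda>i. node_poly \<beta> (N - {i})) h I)"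
          by (simp add: contract_def e_def sum_negf sum_distrib_left mult_ac)
        finally show ?thesis by simp
      qed
      have "\<exists>G'\<in>closed_families N p (g - 3 - p). \<forall>I\<subseteq>N. card I = p \<longrightarrow> h I = node_poly \<beta> I * G' I"
        by (rule closed_family_factor[OF finite_N inj2]) (fact h(2), fact closed)
      then obtain G' where G': "G' \<in> closed_families N p (g - 3 - p)"
          and hG': "\<forall>I\<subseteq>N. card I = p \<longrightarrow> h I = node_poly \<beta> I * G' I"
        by (elim bexE)
      from bspec[OF surj[unfolded green_surj_def card] G'] obtain L
        where L: "L \<in> closed_families N (Suc p) (g - 2 - p)"
          and LG': "\<forall>I\<subseteq>N. card I = p \<longrightarrow> green_map N \<alpha> \<beta> L I = G' I"
        by (elim bexE)
      define G2 where "G2 J = lift (node_poly \<alpha> J * L J)" for J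
      have "differential (\<lambda>J. G1 J + G2 J) I = F I" if I: "I \<subseteq> N" "card I = p" for I
      proof -
        have "differential G2 I = F' I"
          unfolding G2_def differential_lift_node_poly[OF p L I] LG'[rule_format, OF I]
          using h(1)[OF I] hG'[rule_format, OF I] F'(2)[OF I] by (intro prod_eqI) (simp_all add: mult_ac)
        then show ?thesis by (simp add: differential_add F'_def)
      qed
      moreover have "G1 J + G2 J \<in> H 1" for J
        unfolding G1_def G2_def by (intro H_add lift_in)
      ultimately show "\<exists>G. (\<forall>J\<subseteq>N. card J = Suc p \<longrightarrow> G J \<in> H 1) \<and> (\<forall>I\<subseteq>N. card I = p \<longrightarrow> differential G I = F I)"
        by (intro exI[of _ "\<lambda>J. G1 J + G2 J"] conjI allI impI)
    qed
  qed
  ultimately show ?thesis by simp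
qed

end

section \<open>Canonical binary curves in projective space\<close>

lemma phi_eq: "i \<in> {1..g} \<Longrightarrow> phi g a j (t, u) i = (\<Prod>r\<in>{1..g} - {i}. t - a (r, j) * u)"
  by (simp add: phi_def)

text \<open>
  The factors are the linear forms of \<open>\<phi>\<^sub>j\<close> with one of the two homogeneous coordinates fixed.
\<close>

lemma deriv_prod_affine:
  fixes c d :: "nat \<Rightarrow> complex"
  assumes "finite A"
  shows "deriv (\<lambda>z. \<Prod>r\<in>A. c r + d r * z) z = (\<Sum>s\<in>A. d s * (\<Prod>r\<in>A - {s}. c r + d r * z))"
proof -
  have "((\<lambda>z. \<Prod>r\<in>A. c r + d r * z) has_field_derivative (\<Sum>s\<in>A. d s * (\<Prod>r\<in>A - {s}. c r + d r * z))) (at z)"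
    using assms
  proof (induction A rule: finite_induct)
    case (insert x A)
    have *: "(\<Sum>s\<in>A. d s * (\<Prod>r\<in>insert x A - {s}. c r + d r * z)) =
        (c x + d x * z) * (\<Sum>s\<in>A. d s * (\<Prod>r\<in>A - {s}. c r + d r * z))"
      unfolding sum_distrib_left
    proof (rule sum.cong[OF refl])
      fix s assume "s \<in> A"
      then have "insert x A - {s} = insert x (A - {s})" using insert.hyps by auto
      then show "d s * (\<Prod>r\<in>insert x A - {s}. c r + d r * z) =
          (c x + d x * z) * (d s * (\<Prod>r\<in>A - {s}. c r + d r * z))"
        using insert.hyps by simp
    qed
    show ?case
      using insert.hyps
      by (auto simp: * intro!: derivative_eq_intros insert.IH)
  qed simp
  then show ?thesis by (rule DERIV_imp_deriv)
qed

lemma phi_directional_derivative: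
  assumes i: "i \<in> {1..g}"
  shows "c * phi_dt g a j (t, u) i + d * phi_du g a j (t, u) i =
    (\<Sum>s\<in>{1..g} - {i}. (c - d * a (s, j)) * (\<Prod>r\<in>{1..g} - {i} - {s}. t - a (r, j) * u))"
proof -
  have "phi_dt g a j (t, u) i = (\<Sum>s\<in>{1..g} - {i}. \<Prod>r\<in>{1..g} - {i} - {s}. t - a (r, j) * u)"
    using i deriv_prod_affine[of "{1..g} - {i}" "\<lambda>r. - a (r, j) * u" "\<lambda>_. 1" t]
    by (simp add: phi_dt_def phi_def)
  moreover have "phi_du g a j (t, u) i =
      (\<Sum>s\<in>{1..g} - {i}. - a (s, j) * (\<Prod>r\<in>{1..g} - {i} - {s}. t - a (r, j) * u))"
    using i deriv_prod_affine[of "{1..g} - {i}" "\<lambda>_. t" "\<lambda>r. - a (r, j)" u]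
    by (simp add: phi_du_def phi_def)
  ultimately show ?thesis
    by (simp add: sum_distrib_left sum_subtractf left_diff_distrib sum_negf mult_ac)
qed

lemma proj_point_eqD:
  assumes "proj_point g v = proj_point g w"
  shows "\<exists>c. c \<noteq> 0 \<and> (\<forall>i\<in>{1..g}. v i = c * w i)"
proof -
  have "(\<lambda>i\<in>{1..g}. 1 * v i) \<in> proj_point g v" unfolding proj_point_def by (intro CollectI exI[of _ 1]) simp
  then have "(\<lambda>i\<in>{1..g}. 1 * v i) \<in> proj_point g w" using assms by simp
  then obtain c where c: "c \<noteq> 0" "(\<lambda>i\<in>{1..g}. 1 * v i) = (\<lambda>i\<in>{1..g}. c * w i)"
    unfolding proj_point_def by blast
  have "v i = c * w i" if "i \<in> {1..g}" for i using fun_cong[OF c(2), of i] that by simp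
  then show ?thesis using c(1) by blast
qed

lemma proj_point_eqI:
  assumes c: "c \<noteq> 0" and vw: "\<And>i. i \<in> {1..g} \<Longrightarrow> v i = c * w i"
  shows "proj_point g v = proj_point g w"
proof
  show "proj_point g v \<subseteq> proj_point g w"
  proof
    fix x assume "x \<in> proj_point g v"
    then obtain d where "d \<noteq> 0" "x = (\<lambda>i\<in>{1..g}. d * v i)" unfolding proj_point_def by blast
    then show "x \<in> proj_point g w"
      unfolding proj_point_def using c vw
      by (intro CollectI exI[of _ "d * c"]) (auto simp: fun_eq_iff)
  qed
  show "proj_point g w \<subseteq> proj_point g v"
  proof
    fix x assume "x \<in> proj_point g w"
    then obtain d where "d \<noteq> 0" "x = (\<lambda>i\<in>{1..g}. d * w i)" unfolding proj_point_def by blast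
    then show "x \<in> proj_point g v"
      unfolding proj_point_def using c vw
      by (intro CollectI exI[of _ "d / c"]) (auto simp: fun_eq_iff)
  qed
qed

text \<open>
  If two nodes on a component coincide, all coordinates of \<open>\<phi>\<^sub>j\<close> vanish there.
\<close>

lemma smooth_rational_imp_inj:
  assumes "smooth_rational g a j"
  shows "inj_on (\<lambda>l. a (l, j)) {1..g}"
proof (rule inj_onI, rule ccontr)
  fix l r assume l: "l \<in> {1..g}" and r: "r \<in> {1..g}" and eq: "a (l, j) = a (r, j)" and "l \<noteq> r"
  obtain i where i: "i \<in> {1..g}" "phi g a j (a (l, j), 1) i \<noteq> 0"
    using assms unfolding smooth_rational_def by (metis prod.inject zero_neq_one)
  have "\<exists>s\<in>{1..g} - {i}. a (l, j) - a (s, j) * 1 = 0"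
  proof (cases "i = l")
    case True
    then show ?thesis using r eq \<open>l \<noteq> r\<close> by (intro bexI[of _ r]) auto
  next
    case False
    then show ?thesis using l by (intro bexI[of _ l]) auto
  qed
  then show False using i by (simp add: phi_eq)
qed

text \<open>
  A single component. If its nodes are distinct, \<open>\<phi>\<^sub>j\<close> is a rational normal curve in the Lagrange
  basis.
\<close>

locale distinct_nodes =
  fixes g :: nat and a :: "nat \<times> nat \<Rightarrow> complex" and j :: nat
  assumes genus: "3 \<le> g" and inj: "inj_on (\<lambda>l. a (l, j)) {1..g}"
begin

lemma zero_factor_unique:
  assumes "(t, u) \<noteq> (0, 0)" "r \<in> {1..g}" "s \<in> {1..g}" "t = a (r, j) * u" "t = a (s, j) * u"
  shows "r = s"
proof -
  have "u \<noteq> 0" using assms by auto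
  then have "a (r, j) = a (s, j)" using assms by simp
  then show ?thesis using inj_onD[OF inj] assms by blast
qed

lemma phi_at_node:
  assumes tu: "(t, u) \<noteq> (0, 0)" and l: "l \<in> {1..g}" and t: "t = a (l, j) * u" and i: "i \<in> {1..g}"
  shows "phi g a j (t, u) i = 0 \<longleftrightarrow> i \<noteq> l"
proof -
  have "phi g a j (t, u) i = 0 \<longleftrightarrow> (\<exists>r\<in>{1..g} - {i}. t = a (r, j) * u)"
    using i by (simp add: phi_eq)
  also have "\<dots> \<longleftrightarrow> i \<noteq> l"
  proof
    assume "\<exists>r\<in>{1..g} - {i}. t = a (r, j) * u"
    then obtain r where r: "r \<in> {1..g}" "r \<noteq> i" "t = a (r, j) * u" by blast
    then show "i \<noteq> l" using zero_factor_unique[OF tu r(1) l r(3) t] by simp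
  next
    assume "i \<noteq> l"
    then show "\<exists>r\<in>{1..g} - {i}. t = a (r, j) * u" using l t by (intro bexI[of _ l]) auto
  qed
  finally show ?thesis .
qed

text \<open>
  Away from the nodes all coordinates are nonzero, and their reciprocals are proportional to the
  linear forms \<open>t - a\<^sub>i\<^sub>,\<^sub>j u\<close>. This turns equalities of projective points into linear equations.
\<close>

lemma phi_off_nodes:
  assumes "\<forall>l\<in>{1..g}. t \<noteq> a (l, j) * u" and i: "i \<in> {1..g}"
  shows "phi g a j (t, u) i \<noteq> 0"
    and "phi g a j (t, u) i * (t - a (i, j) * u) = (\<Prod>r\<in>{1..g}. t - a (r, j) * u)"
proof -
  show "phi g a j (t, u) i \<noteq> 0" using assms by (simp add: phi_eq[OF i])
  show "phi g a j (t, u) i * (t - a (i, j) * u) = (\<Prod>r\<in>{1..g}. t - a (r, j) * u)"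
    by (subst prod.remove[OF _ i]) (simp_all add: phi_eq[OF i])
qed

lemma phi_node_iff:
  assumes "(t, u) \<noteq> (0, 0)" "l \<in> {1..g}"
  shows "t = a (l, j) * u \<longleftrightarrow> (\<forall>i\<in>{1..g}. phi g a j (t, u) i = 0 \<longleftrightarrow> i \<noteq> l)"
proof
  assume R: "\<forall>i\<in>{1..g}. phi g a j (t, u) i = 0 \<longleftrightarrow> i \<noteq> l"
  obtain i where i: "i \<in> {1..g}" "i \<noteq> l"
  proof
    show "(if l = 1 then 2 else 1) \<in> {1..g}" "(if l = 1 then 2 else 1) \<noteq> l" using genus by auto
  qed
  then have "phi g a j (t, u) i = 0" using R by simp
  then obtain r where r: "r \<in> {1..g}" "t = a (r, j) * u" using phi_off_nodes(1)[of t u i] i by blast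
  have "phi g a j (t, u) l \<noteq> 0" using R assms by simp
  then have "l = r" using phi_at_node[OF assms(1) r assms(2)] by simp
  then show "t = a (l, j) * u" using r by simp
qed (use phi_at_node assms in blast)

text \<open>
  Injectivity: a node is recognized by its vanishing coordinates, and away from the nodes the
  reciprocals of the coordinates determine \<open>[t, u]\<close>. Immersivity: away from the nodes the
  directional derivatives of all \<open>log \<phi>\<^sub>i\<close> vanish only if those of all the linear factors do; at a
  node \<open>l\<close>, the coordinates other than the \<open>l\<close>-th give the direction, and the \<open>l\<close>-th coordinate
  excludes the radial one.
\<close>

lemma smooth_rational: "smooth_rational g a j"
  unfolding smooth_rational_def
proof (intro conjI allI impI)
  fix x :: "complex \<times> complex" assume x: "x \<noteq> (0, 0)"
  obtain t u where tu: "x = (t, u)" by (cases x)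
  show "\<exists>i\<in>{1..g}. phi g a j x i \<noteq> 0"
  proof (cases "\<exists>l\<in>{1..g}. t = a (l, j) * u")
    case True
    then obtain l where "l \<in> {1..g}" "t = a (l, j) * u" by blast
    then show ?thesis using phi_at_node[of t u l l] x tu by (intro bexI[of _ l]) auto
  next
    case False
    then show ?thesis using phi_off_nodes(1)[of t u 1] genus tu by (intro bexI[of _ 1]) auto
  qed
next
  fix t u t' u'
  assume A: "(t, u) \<noteq> (0, 0) \<and> (t', u') \<noteq> (0, 0) \<and>
    proj_point g (phi g a j (t, u)) = proj_point g (phi g a j (t', u'))"
  then obtain c where c: "c \<noteq> 0" "\<forall>i\<in>{1..g}. phi g a j (t, u) i = c * phi g a j (t', u') i"
    using proj_point_eqD by blast
  have node_iff: "t = a (l, j) * u \<longleftrightarrow> t' = a (l, j) * u'" if "l \<in> {1..g}" for l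
    using phi_node_iff[of t u l] phi_node_iff[of t' u' l] A c that by simp
  show "t * u' = t' * u"
  proof (cases "\<exists>l\<in>{1..g}. t = a (l, j) * u")
    case True
    then obtain l where "l \<in> {1..g}" "t = a (l, j) * u" by blast
    then show ?thesis using node_iff[of l] by simp
  next
    case False
    then have off: "\<forall>l\<in>{1..g}. t \<noteq> a (l, j) * u" "\<forall>l\<in>{1..g}. t' \<noteq> a (l, j) * u'"
      using node_iff by auto
    define P where "P = (\<Prod>r\<in>{1..g}. t - a (r, j) * u)"
    define P' where "P' = (\<Prod>r\<in>{1..g}. t' - a (r, j) * u')"
    have nz: "P \<noteq> 0" using off by (simp add: P_def)
    have eq: "P * (t' - a (i, j) * u') = c * P' * (t - a (i, j) * u)" if i: "i \<in> {1..g}" for i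
      unfolding phi_off_nodes(2)[OF off(1) i, folded P_def, symmetric]
        phi_off_nodes(2)[OF off(2) i, folded P'_def, symmetric] bspec[OF c(2) i] by (simp only: mult_ac)
    have i12: "1 \<in> {1..g}" "2 \<in> {1..g}" using genus by auto
    then have "a (1, j) \<noteq> a (2, j)" using inj_onD[OF inj, of 1 2] by auto
    moreover have "(a (1, j) - a (2, j)) * (P * u' - c * P' * u) = 0"
      using eq[OF i12(1)] eq[OF i12(2)] by algebra
    ultimately have u: "P * u' = c * P' * u" by simp
    have "P * t' = c * P' * t" using eq[OF i12(1)] u by algebra
    then have "P * (t * u' - t' * u) = 0" using u by algebra
    then show ?thesis using nz by simp
  qed
next
  fix x :: "complex \<times> complex" and c d
  assume A: "x \<noteq> (0, 0) \<and> (\<forall>i\<in>{1..g}. c * phi_dt g a j x i + d * phi_du g a j x i = 0)"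
  obtain t u where tu: "x = (t, u)" by (cases x)
  have D: "(\<Sum>s\<in>{1..g} - {i}. (c - d * a (s, j)) * (\<Prod>r\<in>{1..g} - {i} - {s}. t - a (r, j) * u)) = 0"
    if i: "i \<in> {1..g}" for i
    using A i phi_directional_derivative[OF i, of c a j t u d] by (simp add: tu)
  have i12: "1 \<in> {1..g}" "2 \<in> {1..g}" using genus by auto
  then have a12: "a (1, j) \<noteq> a (2, j)" using inj_onD[OF inj, of 1 2] by auto
  have "c = 0 \<and> d = 0"
  proof (cases "\<exists>l\<in>{1..g}. t = a (l, j) * u")
    case True
    then obtain l where l: "l \<in> {1..g}" "t = a (l, j) * u" by blast
    have u: "u \<noteq> 0" using A l tu by auto
    have off: "t - a (r, j) * u \<noteq> 0" if "r \<in> {1..g}" "r \<noteq> l" for r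
      using zero_factor_unique[of t u r l] A l tu that by auto
    have cd: "c = d * a (l, j)"
    proof -
      obtain i where i: "i \<in> {1..g}" "i \<noteq> l"
      proof
        show "(if l = 1 then 2 else 1) \<in> {1..g}" "(if l = 1 then 2 else 1) \<noteq> l" using genus by auto
      qed
      have "0 = (\<Sum>s\<in>{1..g} - {i}. (c - d * a (s, j)) * (\<Prod>r\<in>{1..g} - {i} - {s}. t - a (r, j) * u))"
        using D[OF i(1)] by simp
      also have "\<dots> = (\<Sum>s\<in>{1..g} - {i}. if s = l then (c - d * a (l, j)) * (\<Prod>r\<in>{1..g} - {i} - {l}. t - a (r, j) * u) else 0)"
      proof (rule sum.cong[OF refl])
        fix s assume s: "s \<in> {1..g} - {i}"
        have "(\<Prod>r\<in>{1..g} - {i} - {s}. t - a (r, j) * u) = 0" if "s \<noteq> l"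
          using that l i by (intro prod_zero bexI[of _ l]) auto
        then show "(c - d * a (s, j)) * (\<Prod>r\<in>{1..g} - {i} - {s}. t - a (r, j) * u) =
          (if s = l then (c - d * a (l, j)) * (\<Prod>r\<in>{1..g} - {i} - {l}. t - a (r, j) * u) else 0)"
          by auto
      qed
      also have "\<dots> = (c - d * a (l, j)) * (\<Prod>r\<in>{1..g} - {i} - {l}. t - a (r, j) * u)"
        using l i by simp
      finally have "(c - d * a (l, j)) * (\<Prod>r\<in>{1..g} - {i} - {l}. t - a (r, j) * u) = 0" ..
      moreover have "(\<Prod>r\<in>{1..g} - {i} - {l}. t - a (r, j) * u) \<noteq> 0" using off by simp
      ultimately show ?thesis by simp
    qed
    define P where "P = (\<Prod>r\<in>{1..g} - {l}. t - a (r, j) * u)"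
    have P: "P \<noteq> 0" using off by (simp add: P_def)
    \<comment> \<open>Euler's relation for the form whose value is P\<close>
    have "0 = u * (\<Sum>s\<in>{1..g} - {l}. (c - d * a (s, j)) * (\<Prod>r\<in>{1..g} - {l} - {s}. t - a (r, j) * u))"
      using D[OF l(1)] by simp
    also have "\<dots> = (\<Sum>s\<in>{1..g} - {l}. d * P)"
      unfolding sum_distrib_left
    proof (rule sum.cong[OF refl])
      fix s assume "s \<in> {1..g} - {l}"
      then have P': "P = (t - a (s, j) * u) * (\<Prod>r\<in>{1..g} - {l} - {s}. t - a (r, j) * u)"
        unfolding P_def by (intro prod.remove) auto
      have "u * (c - d * a (s, j)) = d * (t - a (s, j) * u)"
        unfolding cd l(2) by (simp add: algebra_simps)
      then show "u * ((c - d * a (s, j)) * (\<Prod>r\<in>{1..g} - {l} - {s}. t - a (r, j) * u)) = d * P"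
        unfolding P' by (simp only: mult.assoc[symmetric])
    qed
    also have "\<dots> = of_nat (g - 1) * (d * P)" using l by simp
    finally have "d = 0" using P genus by simp
    then show ?thesis using cd by simp
  next
    case False
    then have off: "t - a (r, j) * u \<noteq> 0" if "r \<in> {1..g}" for r using that by auto
    define R where "R s = (c - d * a (s, j)) / (t - a (s, j) * u)" for s
    have R: "(\<Sum>s\<in>{1..g}. R s) = R i" if i: "i \<in> {1..g}" for i
    proof -
      define P where "P = (\<Prod>r\<in>{1..g} - {i}. t - a (r, j) * u)"
      have P: "P \<noteq> 0" using off by (simp add: P_def)
      have "0 = (\<Sum>s\<in>{1..g} - {i}. (c - d * a (s, j)) * (\<Prod>r\<in>{1..g} - {i} - {s}. t - a (r, j) * u))"
        using D[OF i] by simp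
      also have "\<dots> = (\<Sum>s\<in>{1..g} - {i}. P * R s)"
      proof (rule sum.cong[OF refl])
        fix s assume s: "s \<in> {1..g} - {i}"
        then have "P = (t - a (s, j) * u) * (\<Prod>r\<in>{1..g} - {i} - {s}. t - a (r, j) * u)"
          unfolding P_def by (intro prod.remove) auto
        then show "(c - d * a (s, j)) * (\<Prod>r\<in>{1..g} - {i} - {s}. t - a (r, j) * u) = P * R s"
          using off[of s] s by (simp add: R_def)
      qed
      finally have "(\<Sum>s\<in>{1..g} - {i}. R s) = 0" using P by (simp flip: sum_distrib_left)
      then show ?thesis using sum.remove[OF finite_atLeastAtMost i, of R] by simp
    qed
    define S where "S = (\<Sum>s\<in>{1..g}. R s)"
    have "(\<Sum>s\<in>{1..g}. R s) = (\<Sum>s\<in>{1..g}. S)"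
    proof (rule sum.cong[OF refl])
      fix s assume "s \<in> {1..g}"
      from R[OF this] show "R s = S" unfolding S_def by (rule sym)
    qed
    then have "S = (\<Sum>s\<in>{1..g}. S)" by (simp only: S_def[symmetric])
    then have "S = of_nat g * S" by simp
    then have "S * (of_nat g - 1) = 0" by (simp add: algebra_simps)
    moreover have "(of_nat g :: complex) \<noteq> 1" using genus by simp
    ultimately have "S = 0" by simp
    then have "c = d * a (i, j)" if "i \<in> {1..g}" for i
      using R[OF that] off[OF that] by (simp add: S_def R_def)
    from this[OF i12(1)] this[OF i12(2)] a12 show ?thesis by auto
  qed
  then show "c = 0" "d = 0" by auto
qed

lemma node_in_component: "l \<in> {1..Suc g} \<Longrightarrow> node g l \<in> component g a j"
proof (cases "l = Suc g")
  case True
  have "node g l = proj_point g (phi g a j (1, 0))"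
    unfolding node_def by (rule proj_point_eqI[of 1]) (simp_all add: True phi_eq)
  then show ?thesis unfolding component_def by (intro CollectI exI[of _ "(1, 0)"]) simp
next
  case False
  assume "l \<in> {1..Suc g}"
  then have l: "l \<in> {1..g}" using False by auto
  have nz: "phi g a j (a (l, j), 1) l \<noteq> 0" using phi_at_node[of "a (l, j)" 1 l l] l by simp
  have "proj_point g (phi g a j (a (l, j), 1)) = node g l"
    unfolding node_def
    by (rule proj_point_eqI[OF nz]) (use phi_at_node[of "a (l, j)" 1 l] l False in auto)
  then show ?thesis unfolding component_def by (intro CollectI exI[of _ "(a (l, j), 1)"]) simp
qed

end

lemma node_inj: "2 \<le> g \<Longrightarrow> inj_on (node g) {1..Suc g}"
proof (rule inj_onI)
  fix l l' assume g: "2 \<le> g" and l: "l \<in> {1..Suc g}" "l' \<in> {1..Suc g}" and eq: "node g l = node g l'"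
  from proj_point_eqD[OF eq[unfolded node_def]]
  obtain c :: complex where c: "c \<noteq> 0"
    "\<forall>i\<in>{1..g}. (if l = Suc g \<or> i = l then 1 else 0) = c * (if l' = Suc g \<or> i = l' then 1 else 0)"
    by (elim exE conjE)
  have *: "l = Suc g \<or> i = l \<longleftrightarrow> l' = Suc g \<or> i = l'" if "i \<in> {1..g}" for i
    using bspec[OF c(2) that] c(1) by (simp split: if_splits)
  have 12: "1 \<in> {1..g}" "2 \<in> {1..g}" using g by auto
  show "l = l'"
  proof (cases "l = Suc g")
    case True
    then show ?thesis using *[OF 12(1)] *[OF 12(2)] by auto
  next
    case False
    then have "l \<in> {1..g}" using l by auto
    then show ?thesis using *[of l] *[OF 12(1)] *[OF 12(2)] False by auto
  qed
qed

text \<open>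
  A common point of the two components that is not a node, and likewise a common tangent line at a
  node, gives an affine relation \<open>x \<alpha>\<^sub>i + y \<beta>\<^sub>i = z\<close> for all \<open>i\<close> with \<open>x\<close>, \<open>y\<close> not both zero. Such a
  relation is excluded by its instances for three values of \<open>i\<close>.
\<close>

theorem canonical_binary_curveI:
  assumes g: "3 \<le> g" and inj: "inj_on (\<lambda>l. a (l, 1)) {1..g}" "inj_on (\<lambda>l. a (l, 2)) {1..g}"
    and det: "(a (1, 1) - a (2, 1)) * (a (1, 2) - a (3, 2)) \<noteq> (a (1, 1) - a (3, 1)) * (a (1, 2) - a (2, 2))"
  shows "canonical_binary_curve g a"
proof -
  interpret C1: distinct_nodes g a 1 by standard (rule g, rule inj(1))
  interpret C2: distinct_nodes g a 2 by standard (rule g, rule inj(2))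
  have affine: "x = 0 \<and> y = 0" if "\<And>i. i \<in> {1..g} \<Longrightarrow> x * a (i, 1) + y * a (i, 2) = z" for x y z
  proof -
    have "1 \<in> {1..g}" "2 \<in> {1..g}" "3 \<in> {1..g}" using g by auto
    note eqs = this[THEN that]
    define D where "D = (a (1, 1) - a (2, 1)) * (a (1, 2) - a (3, 2)) - (a (1, 1) - a (3, 1)) * (a (1, 2) - a (2, 2))"
    have e: "x * (a (1, 1) - a (2, 1)) + y * (a (1, 2) - a (2, 2)) = 0"
      "x * (a (1, 1) - a (3, 1)) + y * (a (1, 2) - a (3, 2)) = 0"
      using eqs by (simp_all add: algebra_simps)
    have "x * D = (x * (a (1, 1) - a (2, 1)) + y * (a (1, 2) - a (2, 2))) * (a (1, 2) - a (3, 2))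
        - (x * (a (1, 1) - a (3, 1)) + y * (a (1, 2) - a (3, 2))) * (a (1, 2) - a (2, 2))"
      by (simp add: D_def algebra_simps)
    moreover have "y * D = (x * (a (1, 1) - a (3, 1)) + y * (a (1, 2) - a (3, 2))) * (a (1, 1) - a (2, 1))
        - (x * (a (1, 1) - a (2, 1)) + y * (a (1, 2) - a (2, 2))) * (a (1, 1) - a (3, 1))"
      by (simp add: D_def algebra_simps)
    moreover have "D \<noteq> 0" using det by (simp add: D_def)
    ultimately show ?thesis unfolding e by simp
  qed
  have common: "(\<exists>l\<in>{1..g}. u \<noteq> 0 \<and> u' \<noteq> 0 \<and> t = a (l, 1) * u \<and> t' = a (l, 2) * u') \<or> u = 0 \<and> u' = 0"
    if nz: "(t, u) \<noteq> (0, 0)" "(t', u') \<noteq> (0, 0)"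
      and eq: "proj_point g (phi g a 1 (t, u)) = proj_point g (phi g a 2 (t', u'))" for t u t' u'
  proof -
    obtain c where c: "c \<noteq> 0" "\<forall>i\<in>{1..g}. phi g a 1 (t, u) i = c * phi g a 2 (t', u') i"
      using proj_point_eqD[OF eq] by blast
    have node_iff: "t = a (l, 1) * u \<longleftrightarrow> t' = a (l, 2) * u'" if "l \<in> {1..g}" for l
      using C1.phi_node_iff[OF nz(1) that] C2.phi_node_iff[OF nz(2) that] c by simp
    show ?thesis
    proof (cases "\<exists>l\<in>{1..g}. t = a (l, 1) * u")
      case True
      then obtain l where l: "l \<in> {1..g}" "t = a (l, 1) * u" by blast
      have "t' = a (l, 2) * u'" using node_iff[OF l(1)] l(2) by (rule iffD1)
      moreover have "u \<noteq> 0" "u' \<noteq> 0" using l(2) calculation nz by auto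
      ultimately show ?thesis using l by blast
    next
      case False
      then have off: "\<forall>l\<in>{1..g}. t \<noteq> a (l, 1) * u" "\<forall>l\<in>{1..g}. t' \<noteq> a (l, 2) * u'"
        using node_iff by auto
      define P where "P = (\<Prod>r\<in>{1..g}. t - a (r, 1) * u)"
      define P' where "P' = (\<Prod>r\<in>{1..g}. t' - a (r, 2) * u')"
      have nzP: "P \<noteq> 0" "P' \<noteq> 0" using off by (simp_all add: P_def P'_def)
      have "c * P' * u * a (i, 1) + (- (P * u')) * a (i, 2) = c * P' * t - P * t'" if i: "i \<in> {1..g}" for i
      proof -
        have "P * (t' - a (i, 2) * u') = c * P' * (t - a (i, 1) * u)"
          unfolding C1.phi_off_nodes(2)[OF off(1) i, folded P_def, symmetric]
            C2.phi_off_nodes(2)[OF off(2) i, folded P'_def, symmetric] bspec[OF c(2) i] by (simp only: mult_ac)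
        then show ?thesis by (simp add: algebra_simps)
      qed
      from affine[OF this] show ?thesis using nzP c(1) by simp
    qed
  qed
  have "component g a 1 \<inter> component g a 2 \<subseteq> node g ` {1..Suc g}"
  proof
    fix Q assume "Q \<in> component g a 1 \<inter> component g a 2"
    then obtain x y where x: "x \<noteq> (0, 0)" "Q = proj_point g (phi g a 1 x)"
      and y: "y \<noteq> (0, 0)" "Q = proj_point g (phi g a 2 y)"
      unfolding component_def by blast
    obtain t u where tu: "x = (t, u)" by (cases x)
    obtain t' u' where tu': "y = (t', u')" by (cases y)
    from common[of t u t' u'] x y
    consider l where "l \<in> {1..g}" "t = a (l, 1) * u" | "u = 0"
      unfolding tu tu' by auto
    then show "Q \<in> node g ` {1..Suc g}"
    proof cases
      case 1
      have tu0: "(t, u) \<noteq> (0, 0)" using x(1) tu by simp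
      have nz: "phi g a 1 (t, u) l \<noteq> 0" using C1.phi_at_node[OF tu0 1 1(1)] by simp
      have "Q = node g l"
        unfolding node_def x(2) tu
        by (rule proj_point_eqI[OF nz]) (use C1.phi_at_node[OF tu0 1] 1 in auto)
      then show ?thesis using 1 by auto
    next
      case 2
      then have "t ^ (g - 1) \<noteq> 0" using x(1) tu by simp
      then have "Q = node g (Suc g)"
        unfolding node_def x(2) tu by (rule proj_point_eqI) (simp add: phi_eq 2)
      then show ?thesis by auto
    qed
  qed
  then have inter: "component g a 1 \<inter> component g a 2 = node g ` {1..Suc g}"
    using C1.node_in_component C2.node_in_component by blast
  have transversal: "tangent g a 1 x \<noteq> tangent g a 2 y"
    if x: "x \<noteq> (0, 0)" and y: "y \<noteq> (0, 0)" and eq: "proj_point g (phi g a 1 x) = proj_point g (phi g a 2 y)" for x y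
  proof
    assume tan: "tangent g a 1 x = tangent g a 2 y"
    obtain t u where tu: "x = (t, u)" by (cases x)
    obtain t' u' where tu': "y = (t', u')" by (cases y)
    have deriv: "\<exists>c' d'. \<forall>i\<in>{1..g}.
      (\<Sum>s\<in>{1..g} - {i}. (c - d * a (s, 1)) * (\<Prod>r\<in>{1..g} - {i} - {s}. t - a (r, 1) * u)) =
      (\<Sum>s\<in>{1..g} - {i}. (c' - d' * a (s, 2)) * (\<Prod>r\<in>{1..g} - {i} - {s}. t' - a (r, 2) * u'))" for c d
    proof -
      have "(\<lambda>i\<in>{1..g}. c * phi_dt g a 1 x i + d * phi_du g a 1 x i) \<in> tangent g a 2 y"
        unfolding tan[symmetric] unfolding tangent_def by blast
      then obtain c' d' where cd: "(\<lambda>i\<in>{1..g}. c * phi_dt g a 1 x i + d * phi_du g a 1 x i) =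
          (\<lambda>i\<in>{1..g}. c' * phi_dt g a 2 y i + d' * phi_du g a 2 y i)"
        unfolding tangent_def by blast
      have "c * phi_dt g a 1 x i + d * phi_du g a 1 x i = c' * phi_dt g a 2 y i + d' * phi_du g a 2 y i"
        if "i \<in> {1..g}" for i using fun_cong[OF cd, of i] that by simp
      then show ?thesis unfolding tu tu' by (intro exI[of _ c'] exI[of _ d'] ballI) (simp only: phi_directional_derivative)
    qed
    from common[of t u t' u'] x y eq
    consider l where "l \<in> {1..g}" "u \<noteq> 0" "u' \<noteq> 0" "t = a (l, 1) * u" "t' = a (l, 2) * u'" | "u = 0" "u' = 0"
      unfolding tu tu' by auto
    then show False
    proof cases
      case 1
      have at_node: "(\<Sum>s\<in>{1..g} - {i}. (c - d * a (s, j)) * (\<Prod>r\<in>{1..g} - {i} - {s}. v - a (r, j) * w)) * (v - a (i, j) * w)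
          = (c - d * a (l, j)) * (\<Prod>r\<in>{1..g} - {l}. v - a (r, j) * w)"
        if i: "i \<in> {1..g}" "i \<noteq> l" and v: "v = a (l, j) * w" for i c d j v w
      proof -
        have "(\<Sum>s\<in>{1..g} - {i}. (c - d * a (s, j)) * (\<Prod>r\<in>{1..g} - {i} - {s}. v - a (r, j) * w)) =
          (\<Sum>s\<in>{1..g} - {i}. if s = l then (c - d * a (l, j)) * (\<Prod>r\<in>{1..g} - {i} - {l}. v - a (r, j) * w) else 0)"
        proof (rule sum.cong[OF refl])
          fix s assume s: "s \<in> {1..g} - {i}"
          have "(\<Prod>r\<in>{1..g} - {i} - {s}. v - a (r, j) * w) = 0" if "s \<noteq> l"
            using that 1 i v by (intro prod_zero bexI[of _ l]) auto
          then show "(c - d * a (s, j)) * (\<Prod>r\<in>{1..g} - {i} - {s}. v - a (r, j) * w) =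
            (if s = l then (c - d * a (l, j)) * (\<Prod>r\<in>{1..g} - {i} - {l}. v - a (r, j) * w) else 0)"
            by auto
        qed
        also have "\<dots> = (c - d * a (l, j)) * (\<Prod>r\<in>{1..g} - {i} - {l}. v - a (r, j) * w)"
          using 1 i by simp
        finally have *: "(\<Sum>s\<in>{1..g} - {i}. (c - d * a (s, j)) * (\<Prod>r\<in>{1..g} - {i} - {s}. v - a (r, j) * w)) =
          (c - d * a (l, j)) * (\<Prod>r\<in>{1..g} - {i} - {l}. v - a (r, j) * w)" .
        have "{1..g} - {l} - {i} = {1..g} - {i} - {l}" by auto
        then have "(\<Prod>r\<in>{1..g} - {l}. v - a (r, j) * w) = (v - a (i, j) * w) * (\<Prod>r\<in>{1..g} - {i} - {l}. v - a (r, j) * w)"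
          using i by (subst prod.remove[of _ i]) auto
        then show ?thesis unfolding * by simp
      qed
      \<comment> \<open>At the finite node l the coordinates \<open>i \<noteq> l\<close> of a tangent vector are a multiple of the
        reciprocals of \<open>t - a\<^sub>i u\<close>.\<close>
      from deriv[of 1 0] obtain c' d' where cd: "\<forall>i\<in>{1..g}.
        (\<Sum>s\<in>{1..g} - {i}. (1 - 0 * a (s, 1)) * (\<Prod>r\<in>{1..g} - {i} - {s}. t - a (r, 1) * u)) =
        (\<Sum>s\<in>{1..g} - {i}. (c' - d' * a (s, 2)) * (\<Prod>r\<in>{1..g} - {i} - {s}. t' - a (r, 2) * u'))" by blast
      define A where "A = (\<Prod>r\<in>{1..g} - {l}. t - a (r, 1) * u)"
      define B where "B = (c' - d' * a (l, 2)) * (\<Prod>r\<in>{1..g} - {l}. t' - a (r, 2) * u')"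
      have "A \<noteq> 0"
        using C1.phi_at_node[of t u l l] 1 x tu by (simp add: A_def phi_eq)
      have rel: "A * (t' - a (i, 2) * u') = B * (t - a (i, 1) * u)" if i: "i \<in> {1..g}" for i
      proof (cases "i = l")
        case True
        then show ?thesis using 1 by simp
      next
        case False
        define S where "S = (\<Sum>s\<in>{1..g} - {i}. (c' - d' * a (s, 2)) * (\<Prod>r\<in>{1..g} - {i} - {s}. t' - a (r, 2) * u'))"
        have "S * (t - a (i, 1) * u) = A"
          using at_node[OF i False 1(4), of 1 0] unfolding bspec[OF cd i] S_def[symmetric] A_def by simp
        moreover have "S * (t' - a (i, 2) * u') = B"
          using at_node[OF i False 1(5), of c' d'] unfolding S_def[symmetric] B_def .
        ultimately show ?thesis by (metis mult.commute mult.left_commute)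
      qed
      have "(- (B * u)) * a (i, 1) + (A * u') * a (i, 2) = A * t' - B * t" if "i \<in> {1..g}" for i
        using rel[OF that] by (simp add: algebra_simps)
      from affine[OF this] show False using \<open>A \<noteq> 0\<close> 1 by simp
    next
      case 2
      then have t: "t \<noteq> 0" "t' \<noteq> 0" using x y tu tu' by auto
      have at_inf: "(\<Sum>s\<in>{1..g} - {i}. (c - d * a (s, j)) * (\<Prod>r\<in>{1..g} - {i} - {s}. v - a (r, j) * 0)) =
          v ^ (g - 2) * (c * of_nat (g - 1) - d * (\<Sum>s\<in>{1..g}. a (s, j)) + d * a (i, j))"
        if i: "i \<in> {1..g}" for i c d j v
      proof -
        have "(\<Sum>s\<in>{1..g} - {i}. (c - d * a (s, j)) * (\<Prod>r\<in>{1..g} - {i} - {s}. v - a (r, j) * 0)) =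
           (\<Sum>s\<in>{1..g} - {i}. v ^ (g - 2) * (c - d * a (s, j)))"
          using i by (intro sum.cong) (auto simp: numeral_2_eq_2)
        also have "\<dots> = v ^ (g - 2) * (c * of_nat (g - 1) - d * (\<Sum>s\<in>{1..g} - {i}. a (s, j)))"
          using i by (simp add: sum_distrib_left[symmetric] sum_subtractf mult_ac)
        also have "(\<Sum>s\<in>{1..g} - {i}. a (s, j)) = (\<Sum>s\<in>{1..g}. a (s, j)) - a (i, j)"
          using sum.remove[OF finite_atLeastAtMost i, of "\<lambda>s. a (s, j)"] by simp
        also have "v ^ (g - 2) * (c * of_nat (g - 1) - d * ((\<Sum>s\<in>{1..g}. a (s, j)) - a (i, j))) =
          v ^ (g - 2) * (c * of_nat (g - 1) - d * (\<Sum>s\<in>{1..g}. a (s, j)) + d * a (i, j))"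
          by (simp add: right_diff_distrib distrib_left)
        finally show ?thesis .
      qed
      \<comment> \<open>At infinity the tangent plane is spanned by \<open>(1, \<dots>, 1)\<close> and \<open>(a\<^sub>i)\<^sub>i\<close>.\<close>
      from deriv[of 0 1] obtain c' d' where cd: "\<forall>i\<in>{1..g}.
        (\<Sum>s\<in>{1..g} - {i}. (0 - 1 * a (s, 1)) * (\<Prod>r\<in>{1..g} - {i} - {s}. t - a (r, 1) * u)) =
        (\<Sum>s\<in>{1..g} - {i}. (c' - d' * a (s, 2)) * (\<Prod>r\<in>{1..g} - {i} - {s}. t' - a (r, 2) * u'))" by blast
      define z where "z = t' ^ (g - 2) * (c' * of_nat (g - 1) - d' * (\<Sum>s\<in>{1..g}. a (s, 2)))
        + t ^ (g - 2) * (\<Sum>s\<in>{1..g}. a (s, 1))"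
      have "t ^ (g - 2) * a (i, 1) + (- (t' ^ (g - 2) * d')) * a (i, 2) = z" if i: "i \<in> {1..g}" for i
        using bspec[OF cd i, unfolded 2 at_inf[OF i]] by (simp add: z_def algebra_simps)
      from affine[OF this] show False using t by simp
    qed
  qed
  show ?thesis
    unfolding canonical_binary_curve_def
    using C1.smooth_rational C2.smooth_rational inter node_inj[of g] g transversal
    by (intro conjI allI impI) auto
qed

section \<open>From genus 2k - 1 to genus 2k\<close>

definition node_differences :: "nat \<Rightarrow> nat \<Rightarrow> (nat \<times> nat \<Rightarrow> complex) \<Rightarrow> complex" where
  "node_differences g j a = (\<Prod>l\<in>{1..g}. \<Prod>r\<in>{1..g} - {l}. a (l, j) - a (r, j))"

lemma node_differences_nonzero: "node_differences g j a \<noteq> 0 \<longleftrightarrow> inj_on (\<lambda>l. a (l, j)) {1..g}"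
  by (auto simp: node_differences_def inj_on_def)

definition non_affine :: "(nat \<times> nat \<Rightarrow> complex) \<Rightarrow> complex" where
  "non_affine a = (a (1, 1) - a (2, 1)) * (a (1, 2) - a (3, 2)) - (a (1, 1) - a (3, 1)) * (a (1, 2) - a (2, 2))"

text \<open>
  The nodes \<open>\<alpha>\<^sub>l = l\<close> and \<open>\<beta>\<^sub>l = l\<^sup>2\<close> show that the conditions can be met.
\<close>

lemma canonical_binary_curve_open:
  assumes g: "3 \<le> g"
  shows "\<exists>f\<in>polynomial_maps ({1..g} \<times> {1, 2}). (\<exists>b. f b \<noteq> 0) \<and> (\<forall>a. f a \<noteq> 0 \<longrightarrow>
    canonical_binary_curve g a \<and> inj_on (\<lambda>l. a (l, 1)) {1..g} \<and> inj_on (\<lambda>l. a (l, 2)) {1..g})"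
proof -
  define f where "f a = node_differences g 1 a * node_differences g 2 a * non_affine a" for a
  define b :: "nat \<times> nat \<Rightarrow> complex" where "b = (\<lambda>(l, j). of_nat (l ^ j))"
  have "inj_on (\<lambda>l. b (l, 1)) {1..g}" "inj_on (\<lambda>l. b (l, 2)) {1..g}"
    by (auto simp: inj_on_def b_def simp flip: of_nat_power)
  moreover have "non_affine b \<noteq> 0" by (simp add: non_affine_def b_def)
  ultimately have "f b \<noteq> 0" by (simp add: f_def node_differences_nonzero del: One_nat_def)
  moreover have "f \<in> polynomial_maps ({1..g} \<times> {1, 2})"
    unfolding f_def[abs_def] node_differences_def non_affine_def using g
    by (intro polynomial_maps_intros) auto
  moreover have "canonical_binary_curve g a \<and> inj_on (\<lambda>l. a (l, 1)) {1..g} \<and> inj_on (\<lambda>l. a (l, 2)) {1..g}"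
    if "f a \<noteq> 0" for a
  proof -
    have nz: "node_differences g 1 a \<noteq> 0" "node_differences g 2 a \<noteq> 0" "non_affine a \<noteq> 0"
      using that by (auto simp: f_def)
    have inj: "inj_on (\<lambda>l. a (l, 1)) {1..g}" "inj_on (\<lambda>l. a (l, 2)) {1..g}"
      using nz(1,2) unfolding node_differences_nonzero by simp_all
    have "canonical_binary_curve g a"
      by (rule canonical_binary_curveI[OF g inj]) (use nz(3) in \<open>simp add: non_affine_def\<close>)
    with inj show ?thesis by blast
  qed
  ultimately show ?thesis by (intro bexI[of _ f] conjI exI[of _ b] allI impI) simp_all
qed

text \<open>
  The increasing enumeration of the indices different from \<open>c\<close>.
\<close>

definition skip :: "nat \<Rightarrow> nat \<Rightarrow> nat" where
  "skip c l = (if l < c then l else Suc l)"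

lemma strict_mono_skip: "strict_mono_on N (skip c)"
  by (auto simp: skip_def strict_mono_on_def)

lemma skip_image:
  assumes "c \<in> {1..Suc g}"
  shows "skip c ` {1..g} = {1..Suc g} - {c}"
proof
  show "skip c ` {1..g} \<subseteq> {1..Suc g} - {c}" by (auto simp: skip_def)
  show "{1..Suc g} - {c} \<subseteq> skip c ` {1..g}"
  proof
    fix l assume l: "l \<in> {1..Suc g} - {c}"
    show "l \<in> skip c ` {1..g}"
      by (rule image_eqI[of _ _ "if l < c then l else l - 1"]) (use l assms in \<open>auto simp: skip_def\<close>)
  qed
qed

text \<open>
  The given curve of genus \<open>g\<close> is placed on the nodes other than \<open>c\<close>.
\<close>

lemma green_surj_deletion_open:
  fixes a0 :: "nat \<times> nat \<Rightarrow> complex"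
  assumes p: "p + 3 \<le> g" and c: "c \<in> {1..Suc g}"
    and inj: "inj_on (\<lambda>l. a0 (l, 1)) {1..g}"
    and surj: "green_surj {1..g} (\<lambda>l. a0 (l, 1)) (\<lambda>l. a0 (l, 2)) p"
  shows "\<exists>f\<in>polynomial_maps ({1..Suc g} \<times> {1, 2 :: nat}). (\<exists>b. f b \<noteq> 0) \<and> (\<forall>a. f a \<noteq> 0 \<longrightarrow>
    inj_on (\<lambda>l. a (l, 1)) ({1..Suc g} - {c}) \<longrightarrow>
    green_surj ({1..Suc g} - {c}) (\<lambda>l. a (l, 1)) (\<lambda>l. a (l, 2)) p)"
proof -
  let ?N = "{1..Suc g} - {c}"
  define b :: "nat \<times> nat \<Rightarrow> complex" where "b = (\<lambda>(l, j). a0 (if l < c then l else l - 1, j))"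
  have b: "(\<lambda>l. b (l, j)) \<circ> skip c = (\<lambda>l. a0 (l, j))" for j
    by (rule ext) (simp add: b_def skip_def)
  have "green_surj (skip c ` {1..g}) (\<lambda>l. b (l, 1)) (\<lambda>l. b (l, 2)) p"
    by (rule green_surj_relabel[OF strict_mono_skip]) (simp only: b surj)
  then have surj': "green_surj ?N (\<lambda>l. b (l, 1)) (\<lambda>l. b (l, 2)) p" by (simp only: skip_image[OF c])
  have "inj_on (\<lambda>l. b (l, 1)) (skip c ` {1..g})"
    by (rule inj_on_imageI) (simp only: b inj)
  then have inj': "inj_on (\<lambda>l. b (l, 1)) ?N" by (simp only: skip_image[OF c])
  have "p + 3 \<le> card ?N" using p c by simp
  from green_surj_open[OF _ _ this inj' surj', of "{1..Suc g} \<times> {1, 2}"]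
  obtain f where f: "f \<in> polynomial_maps ({1..Suc g} \<times> {1, 2})" "f b \<noteq> 0"
    "\<forall>a. f a \<noteq> 0 \<longrightarrow> inj_on (\<lambda>l. a (l, 1)) ?N \<longrightarrow> green_surj ?N (\<lambda>l. a (l, 1)) (\<lambda>l. a (l, 2)) p"
    by auto
  then show ?thesis by (intro bexI[of _ f] conjI exI[of _ b])
qed

theorem corollary4p4:
  fixes k :: nat and a0 :: "nat \<times> nat \<Rightarrow> complex"
  assumes "k \<ge> 2"
    and "canonical_binary_curve (2 * k - 1) a0"
    and "\<forall>p \<le> k - 2. koszul_vanishes (H0_omega_power (2 * k - 1) a0) p 2"
  shows "for_generic_parameters (2 * k) (\<lambda>a. canonical_binary_curve (2 * k) a \<and>
           (\<forall>p \<le> k - 2. koszul_vanishes (H0_omega_power (2 * k) a) p 2))"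
proof -
  define g where "g = 2 * k - 1"
  have g: "2 * k = Suc g" "3 \<le> g" using assms(1) by (auto simp: g_def)
  have inj0: "inj_on (\<lambda>l. a0 (l, 1)) {1..g}" "inj_on (\<lambda>l. a0 (l, 2)) {1..g}"
    using assms(2) smooth_rational_imp_inj unfolding canonical_binary_curve_def g_def by blast+
  interpret C0: binary_curve g a0 by standard (fact g(2), fact inj0(1), fact inj0(2))
  have surj0: "green_surj {1..g} (\<lambda>l. a0 (l, 1)) (\<lambda>l. a0 (l, 2)) p" if p: "p \<le> k - 2" for p
  proof -
    have "p + 3 \<le> g" using p assms(1) by (simp add: g_def)
    from C0.koszul_vanishes_iff_green_surj[OF this] show ?thesis
      using assms(3) p unfolding g_def by blast
  qed
  define V where "V = {1..Suc g} \<times> {1, 2 :: nat}"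
  define X where "X = {1..Suc g} \<times> {..k - 2}"
  \<comment> \<open>The polynomial map f certifies surjectivity for the curve without the node \<open>fst x\<close> in
    degree \<open>snd x\<close>.\<close>
  define good where "good x f \<longleftrightarrow> f \<in> polynomial_maps V \<and> (\<exists>b. f b \<noteq> 0) \<and> (\<forall>a. f a \<noteq> 0 \<longrightarrow>
    inj_on (\<lambda>l. a (l, 1)) ({1..Suc g} - {fst x}) \<longrightarrow>
    green_surj ({1..Suc g} - {fst x}) (\<lambda>l. a (l, 1)) (\<lambda>l. a (l, 2)) (snd x))" for x f
  have "\<exists>f. good x f" if "x \<in> X" for x
  proof -
    have "snd x + 3 \<le> g" "fst x \<in> {1..Suc g}" "snd x \<le> k - 2"
      using that assms(1) by (auto simp: X_def g_def)
    from green_surj_deletion_open[OF this(1,2) inj0(1) surj0[OF this(3)]]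
    show ?thesis unfolding good_def V_def Bex_def .
  qed
  then have "\<forall>x\<in>X. \<exists>f. good x f" by (rule ballI)
  from bchoice[OF this] obtain f where f: "\<forall>x\<in>X. good x (f x)" ..
  from canonical_binary_curve_open[of "Suc g"] g obtain f0 where f0: "f0 \<in> polynomial_maps V" "\<exists>b. f0 b \<noteq> 0"
    "\<forall>a. f0 a \<noteq> 0 \<longrightarrow> canonical_binary_curve (Suc g) a \<and> inj_on (\<lambda>l. a (l, 1)) {1..Suc g} \<and> inj_on (\<lambda>l. a (l, 2)) {1..Suc g}"
    unfolding V_def by auto
  have fX: "f x \<in> polynomial_maps V" "\<exists>b. f x b \<noteq> 0" if "x \<in> X" for x
    using bspec[OF f that] unfolding good_def by blast+
  have prod: "(\<lambda>a. \<Prod>x\<in>X. f x a) \<in> polynomial_maps V"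
    by (intro polynomial_maps_prod fX)
  have "finite X" by (simp add: X_def)
  then have "\<exists>b. (\<Prod>x\<in>X. f x b) \<noteq> 0" by (rule polynomial_maps_prod_nonzero) (fact fX)+
  then obtain b1 where b1: "(\<Prod>x\<in>X. f x b1) \<noteq> 0" ..
  from f0(2) obtain b0 where b0: "f0 b0 \<noteq> 0" ..
  from polynomial_maps_mult_nonzero[OF f0(1) prod, of b0 b1] b0 b1
  obtain b where b: "f0 b * (\<Prod>x\<in>X. f x b) \<noteq> 0" by blast
  show ?thesis
    unfolding g(1)
  proof (rule for_generic_parametersI[where f = "\<lambda>a. f0 a * (\<Prod>x\<in>X. f x a)" and b = b])
    show "(\<lambda>a. f0 a * (\<Prod>x\<in>X. f x a)) \<in> polynomial_maps ({1..Suc g} \<times> {1, 2})"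
      using polynomial_maps.mult[OF f0(1) prod] by (simp only: V_def)
    show "f0 b * (\<Prod>x\<in>X. f x b) \<noteq> 0" by (fact b)
    fix a assume a: "f0 a * (\<Prod>x\<in>X. f x a) \<noteq> 0"
    have "f0 a \<noteq> 0" using a by auto
    with f0(3) have canonical: "canonical_binary_curve (Suc g) a"
      and inj: "inj_on (\<lambda>l. a (l, 1)) {1..Suc g}" "inj_on (\<lambda>l. a (l, 2)) {1..Suc g}" by blast+
    interpret C: binary_curve "Suc g" a by standard (use g in simp, fact inj(1), fact inj(2))
    have "koszul_vanishes (H0_omega_power (Suc g) a) p 2" if p: "p \<le> k - 2" for p
    proof -
      have p': "p + 4 \<le> Suc g" "p + 3 \<le> Suc g" using p assms(1) by (auto simp: g_def)
      have "green_surj {1..Suc g} (\<lambda>l. a (l, 1)) (\<lambda>l. a (l, 2)) p"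
      proof (rule green_surj_from_deletions[OF _ inj])
        fix c assume c: "c \<in> {1..Suc g}"
        then have X: "(c, p) \<in> X" using p by (simp add: X_def)
        then have "f (c, p) a \<noteq> 0" using a \<open>finite X\<close> by auto
        moreover have "inj_on (\<lambda>l. a (l, 1)) ({1..Suc g} - {c})" using inj(1) by (rule inj_on_subset) auto
        ultimately show "green_surj ({1..Suc g} - {c}) (\<lambda>l. a (l, 1)) (\<lambda>l. a (l, 2)) p"
          using bspec[OF f X] unfolding good_def fst_conv snd_conv by blast
      qed (use p' in simp_all)
      then show ?thesis using C.koszul_vanishes_iff_green_surj[OF p'(2)] by blast
    qed
    with canonical show "canonical_binary_curve (Suc g) a \<and> (\<forall>p\<le>k - 2. koszul_vanishes (H0_omega_power (Suc g) a) p 2)"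
      by blast
  qed
qed

end
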